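(* Let $X$ be a projective toric surface. If there exists an ample line bundle $L$ on $X$ with $\dim \Gamma(X, L\otimes \omega_X)=1$, then $X$ is a Gorenstein toric Fano surface.
   Context: Toric varieties are normal and are considered over $\mathbb{C}$. $\omega_X$ denotes the dualizing sheaf of $X$ and $K_X$ a canonical divisor. A Gorenstein toric Fano surface is a projective toric surface $X$ with at worst Gorenstein singularities (so that $K_X$ is a Cartier divisor) whose anti-canonical divisor $-K_X$ is ample. *)

theory Defs
  imports
    "HOL-Algebra.Generated_Rings"
    "HOL-Analysis.Abstract_Topology"
    "HOL-Computational_Algebra.Fraction_Field"
    "HOL-Computational_Algebra.Polynomial"
begin

text \<open>
  Varieties are described as models in the sense of Chevalley and Zariski--Samuel (Commutative
  Algebra II, Ch. VI, Sect. 17): an integral separated scheme of finite type over \<open>\<complex>\<close> with function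
  field \<open>K\<close> is identified with the set of its local rings, which are subrings of \<open>K\<close>. Points of the
  variety \<^emph>\<open>are\<close> their local rings; a point \<open>q\<close> is a generization of \<open>p\<close> iff \<open>p \<subseteq> q\<close>. All points
  are included, not only the closed ones; the generic point is the field itself.

  A toric surface has the function field of its two-dimensional torus, which is \<open>\<complex>(X, Y)\<close>. A choice
  of coordinates on the torus therefore presents every toric surface as a model of this field.
\<close>

section \<open>Rational functions in two variables\<close>

text \<open>The inner polynomial variable is called \<open>X\<close> and the outer one \<open>Y\<close>.\<close>

type_synonym 'k ratfun2 = "'k poly poly fract"

definition const :: "'k::field \<Rightarrow> 'k ratfun2" where
  "const c = Fract [:[:c:]:] 1"

definition coord_X :: "'k::field ratfun2" where
  "coord_X = Fract [:[:0, 1:]:] 1"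

definition coord_Y :: "'k::field ratfun2" where
  "coord_Y = Fract [:0, 1:] 1"

lemma vector_space_ratfun2: "vector_space (\<lambda>(c::'k::field) f. const c * f)"
proof
  fix a b :: 'k and f g :: "'k ratfun2"
  show "const a * (f + g) = const a * f + const a * g"
    by (simp add: ring_distribs)
  have "const (a + b) = const a + const b"
    by (simp add: const_def)
  then show "const (a + b) * f = const a * f + const b * f"
    by (simp add: ring_distribs)
  have "const a * const b = const (a * b)"
    by (simp add: const_def)
  then show "const a * (const b * f) = const (a * b) * f"
    by (simp flip: mult.assoc)
  have "const (1::'k) = 1"
    by (simp add: const_def One_fract_def flip: one_pCons)
  then show "const 1 * f = f"
    by simp
qed

lemma map_poly_pderiv_mult:
  fixes p q :: "'k::field poly poly"
  shows "map_poly pderiv (p * q) = map_poly pderiv p * q + p * map_poly pderiv q"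
proof (rule poly_eqI)
  fix n
  show "Polynomial.coeff (map_poly pderiv (p * q)) n =
      Polynomial.coeff (map_poly pderiv p * q + p * map_poly pderiv q) n"
    unfolding coeff_mult coeff_map_poly[of pderiv, OF pderiv_0] coeff_add
      higher_pderiv_sum[of 1, simplified] sum.distrib[symmetric]
    by (rule sum.cong) (simp_all add: pderiv_mult algebra_simps)
qed

lemma quotient_rule_well_defined:
  fixes d :: "'r::idom \<Rightarrow> 'r"
  assumes d: "\<And>a b. d (a * b) = d a * b + a * d b" and eq: "a * b' = a' * b"
  shows "(d a * b - a * d b) * (b' * b') = (d a' * b' - a' * d b') * (b * b)"
proof -
  have "d a * b' + a * d b' = d a' * b + a' * d b"
    using eq d by metis
  moreover have "(d a * b - a * d b) * (b' * b') - (d a' * b' - a' * d b') * (b * b) =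
      b * b' * (d a * b' + a * d b' - (d a' * b + a' * d b)) -
      (b' * d b + b * d b') * (a * b' - a' * b)"
    by (simp add: algebra_simps)
  ultimately show ?thesis
    using eq by simp
qed

definition fract_derivation :: "('r::idom \<Rightarrow> 'r) \<Rightarrow> 'r fract \<Rightarrow> 'r fract" where
  "fract_derivation d f =
    (THE g. \<forall>a b. b \<noteq> 0 \<and> f = Fract a b \<longrightarrow> g = Fract (d a * b - a * d b) (b * b))"

lemma fract_derivation_Fract:
  fixes d :: "'r::idom \<Rightarrow> 'r"
  assumes "\<And>a b. d (a * b) = d a * b + a * d b" and "b \<noteq> 0"
  shows "fract_derivation d (Fract a b) = Fract (d a * b - a * d b) (b * b)"
  unfolding fract_derivation_def
proof (rule the_equality)
  show "\<forall>a' b'. b' \<noteq> 0 \<and> Fract a b = Fract a' b' \<longrightarrow>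
      Fract (d a * b - a * d b) (b * b) = Fract (d a' * b' - a' * d b') (b' * b')"
    using assms quotient_rule_well_defined[of d] by (auto simp: eq_fract)
qed (use assms in blast)

definition partial_X :: "'k::field ratfun2 \<Rightarrow> 'k ratfun2" where
  "partial_X = fract_derivation (map_poly pderiv)"

definition partial_Y :: "'k::field ratfun2 \<Rightarrow> 'k ratfun2" where
  "partial_Y = fract_derivation pderiv"

lemma partial_X_Fract:
  fixes p q :: "'k::field poly poly"
  assumes "q \<noteq> 0"
  shows "partial_X (Fract p q) =
    Fract (map_poly pderiv p * q - p * map_poly pderiv q) (q * q)"
  unfolding partial_X_def using map_poly_pderiv_mult assms by (rule fract_derivation_Fract)

lemma partial_Y_Fract:
  fixes p q :: "'k::field poly poly"
  assumes "q \<noteq> 0"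
  shows "partial_Y (Fract p q) = Fract (pderiv p * q - p * pderiv q) (q * q)"
  unfolding partial_Y_def
  using assms by (intro fract_derivation_Fract) (simp_all add: pderiv_mult algebra_simps)

text \<open>\<open>da \<and> db = jacobian a b \<cdot> dX \<and> dY\<close>\<close>

definition jacobian :: "'k::field ratfun2 \<Rightarrow> 'k ratfun2 \<Rightarrow> 'k ratfun2" where
  "jacobian a b = partial_X a * partial_Y b - partial_Y a * partial_X b"

section \<open>Subrings of a field\<close>

definition ring_on :: "'k::field set \<Rightarrow> 'k ring" where
  "ring_on A = \<lparr>carrier = A, monoid.mult = (*), one = 1, zero = 0, add = (+)\<rparr>"

definition nonunits :: "'k::field set \<Rightarrow> 'k set" where
  "nonunits A = A - Units (ring_on A)"

definition local_subring :: "'k::field set \<Rightarrow> bool" where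
  "local_subring A \<longleftrightarrow> cring (ring_on A) \<and> ideal (nonunits A) (ring_on A)"

definition dominates :: "'k::field set \<Rightarrow> 'k set \<Rightarrow> bool" where
  "dominates B A \<longleftrightarrow> A \<subseteq> B \<and> nonunits A \<subseteq> nonunits B"

definition localization :: "'k::field set \<Rightarrow> 'k set \<Rightarrow> 'k set" where
  "localization A P = {a / b | a b. a \<in> A \<and> b \<in> A - P}"

text \<open>The local rings of \<open>Spec A\<close>. Primality of \<open>P\<close> includes that \<open>A\<close> is a subring.\<close>

definition affine_model :: "'k::field set \<Rightarrow> 'k set set" where
  "affine_model A = {localization A P | P. primeideal P (ring_on A)}"

definition adjoin :: "'k::field set \<Rightarrow> 'k set \<Rightarrow> 'k set" where
  "adjoin A S = generate_ring (ring_on UNIV) (A \<union> S)"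

definition integrally_closed :: "'k::field set \<Rightarrow> bool" where
  "integrally_closed A \<longleftrightarrow>
    (\<forall>f p. lead_coeff p = 1 \<and> (\<forall>i. Polynomial.coeff p i \<in> A) \<and> poly p f = 0 \<longrightarrow> f \<in> A)"

definition submodule_span :: "'k::field set \<Rightarrow> 'k set \<Rightarrow> 'k set" where
  "submodule_span A S = {\<Sum>s\<in>T. c s * s | T c. finite T \<and> T \<subseteq> S \<and> (\<forall>s\<in>T. c s \<in> A)}"

section \<open>Varieties with function field \<open>\<complex>(X, Y)\<close>\<close>

type_synonym ratfun = "complex ratfun2"

text \<open>Separatedness: no two distinct points are dominated by a common local subring of the function field.\<close>

definition separated_model :: "ratfun set set \<Rightarrow> bool" where
  "separated_model M \<longleftrightarrow>
    (\<forall>p\<in>M. \<forall>q\<in>M. \<forall>A. local_subring A \<and> dominates A p \<and> dominates A q \<longrightarrow> p = q)"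

definition coordinate_ring :: "ratfun set \<Rightarrow> bool" where
  "coordinate_ring A \<longleftrightarrow>
    (\<exists>S. finite S \<and> A = adjoin (range const) S) \<and> localization A {0} = UNIV"

definition variety :: "ratfun set set \<Rightarrow> bool" where
  "variety M \<longleftrightarrow>
    (\<exists>\<A>. finite \<A> \<and> \<A> \<noteq> {} \<and> (\<forall>A\<in>\<A>. coordinate_ring A) \<and> M = (\<Union>A\<in>\<A>. affine_model A)) \<and>
    separated_model M"

definition normal_model :: "ratfun set set \<Rightarrow> bool" where
  "normal_model M \<longleftrightarrow> (\<forall>p\<in>M. integrally_closed p)"

text \<open>
  The closure of the image of \<open>(f\<^sub>0 : \<dots> : f\<^sub>n)\<close> in projective space. The coordinate functions on
  the chart where the homogeneous coordinate of \<open>g = f\<^sub>i\<close> does not vanish are the \<open>f\<^sub>j / f\<^sub>i\<close>.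
\<close>

definition projective_model :: "ratfun set set \<Rightarrow> bool" where
  "projective_model M \<longleftrightarrow>
    (\<exists>F. finite F \<and> M = (\<Union>g\<in>F - {0}. affine_model (adjoin (range const) ((\<lambda>f. f / g) ` F))))"

text \<open>For a subring \<open>A\<close> of \<open>k\<close> this is \<open>A[X\<^sup>\<plusminus>\<^sup>1, Y\<^sup>\<plusminus>\<^sup>1]\<close> inside \<open>k(X, Y)\<close>.\<close>

definition laurent_ring :: "'k::field set \<Rightarrow> 'k ratfun2 set" where
  "laurent_ring A = adjoin (const ` A) {coord_X, inverse coord_X, coord_Y, inverse coord_Y}"

definition torus :: "ratfun set set" where
  "torus = affine_model (laurent_ring UNIV)"

text \<open>
  The product of the torus with \<open>M\<close>, whose function field is \<open>K(S, T)\<close> for \<open>K = \<complex>(X, Y)\<close>. The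
  local rings of the product at the points lying over \<open>p\<close> are localizations of \<open>p[S\<^sup>\<plusminus>\<^sup>1, T\<^sup>\<plusminus>\<^sup>1]\<close>.
\<close>

definition torus_times :: "ratfun set set \<Rightarrow> ratfun ratfun2 set set" where
  "torus_times M = (\<Union>p\<in>M. affine_model (laurent_ring p))"

text \<open>
  The multiplication of the torus corresponds to the homomorphism \<open>\<phi>\<close> of function fields over \<open>\<complex>\<close>
  with \<open>X \<mapsto> S X\<close> and \<open>Y \<mapsto> T Y\<close>. As a rational map from \<open>torus_times M\<close> to \<open>M\<close> it is a morphism
  iff the local ring of every point dominates the image of the local ring of some point of \<open>M\<close>.
  The axioms of a group action then hold automatically, because they hold on the dense torus.
\<close>

definition torus_action_extends :: "ratfun set set \<Rightarrow> bool" where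
  "torus_action_extends M \<longleftrightarrow>
    (\<exists>\<phi> \<in> ring_hom (ring_on UNIV) (ring_on UNIV).
      (\<forall>c. \<phi> (const c) = const (const c)) \<and>
      \<phi> coord_X = coord_X * const coord_X \<and>
      \<phi> coord_Y = coord_Y * const coord_Y \<and>
      (\<forall>q\<in>torus_times M. \<exists>p\<in>M. dominates q (\<phi> ` p)))"

text \<open>The torus is then automatically open and dense in \<open>M\<close>.\<close>

definition toric_surface :: "ratfun set set \<Rightarrow> bool" where
  "toric_surface M \<longleftrightarrow>
    variety M \<and> normal_model M \<and> torus \<subseteq> M \<and> torus_action_extends M"

text \<open>
  The Zariski topology: the loci where a given rational function is regular form a subbasis.
\<close>

definition zariski :: "ratfun set set \<Rightarrow> ratfun set topology" where
  "zariski M = topology_generated_by (range (\<lambda>f. {p \<in> M. f \<in> p}))"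

section \<open>Subsheaves of the function field\<close>

text \<open>
  A sheaf of submodules of the constant sheaf \<open>K\<close> is given by its stalks. On an integral scheme
  every line bundle is isomorphic to such a subsheaf, with transition functions in \<open>K\<close>.
\<close>

type_synonym sheaf = "ratfun set \<Rightarrow> ratfun set"

definition global_sections :: "ratfun set set \<Rightarrow> sheaf \<Rightarrow> ratfun set" where
  "global_sections M F = {f. \<forall>p\<in>M. f \<in> F p}"

definition dim_over_complex :: "ratfun set \<Rightarrow> nat" where
  "dim_over_complex = vector_space.dim (\<lambda>c f. const c * f)"

definition line_bundle :: "ratfun set set \<Rightarrow> sheaf \<Rightarrow> bool" where
  "line_bundle M L \<longleftrightarrow>
    (\<forall>p\<in>M. \<exists>U g. openin (zariski M) U \<and> p \<in> U \<and> g \<noteq> 0 \<and> (\<forall>q\<in>U. L q = (*) g ` q))"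

text \<open>
  If \<open>F\<close> or \<open>G\<close> is invertible, \<open>F \<otimes> G\<close> is isomorphic to the product taken inside \<open>K\<close>.
\<close>

definition tensor :: "sheaf \<Rightarrow> sheaf \<Rightarrow> sheaf" where
  "tensor F G p = submodule_span p {f * g | f g. f \<in> F p \<and> g \<in> G p}"

primrec tensor_power :: "sheaf \<Rightarrow> nat \<Rightarrow> sheaf" where
  "tensor_power L 0 = (\<lambda>p. p)"
| "tensor_power L (Suc n) = tensor L (tensor_power L n)"

definition dual :: "sheaf \<Rightarrow> sheaf" where
  "dual F p = {f. \<forall>g\<in>F p. f * g \<in> p}"

definition nonvanishing_locus :: "ratfun set set \<Rightarrow> sheaf \<Rightarrow> ratfun \<Rightarrow> ratfun set set" where
  "nonvanishing_locus M L s = {p \<in> M. L p = (*) s ` p}"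

text \<open>
  Ampleness as in EGA II, 4.5.2 (and Stacks, 01PS): the affine open sets of the form \<open>M\<^sub>s\<close>, for sections \<open>s\<close> of positive
  powers of \<open>L\<close>, cover \<open>M\<close>.
\<close>

definition ample :: "ratfun set set \<Rightarrow> sheaf \<Rightarrow> bool" where
  "ample M L \<longleftrightarrow> line_bundle M L \<and>
    (\<forall>p\<in>M. \<exists>n\<ge>1. \<exists>s\<in>global_sections M (tensor_power L n).
      p \<in> nonvanishing_locus M (tensor_power L n) s \<and>
      (\<exists>A. nonvanishing_locus M (tensor_power L n) s = affine_model A))"

section \<open>The dualizing sheaf and Gorenstein toric Fano surfaces\<close>

definition codim_one_point :: "ratfun set set \<Rightarrow> ratfun set \<Rightarrow> bool" where
  "codim_one_point M q \<longleftrightarrow> q \<in> M \<and> q \<noteq> UNIV \<and>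
    (\<forall>P. primeideal P (ring_on q) \<longrightarrow> P = {0} \<or> P = nonunits q)"

text \<open>
  On a normal surface the dualizing sheaf is \<open>\<O>(K)\<close>, the sheaf of rational 2-forms that are regular in
  codimension one, i.e. \<open>j\<^sub>* \<Omega>\<^sup>2\<close> for the inclusion \<open>j\<close> of the smooth locus. The form \<open>f dX \<and> dY\<close>
  is represented by \<open>f\<close>; for a point \<open>q\<close> of codimension one, the image of \<open>\<Omega>\<^sup>2\<close> of the local ring
  \<open>q\<close> is spanned by the forms \<open>da \<and> db\<close> with \<open>a, b \<in> q\<close>.
\<close>

definition dualizing_sheaf :: "ratfun set set \<Rightarrow> sheaf" where
  "dualizing_sheaf M p =
    (\<Inter>q\<in>{q. codim_one_point M q \<and> p \<subseteq> q}. submodule_span q {jacobian a b | a b. a \<in> q \<and> b \<in> q})"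

text \<open>
  For normal surfaces, which are Cohen--Macaulay, \<open>M\<close> is Gorenstein iff \<open>\<O>(K)\<close> is invertible,
  i.e. iff a canonical divisor is Cartier. The dual of \<open>\<O>(K)\<close> is \<open>\<O>(-K)\<close>.
\<close>

definition gorenstein :: "ratfun set set \<Rightarrow> bool" where
  "gorenstein M \<longleftrightarrow> line_bundle M (dualizing_sheaf M)"

definition gorenstein_toric_fano_surface :: "ratfun set set \<Rightarrow> bool" where
  "gorenstein_toric_fano_surface M \<longleftrightarrow>
    toric_surface M \<and> projective_model M \<and> gorenstein M \<and> ample M (dual (dualizing_sheaf M))"

end

theory Submission
  imports Defs "HOL-Library.Product_Plus" "HOL-Computational_Algebra.Polynomial_Factorial"
    "HOL-Computational_Algebra.Fundamental_Theorem_Algebra" "HOL-Computational_Algebra.Field_as_Ring"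
begin

text \<open>
  Differentiating the torus action at the unit element shows that every local ring is stable under
  the vector fields \<open>X d/dX\<close> and \<open>Y d/dY\<close>, and hence contains every monomial that occurs in one of
  its Laurent polynomials. It follows that the prime divisors outside the torus are given by
  monomial valuations, \<open>X\<^sup>a Y\<^sup>b \<mapsto> u\<^sub>1 a + u\<^sub>2 b\<close>. A line bundle \<open>L\<close> becomes trivial on the torus, so the
  sections of \<open>L\<close> and of \<open>L \<otimes> \<omega>\<close> are spanned by the lattice points and by the interior lattice points
  of a polygon \<open>{k. u\<^sub>D \<cdot> k \<ge> \<kappa>\<^sub>D for all D}\<close>. If \<open>L\<close> is ample, each edge of the polygon contains two
  lattice points; they are found at the centres of the two rank two monomial valuations that refine
  the valuation of the corresponding divisor. A lattice polygon with exactly one interior lattice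
  point \<open>m\<close> has lattice distance one from \<open>m\<close> to each edge, so the section of \<open>L \<otimes> \<omega>\<close> that belongs to
  \<open>m\<close> generates \<open>L \<otimes> \<omega>\<close> in codimension one, and everywhere by normality. Therefore \<open>\<omega>\<close> is inverse to \<open>L\<close>.
\<close>

section \<open>Subrings of a field and localization\<close>

text \<open>No fan is built, so neither the points of \<open>M\<close> nor the boundary divisors are
  enumerated: each edge of the polygon is studied through its own divisor, and points are reached as
  centres of valuation rings, which projectivity supplies. Separatedness acts through one
  consequence: a point of \<open>M\<close> dominates no other point of \<open>M\<close>. Ampleness
  speaks about powers of \<open>L\<close>, whereas the polygon is that of \<open>L\<close> itself. A
  rank two monomial valuation determines for every function exactly one monomial up to units. Hence
  a monomial section that generates the \<open>n\<close>-th power of \<open>L\<close> at the centre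
  of the valuation has an exponent divisible by \<open>n\<close>, and normality allows the root to
  be taken. The two points found on an edge must also be distinct. If they coincided, the closure of
  the divisor, a complete curve, would lie in an affine open set; but then the residues of the
  functions on that set would be constant, while they have to generate a residue field that is
  transcendental over the constants.\<close>

definition is_subring :: "'k::field set \<Rightarrow> bool" where
  "is_subring A \<longleftrightarrow> 1 \<in> A \<and> (\<forall>x\<in>A. \<forall>y\<in>A. x - y \<in> A \<and> x * y \<in> A)"

definition is_ideal :: "'k::field set \<Rightarrow> 'k set \<Rightarrow> bool" where
  "is_ideal A I \<longleftrightarrow> I \<subseteq> A \<and> 0 \<in> I \<and> (\<forall>x\<in>I. \<forall>y\<in>I. x + y \<in> I) \<and> (\<forall>a\<in>A. \<forall>x\<in>I. a * x \<in> I)"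

definition is_prime :: "'k::field set \<Rightarrow> 'k set \<Rightarrow> bool" where
  "is_prime A P \<longleftrightarrow> is_ideal A P \<and> 1 \<notin> P \<and> (\<forall>x\<in>A. \<forall>y\<in>A. x * y \<in> P \<longrightarrow> x \<in> P \<or> y \<in> P)"

definition unit_set :: "'k::field set \<Rightarrow> 'k set" where
  "unit_set A = {x \<in> A. x \<noteq> 0 \<and> inverse x \<in> A}"

lemma subring_one: "is_subring A \<Longrightarrow> 1 \<in> A"
  and subring_diff: "is_subring A \<Longrightarrow> x \<in> A \<Longrightarrow> y \<in> A \<Longrightarrow> x - y \<in> A"
  and subring_mult: "is_subring A \<Longrightarrow> x \<in> A \<Longrightarrow> y \<in> A \<Longrightarrow> x * y \<in> A"
  unfolding is_subring_def by auto

lemma subring_zero: "is_subring A \<Longrightarrow> 0 \<in> A"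
  using subring_diff[of A 1 1] subring_one[of A] by simp

lemma subring_uminus: "is_subring A \<Longrightarrow> x \<in> A \<Longrightarrow> - x \<in> A"
  using subring_diff[of A 0 x] subring_zero[of A] by simp

lemma subring_add: "is_subring A \<Longrightarrow> x \<in> A \<Longrightarrow> y \<in> A \<Longrightarrow> x + y \<in> A"
  using subring_diff[of A x "-y"] subring_uminus[of A y] by simp

lemma subring_power: "is_subring A \<Longrightarrow> x \<in> A \<Longrightarrow> x ^ n \<in> A"
  by (induction n) (auto intro: subring_mult subring_one)

lemma subring_sum: "is_subring A \<Longrightarrow> (\<And>i. i \<in> S \<Longrightarrow> f i \<in> A) \<Longrightarrow> sum f S \<in> A"
  by (induction S rule: infinite_finite_induct) (auto intro: subring_add subring_zero)

lemmas subring_closed = subring_one subring_zero subring_diff subring_add subring_mult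
  subring_uminus subring_power

lemma ideal_sub: "is_ideal A I \<Longrightarrow> x \<in> I \<Longrightarrow> x \<in> A"
  and ideal_zero: "is_ideal A I \<Longrightarrow> 0 \<in> I"
  and ideal_add: "is_ideal A I \<Longrightarrow> x \<in> I \<Longrightarrow> y \<in> I \<Longrightarrow> x + y \<in> I"
  and ideal_mult: "is_ideal A I \<Longrightarrow> a \<in> A \<Longrightarrow> x \<in> I \<Longrightarrow> a * x \<in> I"
  unfolding is_ideal_def by auto

lemma ideal_mult_right: "is_ideal A I \<Longrightarrow> x \<in> I \<Longrightarrow> a \<in> A \<Longrightarrow> x * a \<in> I"
  using ideal_mult[of A I a x] by (simp add: mult.commute)

lemma ideal_uminus: "is_subring A \<Longrightarrow> is_ideal A I \<Longrightarrow> x \<in> I \<Longrightarrow> - x \<in> I"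
  using ideal_mult[of A I "-1" x] subring_uminus[of A 1] subring_one[of A] by simp

lemma ideal_diff: "is_subring A \<Longrightarrow> is_ideal A I \<Longrightarrow> x \<in> I \<Longrightarrow> y \<in> I \<Longrightarrow> x - y \<in> I"
  using ideal_add[of A I x "-y"] ideal_uminus[of A I y] by simp

lemma ideal_sum: "is_ideal A I \<Longrightarrow> (\<And>i. i \<in> S \<Longrightarrow> f i \<in> I) \<Longrightarrow> sum f S \<in> I"
  by (induction S rule: infinite_finite_induct) (auto intro: ideal_add ideal_zero)

lemma prime_ideal: "is_prime A P \<Longrightarrow> is_ideal A P"
  and prime_one: "is_prime A P \<Longrightarrow> 1 \<notin> P"
  and prime_mult: "is_prime A P \<Longrightarrow> x \<in> A \<Longrightarrow> y \<in> A \<Longrightarrow> x * y \<in> P \<Longrightarrow> x \<in> P \<or> y \<in> P"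
  unfolding is_prime_def by auto

lemma prime_power: "is_subring A \<Longrightarrow> is_prime A P \<Longrightarrow> x \<in> A \<Longrightarrow> x ^ n \<in> P \<Longrightarrow> x \<in> P"
  by (induction n) (auto dest: prime_one prime_mult intro: subring_power)

lemma ring_on_simps [simp]:
  "carrier (ring_on A) = A" "monoid.mult (ring_on A) = (*)" "one (ring_on A) = 1"
  "zero (ring_on A) = 0" "add (ring_on A) = (+)"
  by (simp_all add: ring_on_def)

lemma a_inv_ring_on: "cring (ring_on A) \<Longrightarrow> x \<in> A \<Longrightarrow> \<ominus>\<^bsub>ring_on A\<^esub> x = - x"
proof -
  assume "cring (ring_on A)" "x \<in> A"
  then interpret cring "ring_on A" by simp
  have "x + \<ominus>\<^bsub>ring_on A\<^esub> x = 0"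
    using r_neg[of x] \<open>x \<in> A\<close> by simp
  then show ?thesis
    by (simp add: add_eq_0_iff)
qed

text \<open>\<open>ring_on A\<close> carries the operations of the ambient field, so its additive
  inverses are those of the field and being a ring is a mere closure condition. This and the next
  equivalences replace structures with carriers by conditions on sets.\<close>

lemma cring_ring_on_iff: "cring (ring_on A) \<longleftrightarrow> is_subring A"
proof
  assume "cring (ring_on A)"
  then interpret cring "ring_on A" .
  have uminus: "- y \<in> A" if "y \<in> A" for y
    using a_inv_closed[of y] a_inv_ring_on[OF is_cring that] that by simp
  have "x - y \<in> A" if "x \<in> A" "y \<in> A" for x y
    using a_closed[of x "- y"] uminus[of y] that by simp
  then show "is_subring A"
    using one_closed m_closed by (auto simp: is_subring_def)
next
  assume A: "is_subring A"
  show "cring (ring_on A)"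
  proof (rule cringI)
    show "abelian_group (ring_on A)"
    proof (rule abelian_groupI)
      fix x assume "x \<in> carrier (ring_on A)"
      then show "\<exists>y\<in>carrier (ring_on A). y \<oplus>\<^bsub>ring_on A\<^esub> x = \<zero>\<^bsub>ring_on A\<^esub>"
        using subring_uminus[OF A] by (intro bexI[of _ "-x"]) auto
    qed (use A in \<open>auto intro: subring_closed\<close>)
    show "comm_monoid (ring_on A)"
      by (rule comm_monoidI) (use A in \<open>auto intro: subring_closed\<close>)
  qed (auto simp: algebra_simps)
qed

lemma ideal_ring_on_iff:
  assumes A: "is_subring A"
  shows "ideal I (ring_on A) \<longleftrightarrow> is_ideal A I"
proof
  assume "ideal I (ring_on A)"
  then interpret ideal I "ring_on A" .
  show "is_ideal A I"
    unfolding is_ideal_def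
    using a_subset additive_subgroup.zero_closed[OF additive_subgroup_axioms]
      additive_subgroup.a_closed[OF additive_subgroup_axioms] I_l_closed by auto
next
  assume I: "is_ideal A I"
  interpret cring "ring_on A"
    using A by (simp add: cring_ring_on_iff)
  have inv: "inv\<^bsub>add_monoid (ring_on A)\<^esub> x = - x" if "x \<in> A" for x
    using a_inv_ring_on[OF is_cring that] by (simp add: a_inv_def)
  show "ideal I (ring_on A)"
  proof (rule idealI)
    show "ring (ring_on A)" ..
    show "subgroup I (add_monoid (ring_on A))"
    proof (rule group.subgroupI)
      show "Group.group (add_monoid (ring_on A))" ..
      fix a assume "a \<in> I"
      then show "inv\<^bsub>add_monoid (ring_on A)\<^esub> a \<in> I"
        using inv[of a] ideal_uminus[OF A I, of a] ideal_sub[OF I, of a] by simp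
    qed (use I A in \<open>auto intro: ideal_add ideal_zero dest: ideal_sub\<close>)
  qed (use I in \<open>auto intro: ideal_mult ideal_mult_right\<close>)
qed

lemma primeideal_ring_on_iff:
  "primeideal P (ring_on A) \<longleftrightarrow> is_subring A \<and> is_prime A P"
proof
  assume "primeideal P (ring_on A)"
  then interpret primeideal P "ring_on A" .
  have A: "is_subring A"
    using is_cring by (simp add: cring_ring_on_iff)
  have I: "is_ideal A P"
    using is_ideal ideal_ring_on_iff[OF A] by simp
  have "1 \<notin> P"
    using I_notcarr ideal_mult[OF I, of _ 1] ideal_sub[OF I] by auto
  then show "is_subring A \<and> is_prime A P"
    using A I I_prime by (auto simp: is_prime_def)
next
  assume *: "is_subring A \<and> is_prime A P"
  then have "A \<noteq> P"
    using prime_one subring_one by blast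
  with * show "primeideal P (ring_on A)"
    by (intro primeidealI)
      (auto simp: ideal_ring_on_iff cring_ring_on_iff is_prime_def)
qed

lemma Units_ring_on: "Units (ring_on A) = unit_set A"
proof (intro equalityI subsetI)
  fix x assume "x \<in> unit_set A"
  then show "x \<in> Units (ring_on A)"
    by (auto simp: Units_def unit_set_def intro!: bexI[of _ "inverse x"])
next
  fix x assume "x \<in> Units (ring_on A)"
  then obtain y where "x \<in> A" "y \<in> A" "x * y = 1"
    by (auto simp: Units_def)
  then show "x \<in> unit_set A"
    using inverse_unique[of x y] by (auto simp: unit_set_def)
qed

lemma nonunits_eq: "nonunits A = A - unit_set A"
  by (simp add: nonunits_def Units_ring_on)

lemma local_subring_iff:
  "local_subring A \<longleftrightarrow> is_subring A \<and> is_ideal A (nonunits A)"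
  by (auto simp: local_subring_def cring_ring_on_iff ideal_ring_on_iff)

lemma local_subring_is_subring: "local_subring A \<Longrightarrow> is_subring A"
  and local_subring_ideal: "local_subring A \<Longrightarrow> is_ideal A (nonunits A)"
  by (simp_all add: local_subring_iff)

lemma unit_setI: "x \<in> A \<Longrightarrow> inverse x \<in> A \<Longrightarrow> x \<noteq> 0 \<Longrightarrow> x \<in> unit_set A"
  by (simp add: unit_set_def)

lemma unit_setD: "x \<in> unit_set A \<Longrightarrow> x \<in> A" "x \<in> unit_set A \<Longrightarrow> inverse x \<in> A"
    "x \<in> unit_set A \<Longrightarrow> x \<noteq> 0"
  by (simp_all add: unit_set_def)

lemma unit_set_one: "is_subring A \<Longrightarrow> 1 \<in> unit_set A"
  by (simp add: unit_set_def subring_one)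

lemma unit_set_mult: "is_subring A \<Longrightarrow> x \<in> unit_set A \<Longrightarrow> y \<in> unit_set A \<Longrightarrow> x * y \<in> unit_set A"
  by (auto simp: unit_set_def subring_mult)

lemma unit_set_inverse: "x \<in> unit_set A \<Longrightarrow> inverse x \<in> unit_set A"
  by (auto simp: unit_set_def)

lemma unit_set_divide: "is_subring A \<Longrightarrow> x \<in> unit_set A \<Longrightarrow> y \<in> unit_set A \<Longrightarrow> x / y \<in> unit_set A"
  by (simp add: divide_inverse unit_set_mult unit_set_inverse)

lemma unit_set_power: "is_subring A \<Longrightarrow> x \<in> unit_set A \<Longrightarrow> x ^ n \<in> unit_set A"
  by (induction n) (auto intro: unit_set_mult unit_set_one)

lemma unit_set_powi: "is_subring A \<Longrightarrow> x \<in> unit_set A \<Longrightarrow> x powi n \<in> unit_set A"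
  by (auto simp: power_int_def intro: unit_set_power unit_set_inverse)

text \<open>The quotient of \<open>x ^ (n - 1)\<close> by the unit \<open>x ^ n\<close> inverts
  \<open>x\<close>. Used to pass from a generator of a power of a line bundle to a generator of the
  bundle.\<close>

lemma unit_set_of_power:
  assumes "is_subring A" "x \<in> A" "x ^ n \<in> unit_set A" "n > 0"
  shows "x \<in> unit_set A"
proof (rule unit_setI)
  show "x \<noteq> 0"
    using assms(3,4) by (auto simp: unit_set_def power_0_left)
  then have "inverse x = x ^ (n - 1) * inverse (x ^ n)"
    using assms(4) by (cases n) (simp_all add: field_simps)
  then show "inverse x \<in> A"
    using assms by (auto intro!: subring_mult subring_power dest: unit_setD)
qed fact

lemma unit_set_mono: "A \<subseteq> B \<Longrightarrow> unit_set A \<subseteq> unit_set B"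
  by (auto simp: unit_set_def)

lemma mem_image_mult_iff: "(g::'k::field) \<noteq> 0 \<Longrightarrow> x \<in> (*) g ` A \<longleftrightarrow> x / g \<in> A"
  by (auto simp: image_iff field_simps intro: bexI[of _ "x / g"])

lemma image_mult_unit:
  assumes "is_subring A" "e \<in> unit_set A"
  shows "(*) (g * e) ` A = (*) g ` A"
proof (intro equalityI subsetI)
  fix x assume "x \<in> (*) (g * e) ` A"
  then obtain a where "a \<in> A" "x = g * (e * a)"
    by (auto simp: mult.assoc)
  then show "x \<in> (*) g ` A"
    using assms by (auto intro!: imageI subring_mult dest: unit_setD)
next
  fix x assume "x \<in> (*) g ` A"
  then obtain a where a: "a \<in> A" "x = g * a"
    by auto
  have "inverse e * a \<in> A" "x = g * e * (inverse e * a)"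
    using a assms unit_setD[OF assms(2)] by (auto intro: subring_mult)
  then show "x \<in> (*) (g * e) ` A"
    by blast
qed

text \<open>Two generators of one principal fractional ideal differ by a unit. This turns equality
  of stalks into a statement about units and, on a discrete valuation ring, about
  valuations.\<close>

lemma image_mult_eq_iff:
  assumes "is_subring A" "g \<noteq> 0" "h \<noteq> 0"
  shows "(*) g ` A = (*) h ` A \<longleftrightarrow> h / g \<in> unit_set A"
proof
  assume eq: "(*) g ` A = (*) h ` A"
  have "h \<in> (*) g ` A" "g \<in> (*) h ` A"
    using subring_one[OF assms(1)] eq by force+
  then have "h / g \<in> A" "g / h \<in> A"
    using mem_image_mult_iff[OF assms(2), THEN iffD1, of h A]
      mem_image_mult_iff[OF assms(3), THEN iffD1, of g A] by simp_all
  then show "h / g \<in> unit_set A"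
    using assms by (intro unit_setI) (auto simp: inverse_eq_divide)
next
  assume "h / g \<in> unit_set A"
  then show "(*) g ` A = (*) h ` A"
    using image_mult_unit[OF assms(1), of "h / g" g] assms(2) by simp
qed

lemma is_subring_UNIV: "is_subring UNIV"
  by (simp add: is_subring_def)

lemma adjoin_subring: "is_subring (adjoin (A::'k::field set) S)"
proof -
  interpret cring "ring_on (UNIV :: 'k set)"
    by (simp add: cring_ring_on_iff is_subring_UNIV)
  have neg: "\<ominus>\<^bsub>ring_on UNIV\<^esub> x = - x" for x :: 'k
    using a_inv_ring_on[OF is_cring] by simp
  have a_inv: "- x \<in> adjoin A S" if "x \<in> adjoin A S" for x
    using generate_ring.a_inv[of x "ring_on UNIV" "A \<union> S"] that by (simp add: adjoin_def neg)
  have add: "x + y \<in> adjoin A S" if "x \<in> adjoin A S" "y \<in> adjoin A S" for x y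
    using generate_ring.eng_add[of x "ring_on UNIV" "A \<union> S" y] that by (simp add: adjoin_def)
  have mul: "x * y \<in> adjoin A S" if "x \<in> adjoin A S" "y \<in> adjoin A S" for x y
    using generate_ring.eng_mult[of x "ring_on UNIV" "A \<union> S" y] that by (simp add: adjoin_def)
  have "1 \<in> adjoin A S"
    using generate_ring.one[of "ring_on UNIV" "A \<union> S"] by (simp add: adjoin_def)
  then show ?thesis
    using add[OF _ a_inv] mul by (auto simp: is_subring_def)
qed

lemma adjoin_base: "A \<subseteq> adjoin A S" and adjoin_gens: "S \<subseteq> adjoin A S"
  by (auto simp: adjoin_def intro: generate_ring.incl)

lemma adjoin_least:
  fixes A B S :: "'k::field set"
  assumes "is_subring B" "A \<subseteq> B" "S \<subseteq> B"
  shows "adjoin A S \<subseteq> B"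
proof -
  interpret cring "ring_on (UNIV :: 'k set)"
    by (simp add: cring_ring_on_iff is_subring_UNIV)
  have neg: "\<ominus>\<^bsub>ring_on UNIV\<^esub> x = - x" for x :: 'k
    using a_inv_ring_on[OF is_cring] by simp
  show ?thesis
  proof
    fix x assume "x \<in> adjoin A S"
    then show "x \<in> B"
      unfolding adjoin_def
      by (induction rule: generate_ring.induct)
        (use assms in \<open>auto simp: neg intro: subring_closed\<close>)
  qed
qed

section \<open>Localization at a prime, inside the field\<close>

context
  fixes A P :: "'k::field set"
  assumes A: "is_subring A" and P: "is_prime A P"
begin

lemma localization_den_mult: "b \<in> A - P \<Longrightarrow> d \<in> A - P \<Longrightarrow> b * d \<in> A - P"
  using A P by (auto intro: subring_mult dest: prime_mult)

lemma localization_den_nonzero: "b \<in> A - P \<Longrightarrow> b \<noteq> 0"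
  using ideal_zero[OF prime_ideal[OF P]] by auto

lemma localizationI: "a \<in> A \<Longrightarrow> b \<in> A - P \<Longrightarrow> a / b \<in> localization A P"
  by (auto simp: localization_def)

lemma localizationE:
  assumes "x \<in> localization A P"
  obtains a b where "a \<in> A" "b \<in> A - P" "b \<noteq> 0" "x = a / b"
  using assms localization_den_nonzero by (auto simp: localization_def)

lemma subset_localization: "A \<subseteq> localization A P"
proof
  fix x assume "x \<in> A"
  then show "x \<in> localization A P"
    using localizationI[of x 1] subring_one[OF A] prime_one[OF P] by auto
qed

lemma localization_subring: "is_subring (localization A P)"
  unfolding is_subring_def
proof (intro conjI ballI)
  show "1 \<in> localization A P"
    using subset_localization subring_one[OF A] by auto
next
  fix x y assume "x \<in> localization A P" "y \<in> localization A P"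
  then obtain a b c d where *: "a \<in> A" "b \<in> A - P" "b \<noteq> 0" "x = a / b"
      "c \<in> A" "d \<in> A - P" "d \<noteq> 0" "y = c / d"
    by (elim localizationE) blast
  have "x - y = (a * d - c * b) / (b * d)" "x * y = (a * c) / (b * d)"
    using * by (simp_all add: field_simps)
  then show "x - y \<in> localization A P" "x * y \<in> localization A P"
    using * localization_den_mult[of b d]
    by (auto intro!: localizationI subring_closed A)
qed

lemma unit_localization_iff:
  assumes "a \<in> A" "b \<in> A - P"
  shows "a / b \<in> unit_set (localization A P) \<longleftrightarrow> a \<notin> P"
proof
  assume unit: "a / b \<in> unit_set (localization A P)"
  then have "a \<noteq> 0"
    by (auto simp: unit_set_def)
  have "b / a \<in> localization A P"
    using unit_setD(2)[OF unit] by simp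
  then obtain c d where *: "c \<in> A" "d \<in> A - P" "d \<noteq> 0" "b / a = c / d"
    by (elim localizationE)
  then have eq: "b * d = c * a"
    using \<open>a \<noteq> 0\<close> by (simp add: field_simps)
  show "a \<notin> P"
  proof
    assume "a \<in> P"
    then have "b * d \<in> P"
      using eq ideal_mult[OF prime_ideal[OF P]] * by simp
    then show False
      using localization_den_mult[of b d] assms * by auto
  qed
next
  assume "a \<notin> P"
  then have "a \<noteq> 0"
    using ideal_zero[OF prime_ideal[OF P]] by auto
  then show "a / b \<in> unit_set (localization A P)"
    using \<open>a \<notin> P\<close> assms localization_den_nonzero[of b] localizationI[of a b] localizationI[of b a]
    by (intro unit_setI) auto
qed

lemma unit_localization_iff':
  assumes "a \<in> A" shows "a \<in> unit_set (localization A P) \<longleftrightarrow> a \<notin> P"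
  using unit_localization_iff[of a 1] assms subring_one[OF A] prime_one[OF P] by auto

lemma nonunits_localization: "nonunits (localization A P) = {a / b | a b. a \<in> P \<and> b \<in> A - P}"
proof (intro equalityI subsetI)
  fix x assume "x \<in> nonunits (localization A P)"
  then have "x \<in> localization A P" "x \<notin> unit_set (localization A P)"
    by (simp_all add: nonunits_eq)
  then show "x \<in> {a / b | a b. a \<in> P \<and> b \<in> A - P}"
    using unit_localization_iff by (elim localizationE) auto
next
  fix x assume "x \<in> {a / b | a b. a \<in> P \<and> b \<in> A - P}"
  then obtain a b where *: "x = a / b" "a \<in> P" "b \<in> A - P"
    by auto
  then have "a \<in> A"
    using ideal_sub[OF prime_ideal[OF P]] by auto
  then show "x \<in> nonunits (localization A P)"
    using * unit_localization_iff[of a b] localizationI by (simp add: nonunits_eq)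
qed

lemma local_localization: "local_subring (localization A P)"
  unfolding local_subring_iff is_ideal_def
proof (intro conjI ballI)
  have I: "is_ideal A P"
    by (rule prime_ideal[OF P])
  show "is_subring (localization A P)"
    by (rule localization_subring)
  show "nonunits (localization A P) \<subseteq> localization A P"
    by (auto simp: nonunits_def)
  show "0 \<in> nonunits (localization A P)"
    using subring_zero[OF localization_subring] by (simp add: nonunits_eq unit_set_def)
  fix x y assume y: "y \<in> nonunits (localization A P)"
  then obtain c d where cd: "y = c / d" "c \<in> P" "d \<in> A - P"
    by (auto simp: nonunits_localization)
  {
    assume "x \<in> nonunits (localization A P)"
    then obtain a b where ab: "x = a / b" "a \<in> P" "b \<in> A - P"
      by (auto simp: nonunits_localization)
    have "x + y = (d * a + b * c) / (b * d)"
      using ab cd localization_den_nonzero by (simp add: field_simps)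
    then show "x + y \<in> nonunits (localization A P)"
      using ab cd localization_den_mult[of b d] ideal_mult[OF I] ideal_add[OF I]
      unfolding nonunits_localization by blast
  }
  {
    assume "x \<in> localization A P"
    then obtain a b where ab: "x = a / b" "a \<in> A" "b \<in> A - P"
      by (auto elim: localizationE)
    have "x * y = (a * c) / (b * d)"
      using ab cd by simp
    then show "x * y \<in> nonunits (localization A P)"
      using ab cd localization_den_mult[of b d] ideal_mult[OF I]
      unfolding nonunits_localization by blast
  }
qed

lemma prime_contraction:
  assumes Q: "is_prime (localization A P) Q"
  shows "is_prime A (Q \<inter> A)"
proof -
  have "x \<in> Q \<or> y \<in> Q" if "x \<in> A" "y \<in> A" "x * y \<in> Q" for x y
    using prime_mult[OF Q _ _ that(3)] subset_localization that by blast
  moreover have "a * x \<in> Q" if "a \<in> A" "x \<in> Q" for a x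
    using ideal_mult[OF prime_ideal[OF Q]] subset_localization that by blast
  ultimately show ?thesis
    using A prime_one[OF Q] ideal_add[OF prime_ideal[OF Q]] ideal_zero[OF prime_ideal[OF Q]]
    by (auto simp: is_prime_def is_ideal_def intro: subring_add subring_mult subring_zero)
qed

text \<open>Denominators of the first localization are units there and can be cleared before
  localizing again. Hence a localization of a point of an affine model is a point of the same
  model.\<close>

lemma localization_localization:
  assumes Q: "is_prime (localization A P) Q"
  shows "localization (localization A P) Q = localization A (Q \<inter> A)"
proof (intro equalityI subsetI)
  fix x assume "x \<in> localization (localization A P) Q"
  then obtain y z where yz: "x = y / z" "y \<in> localization A P" "z \<in> localization A P" "z \<notin> Q"
    by (auto simp: localization_def)
  from yz obtain a b c d where *: "a \<in> A" "b \<in> A - P" "b \<noteq> 0" "y = a / b"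
      "c \<in> A" "d \<in> A - P" "d \<noteq> 0" "z = c / d"
    by (elim localizationE) blast
  have "z * (b * d) \<notin> Q"
  proof
    assume *: "z * (b * d) \<in> Q"
    have bd: "b * d \<in> unit_set (localization A P)"
      using localization_den_mult[of b d] \<open>b \<in> A - P\<close> \<open>d \<in> A - P\<close> unit_localization_iff'[of "b * d"]
      by auto
    have "z * (b * d) * inverse (b * d) \<in> Q"
      using ideal_mult_right[OF prime_ideal[OF Q] *] unit_setD(2)[OF bd] by blast
    then show False
      using yz(4) nonzero_mult_div_cancel_right[OF unit_setD(3)[OF bd], of z]
      by (simp only: divide_inverse)
  qed
  moreover have "z * (b * d) = c * b"
    using * by simp
  moreover have "x = (a * d) / (c * b)"
    using * yz by simp
  moreover have "a * d \<in> A" "c * b \<in> A"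
    using * A by (auto intro: subring_mult)
  ultimately show "x \<in> localization A (Q \<inter> A)"
    unfolding localization_def by auto
next
  fix x assume "x \<in> localization A (Q \<inter> A)"
  then show "x \<in> localization (localization A P) Q"
  proof -
    from \<open>x \<in> localization A (Q \<inter> A)\<close> obtain a b where "x = a / b" "a \<in> A" "b \<in> A" "b \<notin> Q"
      by (auto simp: localization_def)
    moreover from this have "a \<in> localization A P" "b \<in> localization A P"
      using subset_localization by auto
    ultimately show ?thesis
      unfolding localization_def[of "localization A P"] by blast
  qed
qed

end

lemma localization_nonunits:
  assumes "local_subring D"
  shows "is_prime D (nonunits D)" "localization D (nonunits D) = D"
proof -
  have D: "is_subring D" and I: "is_ideal D (nonunits D)"
    using assms by (simp_all add: local_subring_iff)
  show P: "is_prime D (nonunits D)"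
    using I D unit_set_one[OF D] unit_set_mult[OF D] by (auto simp: is_prime_def nonunits_eq)
  show "localization D (nonunits D) = D"
  proof
    show "localization D (nonunits D) \<subseteq> D"
      using D by (auto simp: localization_def nonunits_eq divide_inverse intro!: subring_mult dest: unit_setD)
  qed (rule subset_localization[OF D P])
qed

lemma prime_subset_nonunits:
  assumes "is_subring D" "is_prime D Q"
  shows "Q \<subseteq> nonunits D"
proof
  fix x assume x: "x \<in> Q"
  have "x \<notin> unit_set D"
  proof
    assume "x \<in> unit_set D"
    then have "x * inverse x \<in> Q" "x \<noteq> 0"
      using ideal_mult_right[OF prime_ideal[OF assms(2)] x] by (auto dest: unit_setD)
    then show False
      using prime_one[OF assms(2)] by simp
  qed
  then show "x \<in> nonunits D"
    using x ideal_sub[OF prime_ideal[OF assms(2)]] assms(1) by (auto simp: nonunits_eq)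
qed

section \<open>Noetherian rings and discrete valuation rings\<close>

text \<open>Stated by chains, because the uses below exhibit an explicit ascending sequence of
  ideals or pick a maximal one.\<close>

definition noetherian :: "'k::field set \<Rightarrow> bool" where
  "noetherian A \<longleftrightarrow> is_subring A \<and>
    (\<forall>I :: nat \<Rightarrow> 'k set. (\<forall>n. is_ideal A (I n)) \<and> (\<forall>n. I n \<subseteq> I (Suc n)) \<longrightarrow>
      (\<exists>N. \<forall>n\<ge>N. I n = I N))"

lemma noetherian_chain:
  assumes "noetherian A" "\<And>n. is_ideal A (I n)" "\<And>n. I n \<subseteq> I (Suc n)"
  obtains N where "\<And>n. n \<ge> N \<Longrightarrow> I n = I N"
  using assms unfolding noetherian_def by meson

lemma noetherian_subring: "noetherian A \<Longrightarrow> is_subring A"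
  by (simp add: noetherian_def)

lemma noetherian_maximal:
  assumes A: "noetherian A" and S: "S \<noteq> {}" "\<And>I. I \<in> S \<Longrightarrow> is_ideal A I"
  obtains I where "I \<in> S" "\<And>J. J \<in> S \<Longrightarrow> I \<subseteq> J \<Longrightarrow> J = I"
proof -
  have "\<exists>I\<in>S. \<forall>J\<in>S. I \<subseteq> J \<longrightarrow> J = I"
  proof (rule ccontr)
    assume "\<not> ?thesis"
    then have step: "\<exists>J. J \<in> S \<and> I \<subset> J" if "I \<in> S" for I
      using that by blast
    have "\<exists>F. \<forall>n::nat. F n \<in> S \<and> F n \<subset> F (Suc n)"
    proof (rule dependent_nat_choice)
      show "\<exists>I. I \<in> S"
        using S(1) by blast
    qed (rule step)
    then obtain F :: "nat \<Rightarrow> 'a set" where F: "\<And>n. F n \<in> S" "\<And>n. F n \<subset> F (Suc n)"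
      by metis
    obtain N where "\<And>n. n \<ge> N \<Longrightarrow> F n = F N"
      using noetherian_chain[OF A, of F] F S(2) by (metis psubset_imp_subset)
    from this[of "Suc N"] show False
      using F(2)[of N] by auto
  qed
  then show ?thesis
    using that by blast
qed

lemma noetherian_field:
  assumes A: "is_subring A" and inv: "\<And>x. x \<in> A \<Longrightarrow> inverse x \<in> A"
  shows "noetherian A"
  unfolding noetherian_def
proof (intro conjI allI impI A)
  fix I :: "nat \<Rightarrow> _ set" assume *: "(\<forall>n. is_ideal A (I n)) \<and> (\<forall>n. I n \<subseteq> I (Suc n))"
  have full: "I n = A" if ne: "I n \<noteq> {0}" for n
  proof -
    have I: "is_ideal A (I n)"
      using * by simp
    obtain x where x: "x \<in> I n" "x \<noteq> 0"
      using ne ideal_zero[OF I] by auto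
    have "y \<in> I n" if "y \<in> A" for y
    proof -
      have "y * inverse x * x \<in> I n"
        using x that ideal_sub[OF I] by (intro ideal_mult[OF I] subring_mult[OF A] inv)
      then show ?thesis
        using x by (simp add: mult.assoc)
    qed
    then show ?thesis
      using ideal_sub[OF I] by blast
  qed
  have mono: "I m \<subseteq> I n" if "m \<le> n" for m n
    using lift_Suc_mono_le[of I] * that by blast
  show "\<exists>N. \<forall>n\<ge>N. I n = I N"
  proof (cases "\<exists>N. I N \<noteq> {0}")
    case True
    then obtain N where N: "I N \<noteq> {0}" by blast
    have "I n \<noteq> {0}" if "n \<ge> N" for n
      using mono[OF that] N * ideal_zero[of A "I N"] by auto
    then have "\<forall>n\<ge>N. I n = A"
      using full by blast
    then show ?thesis
      by (intro exI[of _ N]) simp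
  qed auto
qed

section \<open>Hilbert's basis theorem\<close>

definition polys_over :: "'k::field set \<Rightarrow> 'k poly set" where
  "polys_over A = {p. \<forall>i. Polynomial.coeff p i \<in> A}"

lemma polys_over_coeff: "p \<in> polys_over A \<Longrightarrow> Polynomial.coeff p i \<in> A"
  by (simp add: polys_over_def)

context
  fixes A :: "'k::field set"
  assumes A: "is_subring A"
begin

lemma polys_over_add: "p \<in> polys_over A \<Longrightarrow> q \<in> polys_over A \<Longrightarrow> p + q \<in> polys_over A"
  and polys_over_diff: "p \<in> polys_over A \<Longrightarrow> q \<in> polys_over A \<Longrightarrow> p - q \<in> polys_over A"
  and polys_over_mult: "p \<in> polys_over A \<Longrightarrow> q \<in> polys_over A \<Longrightarrow> p * q \<in> polys_over A"
  and polys_over_pCons: "c \<in> A \<Longrightarrow> p \<in> polys_over A \<Longrightarrow> pCons c p \<in> polys_over A"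
  and polys_over_smult: "c \<in> A \<Longrightarrow> p \<in> polys_over A \<Longrightarrow> Polynomial.smult c p \<in> polys_over A"
  and polys_over_zero: "0 \<in> polys_over A"
  and polys_over_one: "1 \<in> polys_over A"
  and polys_over_monom: "c \<in> A \<Longrightarrow> Polynomial.monom c n \<in> polys_over A"
  by (auto simp: polys_over_def coeff_mult coeff_pCons split: nat.split
      intro!: subring_sum[OF A] subring_closed[OF A])

lemma adjoin_single: "adjoin A {a} = {poly p a | p. p \<in> polys_over A}" (is "_ = ?B")
proof
  have "is_subring ?B"
    unfolding is_subring_def
  proof (intro conjI ballI)
    show "1 \<in> ?B"
      using polys_over_one by (force intro: exI[of _ 1])
    fix x y assume "x \<in> ?B" "y \<in> ?B"
    then obtain p q where "x = poly p a" "y = poly q a" "p \<in> polys_over A" "q \<in> polys_over A"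
      by auto
    then show "x - y \<in> ?B" "x * y \<in> ?B"
      using polys_over_diff[of p q] polys_over_mult[of p q] by (auto simp flip: poly_diff poly_mult)
  qed
  moreover have "A \<subseteq> ?B"
    using polys_over_pCons[OF _ polys_over_zero] by (force intro: exI[of _ "[:_:]"])
  moreover have "a \<in> ?B"
    using polys_over_pCons[OF subring_zero[OF A] polys_over_one]
    by (auto intro!: exI[of _ "pCons 0 1"])
  ultimately show "adjoin A {a} \<subseteq> ?B"
    by (intro adjoin_least) auto
  have S: "is_subring (adjoin A {a})"
    by (rule adjoin_subring)
  show "?B \<subseteq> adjoin A {a}"
    using adjoin_base[of A "{a}"] adjoin_gens[of "{a}" A]
    by (auto simp: poly_altdef intro!: subring_sum[OF S] subring_mult[OF S] subring_power[OF S]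
        dest: polys_over_coeff)
qed

end

text \<open>Hilbert's argument with ideals of leading coefficients. An ideal of
  \<open>adjoin A {a}\<close> is tested on the polynomials \<open>p\<close> with
  \<open>poly p a\<close> in it, that is, on its preimage in the polynomial ring, so algebraic
  relations of \<open>a\<close> do no harm.\<close>

lemma noetherian_adjoin_single:
  fixes A :: "'k::field set"
  assumes noeth: "noetherian A"
  shows "noetherian (adjoin A {a})"
  unfolding noetherian_def
proof (intro conjI allI impI adjoin_subring)
  fix I :: "nat \<Rightarrow> 'k set"
  define B where "B = adjoin A {a}"
  assume *: "(\<forall>n. is_ideal (adjoin A {a}) (I n)) \<and> (\<forall>n. I n \<subseteq> I (Suc n))"
  have A: "is_subring A"
    by (rule noetherian_subring[OF noeth])
  have B: "is_subring B"
    by (simp add: B_def adjoin_subring)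
  have I: "is_ideal B (I j)" for j
    using * by (simp add: B_def)
  have AB: "A \<subseteq> B" and aB: "a \<in> B"
    using adjoin_base[of A "{a}"] adjoin_gens[of "{a}" A] by (auto simp: B_def)
  have mono: "I i \<subseteq> I j" if "i \<le> j" for i j
    using lift_Suc_mono_le[of I] * that by blast
  \<comment> \<open>Coefficients at position \<open>n\<close> of polynomials of degree at most
    \<open>n\<close>; admitting smaller degrees puts 0 into the set and makes it an ideal.\<close>
  define L where "L n j = {Polynomial.coeff p n | p. p \<in> polys_over A \<and> degree p \<le> n \<and> poly p a \<in> I j}"
    for n j
  have L_ideal: "is_ideal A (L n j)" for n j
    unfolding is_ideal_def
  proof (intro conjI ballI)
    show "L n j \<subseteq> A"
      by (auto simp: L_def polys_over_coeff)
    show "0 \<in> L n j"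
      using polys_over_zero[OF A] ideal_zero[OF I] by (force simp: L_def intro: exI[of _ 0])
    fix x y assume y: "y \<in> L n j"
    then obtain q where q: "y = Polynomial.coeff q n" "q \<in> polys_over A" "degree q \<le> n" "poly q a \<in> I j"
      by (auto simp: L_def)
    {
      assume "x \<in> L n j"
      then obtain p where p: "x = Polynomial.coeff p n" "p \<in> polys_over A" "degree p \<le> n" "poly p a \<in> I j"
        by (auto simp: L_def)
      have "x + y = Polynomial.coeff (p + q) n" "p + q \<in> polys_over A" "degree (p + q) \<le> n"
        "poly (p + q) a \<in> I j"
        using p q ideal_add[OF I] polys_over_add[OF A] by (auto intro: degree_add_le)
      then show "x + y \<in> L n j"
        unfolding L_def by blast
    }
    {
      assume "x \<in> A"
      then have "x * y = Polynomial.coeff (Polynomial.smult x q) n" "Polynomial.smult x q \<in> polys_over A"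
        "degree (Polynomial.smult x q) \<le> n" "poly (Polynomial.smult x q) a \<in> I j"
        using q ideal_mult[OF I] polys_over_smult[OF A] AB by (auto intro: order_trans[OF degree_smult_le])
      then show "x * y \<in> L n j"
        unfolding L_def by blast
    }
  qed
  have L_mono_right: "L n i \<subseteq> L n j" if "i \<le> j" for n i j
    using mono[OF that] by (auto simp: L_def)
  have L_Suc: "L n j \<subseteq> L (Suc n) j" for n j
  proof
    fix x assume "x \<in> L n j"
    then obtain p where p: "x = Polynomial.coeff p n" "p \<in> polys_over A" "degree p \<le> n" "poly p a \<in> I j"
      by (auto simp: L_def)
    have "x = Polynomial.coeff (pCons 0 p) (Suc n)" "pCons 0 p \<in> polys_over A"
      "degree (pCons 0 p) \<le> Suc n" "poly (pCons 0 p) a \<in> I j"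
      using p ideal_mult[OF I aB] polys_over_pCons[OF A subring_zero[OF A]]
      by (auto intro: order_trans[OF degree_pCons_le])
    then show "x \<in> L (Suc n) j"
      unfolding L_def by blast
  qed
  have L_mono_left: "L m j \<subseteq> L n j" if "m \<le> n" for m n j
    using lift_Suc_mono_le[of "\<lambda>n. L n j"] L_Suc that by blast
  \<comment> \<open>The family is monotone in both indices, so stability along the diagonal settles
    all \<open>n, j \<ge> N\<close>; the finitely many rows \<open>n < N\<close> stabilize
    separately.\<close>
  have "L n n \<subseteq> L (Suc n) (Suc n)" for n
    using L_Suc[of n n] L_mono_right[of n "Suc n" "Suc n"] by auto
  then obtain N where N: "\<And>n. n \<ge> N \<Longrightarrow> L n n = L N N"
    using noetherian_chain[OF noeth, of "\<lambda>n. L n n", OF L_ideal] by blast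
  have high: "L n j = L N N" if "n \<ge> N" "j \<ge> N" for n j
  proof
    show "L N N \<subseteq> L n j"
      using L_mono_left[OF that(1), of N] L_mono_right[OF that(2), of n] by blast
    have "L n j \<subseteq> L (max n j) (max n j)"
      using L_mono_left[of n "max n j" j] L_mono_right[of j "max n j" "max n j"] by auto
    then show "L n j \<subseteq> L N N"
      using N[of "max n j"] that by auto
  qed
  have "\<exists>M. \<forall>j\<ge>M. L n j = L n M" for n
    using noetherian_chain[OF noeth, of "\<lambda>j. L n j", OF L_ideal] L_mono_right[OF le_SucI[OF order_refl]]
    by meson
  then obtain M where M: "\<And>n j. j \<ge> M n \<Longrightarrow> L n j = L n (M n)"
    by metis
  \<comment> \<open>The sum is a crude common bound for the thresholds of the rows below
    \<open>N\<close>.\<close>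
  define J where "J = N + (\<Sum>n<N. M n)"
  have stable: "L n j = L n J" if "j \<ge> J" for n j
  proof (cases "n < N")
    case True
    then have "M n \<le> (\<Sum>n<N. M n)"
      by (intro member_le_sum) auto
    then show ?thesis
      using M[of n j] M[of n J] that by (simp add: J_def)
  next
    case False
    then show ?thesis
      using high[of n j] high[of n J] that by (simp add: J_def)
  qed
  \<comment> \<open>Subtracting an element of \<open>I J\<close> with the same top coefficient
    lowers the degree bound.\<close>
  have main: "poly p a \<in> I J" if "j \<ge> J" "p \<in> polys_over A" "degree p \<le> d" "poly p a \<in> I j" for j d p
    using that(2-)
  proof (induction d arbitrary: p)
    case (0 p)
    then have "Polynomial.coeff p 0 \<in> L 0 J"
      using stable[OF that(1), of 0] by (auto simp: L_def)
    then obtain q where "Polynomial.coeff p 0 = Polynomial.coeff q 0" "degree q \<le> 0" "poly q a \<in> I J"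
      by (auto simp: L_def)
    then show ?case
      using 0 by (auto elim!: degree_eq_zeroE)
  next
    case (Suc d p)
    then have "Polynomial.coeff p (Suc d) \<in> L (Suc d) J"
      using stable[OF that(1), of "Suc d"] by (auto simp: L_def)
    then obtain q where q: "Polynomial.coeff p (Suc d) = Polynomial.coeff q (Suc d)" "q \<in> polys_over A"
        "degree q \<le> Suc d" "poly q a \<in> I J"
      by (auto simp: L_def)
    have deg: "degree (p - q) \<le> d"
    proof (rule degree_le, intro allI impI)
      fix i assume "d < i"
      then consider "i = Suc d" | "i > Suc d" by linarith
      then show "Polynomial.coeff (p - q) i = 0"
        using Suc.prems(2) q by cases (auto simp: coeff_eq_0)
    qed
    have "poly (p - q) a \<in> I j"
      using ideal_diff[OF B I Suc.prems(3)] q(4) mono[OF that(1)] by auto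
    then have "poly (p - q) a \<in> I J"
      using Suc.IH[of "p - q"] polys_over_diff[OF A Suc.prems(1) q(2)] deg by blast
    then have "poly (p - q) a + poly q a \<in> I J"
      using ideal_add[OF I] q(4) by blast
    then show ?case
      by simp
  qed
  have "I j = I J" if "j \<ge> J" for j
  proof
    show "I j \<subseteq> I J"
    proof
      fix x assume x: "x \<in> I j"
      then have "x \<in> adjoin A {a}"
        using ideal_sub[OF I] by (simp add: B_def)
      then obtain p where "p \<in> polys_over A" "x = poly p a"
        by (auto simp: adjoin_single[OF A])
      then show "x \<in> I J"
        using main[OF that, of p "degree p"] x by simp
    qed
  qed (rule mono[OF that])
  then show "\<exists>N. \<forall>n\<ge>N. I n = I N"
    by blast
qed

lemma adjoin_insert: "adjoin A (insert a S) = adjoin (adjoin A S) {a}"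
proof
  show "adjoin A (insert a S) \<subseteq> adjoin (adjoin A S) {a}"
    using adjoin_base[of A S] adjoin_gens[of S A] adjoin_base[of "adjoin A S" "{a}"]
      adjoin_gens[of "{a}" "adjoin A S"]
    by (intro adjoin_least adjoin_subring) blast+
  show "adjoin (adjoin A S) {a} \<subseteq> adjoin A (insert a S)"
    using adjoin_base[of A "insert a S"] adjoin_gens[of "insert a S" A]
    by (intro adjoin_least adjoin_subring) blast+
qed

lemma adjoin_empty: "is_subring A \<Longrightarrow> adjoin A {} = A"
  using adjoin_least[of A A "{}"] adjoin_base[of A "{}"] by auto

lemma noetherian_adjoin: "finite S \<Longrightarrow> noetherian A \<Longrightarrow> noetherian (adjoin A S)"
proof (induction S rule: finite_induct)
  case empty
  then show ?case
    by (simp add: adjoin_empty noetherian_subring)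
next
  case (insert a S)
  then show ?case
    unfolding adjoin_insert[of A a S] by (intro noetherian_adjoin_single) simp
qed

text \<open>An ideal of the localization is recovered from its contraction to \<open>A\<close> by
  dividing by denominators, so a chain is stable once its contractions are.\<close>

lemma noetherian_localization:
  assumes A: "noetherian A" and P: "is_prime A P"
  shows "noetherian (localization A P)"
proof -
  have sA: "is_subring A"
    by (rule noetherian_subring[OF A])
  note sub = subset_localization[OF sA P]
  have contr: "is_ideal A (I \<inter> A)" if "is_ideal (localization A P) I" for I
    using sub ideal_zero[OF that] ideal_add[OF that] ideal_mult[OF that]
    unfolding is_ideal_def by (auto intro: subring_zero[OF sA] subring_add[OF sA] subring_mult[OF sA])
  have ext: "I \<subseteq> J" if I: "is_ideal (localization A P) I" and J: "is_ideal (localization A P) J"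
    and le: "I \<inter> A \<subseteq> J" for I J
  proof
    fix x assume x: "x \<in> I"
    then obtain a b where ab: "a \<in> A" "b \<in> A - P" "b \<noteq> 0" "x = a / b"
      using ideal_sub[OF I] by (blast elim: localizationE[OF sA P])
    have "b * x \<in> I"
      using ideal_mult[OF I, of b x] x ab sub by auto
    then have "a \<in> J"
      using ab le by auto
    then have "(1 / b) * a \<in> J"
      using ab by (intro ideal_mult[OF J] localizationI[OF sA P] subring_one[OF sA]) auto
    then show "x \<in> J"
      using ab by simp
  qed
  show ?thesis
    unfolding noetherian_def
  proof (intro conjI allI impI localization_subring sA P)
    fix I :: "nat \<Rightarrow> _ set"
    assume I: "(\<forall>n. is_ideal (localization A P) (I n)) \<and> (\<forall>n. I n \<subseteq> I (Suc n))"
    obtain N where N: "\<And>n. n \<ge> N \<Longrightarrow> I n \<inter> A = I N \<inter> A"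
      using noetherian_chain[OF A, of "\<lambda>n. I n \<inter> A"] I contr by blast
    then have "I n = I N" if "n \<ge> N" for n
      using that I ext[of "I n" "I N"] ext[of "I N" "I n"] by blast
    then show "\<exists>N. \<forall>n\<ge>N. I n = I N"
      by blast
  qed
qed

text \<open>The ascending chain of the modules \<open>A y + A c y + \<dots> + A c\<^sup>n y\<close> replaces the determinant trick.\<close>

lemma almost_integral_mem:
  fixes A :: "'k::field set"
  assumes noeth: "noetherian A" and closed: "integrally_closed A"
    and "y \<noteq> 0" and y: "\<And>n. c ^ n * y \<in> A"
  shows "c \<in> A"
proof -
  have A: "is_subring A"
    by (rule noetherian_subring[OF noeth])
  define J where "J n = {poly p c * y | p. p \<in> polys_over A \<and> degree p \<le> n}" for n
  have mem: "poly p c * y \<in> A" if "p \<in> polys_over A" for p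
    unfolding poly_altdef sum_distrib_right mult.assoc
    by (rule subring_sum[OF A], rule subring_mult[OF A polys_over_coeff[OF that] y])
  have "is_ideal A (J n)" for n
    unfolding is_ideal_def
  proof (intro conjI ballI)
    show "J n \<subseteq> A"
      using mem by (auto simp: J_def)
    show "0 \<in> J n"
      using polys_over_zero[OF A] by (force simp: J_def intro: exI[of _ 0])
    fix x z assume "z \<in> J n"
    then obtain q where q: "z = poly q c * y" "q \<in> polys_over A" "degree q \<le> n"
      by (auto simp: J_def)
    {
      assume "x \<in> J n"
      then obtain p where p: "x = poly p c * y" "p \<in> polys_over A" "degree p \<le> n"
        by (auto simp: J_def)
      have "x + z = poly (p + q) c * y" "p + q \<in> polys_over A" "degree (p + q) \<le> n"
        using p q polys_over_add[OF A] by (auto intro: degree_add_le simp: algebra_simps)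
      then show "x + z \<in> J n"
        unfolding J_def by blast
    }
    {
      assume "x \<in> A"
      then have "x * z = poly (Polynomial.smult x q) c * y" "Polynomial.smult x q \<in> polys_over A"
        "degree (Polynomial.smult x q) \<le> n"
        using q polys_over_smult[OF A] by (auto intro: order_trans[OF degree_smult_le])
      then show "x * z \<in> J n"
        unfolding J_def by blast
    }
  qed
  moreover have "J n \<subseteq> J (Suc n)" for n
    unfolding J_def using le_SucI by blast
  ultimately obtain N where N: "\<And>n. n \<ge> N \<Longrightarrow> J n = J N"
    using noetherian_chain[OF noeth] by metis
  \<comment> \<open>\<open>J (Suc N) = J N\<close> expresses \<open>c ^ Suc N * y\<close> by lower
    powers of \<open>c\<close> times \<open>y\<close>; cancelling \<open>y\<close> leaves a monic
    equation for \<open>c\<close>.\<close>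
  have "poly (Polynomial.monom 1 (Suc N)) c * y \<in> J (Suc N)"
    unfolding J_def using polys_over_monom[OF A subring_one[OF A]] by (blast intro: degree_monom_le)
  then have "poly (Polynomial.monom 1 (Suc N)) c * y \<in> J N"
    using N[of "Suc N"] by simp
  then obtain p where p: "poly (Polynomial.monom 1 (Suc N)) c * y = poly p c * y"
      "p \<in> polys_over A" "degree p \<le> N"
    unfolding J_def by blast
  define q where "q = Polynomial.monom 1 (Suc N) - p"
  have "poly q c = 0"
    using p(1) \<open>y \<noteq> 0\<close> by (simp add: q_def)
  moreover have "q \<in> polys_over A"
    unfolding q_def using p by (intro polys_over_diff polys_over_monom subring_one A)
  moreover have "lead_coeff q = 1"
  proof -
    have "Polynomial.coeff q (Suc N) = 1"
      using p by (simp add: q_def coeff_eq_0)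
    moreover have "degree q = Suc N"
    proof (rule antisym)
      show "degree q \<le> Suc N"
        unfolding q_def using p by (intro degree_diff_le) (auto simp: degree_monom_le)
      show "Suc N \<le> degree q"
        using \<open>Polynomial.coeff q (Suc N) = 1\<close> by (intro le_degree) simp
    qed
    ultimately show ?thesis
      by simp
  qed
  ultimately show ?thesis
    using closed unfolding integrally_closed_def polys_over_def by blast
qed

section \<open>Discrete valuation rings from normality\<close>

definition is_dvr :: "'k::field set \<Rightarrow> 'k \<Rightarrow> bool" where
  "is_dvr D t \<longleftrightarrow> is_subring D \<and> t \<in> D \<and> t \<noteq> 0 \<and> inverse t \<notin> D \<and>
    (\<forall>f. f \<noteq> 0 \<longrightarrow> (\<exists>n::int. f / t powi n \<in> unit_set D))"

text \<open>If \<open>f\<close> could be divided by \<open>t\<close> forever, the principal ideals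
  of \<open>f / t ^ n\<close> would form an ascending chain, and its stability at \<open>N\<close>
  would put \<open>inverse t\<close> into \<open>D\<close>. A general \<open>f\<close> is a quotient
  of two elements of \<open>D\<close>.\<close>

lemma dvr_of_principal_maximal:
  fixes D :: "'k::field set"
  assumes noeth: "noetherian D" and frac: "\<And>f. \<exists>g\<in>D. g \<noteq> 0 \<and> g * f \<in> D"
    and t: "t \<in> D" "t \<noteq> 0" "inverse t \<notin> D"
    and div: "\<And>f. f \<in> D \<Longrightarrow> f \<notin> unit_set D \<Longrightarrow> f / t \<in> D"
  shows "is_dvr D t"
proof -
  have D: "is_subring D"
    by (rule noetherian_subring[OF noeth])
  have pos: "\<exists>n::nat. f / t ^ n \<in> unit_set D" if "f \<in> D" "f \<noteq> 0" for f
  proof (rule ccontr)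
    assume no: "\<not> ?thesis"
    have mem: "f / t ^ n \<in> D" for n
    proof (induction n)
      case (Suc n)
      then have "f / t ^ n / t \<in> D"
        using no div[of "f / t ^ n"] by blast
      then show ?case
        by (simp add: mult.commute)
    qed (use that in simp)
    define J where "J n = (*) (f / t ^ n) ` D" for n
    have "is_ideal D (J n)" for n
      unfolding is_ideal_def J_def
    proof (intro conjI ballI)
      show "(*) (f / t ^ n) ` D \<subseteq> D"
        using subring_mult[OF D mem] by auto
      show "0 \<in> (*) (f / t ^ n) ` D"
        using subring_zero[OF D] by (auto intro!: image_eqI[of _ _ 0])
      fix x y assume "y \<in> (*) (f / t ^ n) ` D"
      then obtain b where b: "y = f / t ^ n * b" "b \<in> D"
        by auto
      {
        assume "x \<in> (*) (f / t ^ n) ` D"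
        then obtain a where a: "x = f / t ^ n * a" "a \<in> D"
          by auto
        show "x + y \<in> (*) (f / t ^ n) ` D"
          using a b subring_add[OF D] by (auto intro!: image_eqI[of _ _ "a + b"] simp only: distrib_left)
      }
      {
        assume "x \<in> D"
        then show "x * y \<in> (*) (f / t ^ n) ` D"
          using b subring_mult[OF D] by (auto intro!: image_eqI[of _ _ "x * b"] simp: algebra_simps)
      }
    qed
    moreover have "J n \<subseteq> J (Suc n)" for n
    proof
      fix x assume "x \<in> J n"
      then obtain b where "x = f / t ^ n * b" "b \<in> D"
        by (auto simp: J_def)
      then show "x \<in> J (Suc n)"
        using t subring_mult[OF D] by (auto simp: J_def intro!: image_eqI[of _ _ "t * b"])
    qed
    ultimately obtain N where N: "\<And>n. n \<ge> N \<Longrightarrow> J n = J N"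
      using noetherian_chain[OF noeth] by metis
    have "f / t ^ Suc N \<in> J (Suc N)"
      using subring_one[OF D] by (auto simp: J_def intro!: image_eqI[of _ _ 1])
    then have "f / t ^ Suc N \<in> J N"
      using N[of "Suc N"] by simp
    then obtain b where "f / t ^ Suc N = f / t ^ N * b" "b \<in> D"
      by (auto simp: J_def)
    then have "inverse t = b"
      using t that by (simp add: field_simps)
    then show False
      using t \<open>b \<in> D\<close> by simp
  qed
  have "\<exists>n::int. f / t powi n \<in> unit_set D" if f: "f \<noteq> 0" for f
  proof -
    obtain g where g: "g \<in> D" "g \<noteq> 0" "g * f \<in> D"
      using frac by blast
    obtain m n where mn: "g / t ^ m \<in> unit_set D" "g * f / t ^ n \<in> unit_set D"
      using pos[of g] pos[of "g * f"] g f by auto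
    have "(g * f / t ^ n) / (g / t ^ m) = f / t powi (int n - int m)"
      using g t by (simp add: power_int_diff field_simps)
    then show ?thesis
      using unit_set_divide[OF D mn(2,1)] by metis
  qed
  then show ?thesis
    using D t by (simp add: is_dvr_def)
qed

text \<open>A maximal denominator ideal \<open>Q\<close> is prime. If multiplication by
  \<open>c\<close> mapped \<open>Q\<close> into itself, then \<open>c\<close> would be almost
  integral and lie in \<open>A\<close>. So \<open>y * c\<close> is outside \<open>Q\<close> for some
  \<open>y \<in> Q\<close>; at \<open>Q\<close> it is a unit, dividing by \<open>y\<close> amounts
  to multiplying by \<open>c\<close>, and thus \<open>y\<close> generates the maximal ideal.\<close>

lemma exists_dvr_avoiding:
  fixes A :: "'k::field set"
  assumes noeth: "noetherian A" and closed: "integrally_closed A"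
    and frac: "\<And>f. \<exists>g\<in>A. g \<noteq> 0 \<and> g * f \<in> A" and x: "x \<notin> A"
  obtains Q t where "is_prime A Q" "x \<notin> localization A Q" "is_dvr (localization A Q) t"
proof -
  have A: "is_subring A"
    by (rule noetherian_subring[OF noeth])
  define col where "col c = {a \<in> A. a * c \<in> A}" for c
  \<comment> \<open>Only multiples of \<open>x\<close> compete. A denominator of \<open>x\<close> is
    one of \<open>c = d * x\<close> as well and thus lies in \<open>Q\<close>, which keeps
    \<open>x\<close> out of the localization at \<open>Q\<close>.\<close>
  define S where "S = {col c | c. c \<in> (\<lambda>a. a * x) ` A \<and> c \<notin> A}"
  have col_ideal: "is_ideal A (col c)" for c
    unfolding is_ideal_def col_def
    by (auto simp: distrib_right mult.assoc
        subring_zero[OF A] subring_add[OF A] subring_mult[OF A])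
  have "col x \<in> S"
    using subring_one[OF A] x by (force simp: S_def)
  then have "S \<noteq> {}"
    by blast
  moreover have "is_ideal A I" if "I \<in> S" for I
    using that col_ideal by (auto simp: S_def)
  ultimately obtain Q where "Q \<in> S" and max: "\<And>J. J \<in> S \<Longrightarrow> Q \<subseteq> J \<Longrightarrow> J = Q"
    using noetherian_maximal[OF noeth] by metis
  then obtain c d where c: "Q = col c" "c = d * x" "d \<in> A" "c \<notin> A"
    by (auto simp: S_def)
  have Q: "is_prime A Q"
    unfolding is_prime_def
  proof (intro conjI ballI impI)
    show "is_ideal A Q"
      using c col_ideal by simp
    show "1 \<notin> Q"
      using c by (simp add: col_def)
    fix a b assume ab: "a \<in> A" "b \<in> A" "a * b \<in> Q"
    show "a \<in> Q \<or> b \<in> Q"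
    proof (rule disjCI)
      assume "b \<notin> Q"
      then have "b * c \<notin> A"
        using ab c by (simp add: col_def)
      moreover have "b * c \<in> (\<lambda>a. a * x) ` A"
        using c ab subring_mult[OF A] by (auto intro!: image_eqI[of _ _ "b * d"])
      ultimately have "col (b * c) \<in> S"
        unfolding S_def by blast
      moreover have "Q \<subseteq> col (b * c)"
      proof
        fix z assume "z \<in> Q"
        then have "z \<in> A" "b * (z * c) \<in> A"
          using ab subring_mult[OF A, of b] unfolding c(1) col_def by blast+
        then show "z \<in> col (b * c)"
          by (simp add: col_def mult.left_commute)
      qed
      ultimately have "col (b * c) = Q"
        by (rule max)
      moreover have "a \<in> col (b * c)"
        using ab c by (simp add: col_def mult.assoc)
      ultimately show "a \<in> Q"
        by simp
    qed
  qed
  let ?D = "localization A Q"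
  have D: "is_subring ?D"
    by (rule localization_subring[OF A Q])
  have "x \<notin> ?D"
  proof
    assume "x \<in> ?D"
    then obtain a b where ab: "a \<in> A" "b \<in> A - Q" "b \<noteq> 0" "x = a / b"
      by (rule localizationE[OF A Q])
    have "b * c = d * a"
      using ab c by simp
    then have "b \<in> Q"
      using ab c subring_mult[OF A] by (simp add: col_def)
    then show False
      using ab by simp
  qed
  moreover have "\<exists>y\<in>Q. y * c \<notin> Q"
  proof (rule ccontr)
    assume "\<not> ?thesis"
    then have stab: "y * c \<in> Q" if "y \<in> Q" for y
      using that by blast
    obtain y where y: "y \<in> Q" "y \<noteq> 0"
      using frac[of c] c by (auto simp: col_def)
    have "c ^ n * y \<in> Q" for n
    proof (induction n)
      case (Suc n)
      then show ?case
        using stab[of "c ^ n * y"] by (simp add: ac_simps)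
    qed (use y in simp)
    then have "c \<in> A"
      using almost_integral_mem[OF noeth closed y(2)] ideal_sub[OF prime_ideal[OF Q]] by blast
    then show False
      using c by simp
  qed
  then obtain y where y: "y \<in> Q" "y * c \<notin> Q"
    by blast
  have yA: "y \<in> A" "y * c \<in> A"
    using y c by (auto simp: col_def)
  have "y \<noteq> 0"
    using y ideal_zero[OF prime_ideal[OF Q]] by auto
  have "is_dvr ?D y"
  proof (rule dvr_of_principal_maximal)
    show "noetherian ?D"
      by (rule noetherian_localization[OF noeth Q])
    show "\<exists>g\<in>?D. g \<noteq> 0 \<and> g * f \<in> ?D" for f
      using frac[of f] subset_localization[OF A Q] by blast
    show "y \<in> ?D"
      using yA subset_localization[OF A Q] by blast
    show "inverse y \<notin> ?D"
      using unit_localization_iff'[OF A Q yA(1)] y \<open>y \<in> ?D\<close> \<open>y \<noteq> 0\<close> by (auto simp: unit_set_def)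
    fix f assume "f \<in> ?D" "f \<notin> unit_set ?D"
    then have "f \<in> nonunits ?D"
      by (simp add: nonunits_eq)
    then obtain a b where ab: "f = a / b" "a \<in> Q" "b \<in> A - Q"
      by (auto simp: nonunits_localization[OF A Q])
    have "b \<noteq> 0" "c \<noteq> 0"
      using localization_den_nonzero[OF A Q ab(3)] c subring_zero[OF A] by auto
    then have "f / y = (a * c) / (b * (y * c))"
      using ab \<open>y \<noteq> 0\<close> by (simp add: field_simps)
    moreover have "a * c \<in> A" "b * (y * c) \<in> A - Q"
      using ab c yA y localization_den_mult[OF A Q, of b "y * c"] by (auto simp: col_def)
    ultimately show "f / y \<in> ?D"
      using localizationI[OF A Q] by metis
  qed fact
  ultimately show ?thesis
    using that Q by blast
qed

section \<open>Normal varieties\<close>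

definition dval :: "'k::field set \<Rightarrow> 'k \<Rightarrow> 'k \<Rightarrow> int" where
  "dval D t f = (THE n. f / t powi n \<in> unit_set D)"

context
  fixes D :: "'k::field set" and t :: 'k
  assumes dvr: "is_dvr D t"
begin

lemma dvr_subring: "is_subring D" and dvr_unif_mem: "t \<in> D" and dvr_unif_nonzero: "t \<noteq> 0"
  and dvr_unif_inverse: "inverse t \<notin> D"
  using dvr by (simp_all add: is_dvr_def)

lemma dvr_unif_powi_mem_iff: "t powi n \<in> D \<longleftrightarrow> n \<ge> 0"
proof
  assume mem: "t powi n \<in> D"
  show "n \<ge> 0"
  proof (rule ccontr)
    assume "\<not> n \<ge> 0"
    then have "t powi (- n - 1) \<in> D"
      by (simp add: power_int_def subring_power dvr_subring dvr_unif_mem)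
    then have "t powi n * t powi (- n - 1) \<in> D"
      using mem subring_mult dvr_subring by blast
    moreover have "t powi n * t powi (- n - 1) = inverse t"
      using dvr_unif_nonzero by (simp flip: power_int_add add: power_int_minus)
    ultimately show False
      using dvr_unif_inverse by simp
  qed
qed (simp add: power_int_def subring_power dvr_subring dvr_unif_mem)

lemma dval_unique:
  assumes "f \<noteq> 0" "f / t powi n \<in> unit_set D"
  shows "dval D t f = n"
  unfolding dval_def
proof (rule the_equality)
  fix m assume "f / t powi m \<in> unit_set D"
  then have "(f / t powi m) / (f / t powi n) \<in> D" "(f / t powi n) / (f / t powi m) \<in> D"
    using assms(2) unit_set_divide[OF dvr_subring] by (blast dest: unit_setD)+
  then have "t powi (n - m) \<in> D" "t powi (m - n) \<in> D"
    using assms(1) dvr_unif_nonzero by (simp_all add: power_int_diff)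
  then show "m = n"
    by (simp add: dvr_unif_powi_mem_iff)
qed fact

lemma dval_unit: "f \<noteq> 0 \<Longrightarrow> f / t powi dval D t f \<in> unit_set D"
  using dvr dval_unique unfolding is_dvr_def by metis

lemma dval_mult: "f \<noteq> 0 \<Longrightarrow> g \<noteq> 0 \<Longrightarrow> dval D t (f * g) = dval D t f + dval D t g"
  using unit_set_mult[OF dvr_subring dval_unit[of f] dval_unit[of g]] dvr_unif_nonzero
  by (intro dval_unique) (auto simp: power_int_add)

lemma dval_unif_powi: "dval D t (t powi n) = n"
  using dvr_unif_nonzero unit_set_one[OF dvr_subring] by (intro dval_unique) auto

lemma dval_one: "dval D t 1 = 0"
  using dval_unif_powi[of 0] by simp

lemma dval_unif: "dval D t t = 1"
  using dval_unif_powi[of 1] by simp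

lemma dval_inverse: "f \<noteq> 0 \<Longrightarrow> dval D t (inverse f) = - dval D t f"
  using dval_mult[of f "inverse f"] dval_one by simp

lemma dval_divide: "f \<noteq> 0 \<Longrightarrow> g \<noteq> 0 \<Longrightarrow> dval D t (f / g) = dval D t f - dval D t g"
  by (simp add: divide_inverse dval_mult dval_inverse)

lemma dval_power: "f \<noteq> 0 \<Longrightarrow> dval D t (f ^ n) = int n * dval D t f"
  by (induction n) (auto simp: dval_one dval_mult algebra_simps)

lemma dval_powi: "f \<noteq> 0 \<Longrightarrow> dval D t (f powi n) = n * dval D t f"
  by (auto simp: power_int_def dval_power dval_inverse)

lemma dvr_mem_iff: "f \<noteq> 0 \<Longrightarrow> f \<in> D \<longleftrightarrow> dval D t f \<ge> 0"
proof -
  assume f: "f \<noteq> 0"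
  let ?e = "f / t powi dval D t f"
  have e: "?e \<in> unit_set D"
    by (rule dval_unit[OF f])
  have "f \<in> D \<longleftrightarrow> t powi dval D t f \<in> D"
  proof
    assume "f \<in> D"
    then have "f * inverse ?e \<in> D"
      using e subring_mult[OF dvr_subring] unit_setD(2) by blast
    then show "t powi dval D t f \<in> D"
      using f dvr_unif_nonzero by (simp add: field_simps)
  next
    assume "t powi dval D t f \<in> D"
    then have "?e * t powi dval D t f \<in> D"
      using e subring_mult[OF dvr_subring] unit_setD(1) by blast
    then show "f \<in> D"
      using dvr_unif_nonzero by simp
  qed
  then show ?thesis
    by (simp add: dvr_unif_powi_mem_iff)
qed

lemma dvr_unit_iff: "f \<in> unit_set D \<longleftrightarrow> f \<noteq> 0 \<and> dval D t f = 0"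
  using dvr_mem_iff[of f] dvr_mem_iff[of "inverse f"] dval_inverse[of f] by (auto simp: unit_set_def)

lemma dvr_nonunit_iff: "f \<in> nonunits D \<longleftrightarrow> f = 0 \<or> dval D t f \<ge> 1"
  using dvr_mem_iff[of f] subring_zero[OF dvr_subring]
  by (cases "f = 0") (auto simp: nonunits_eq dvr_unit_iff)

lemma dvr_nonunit_iff_divide: "f \<in> nonunits D \<longleftrightarrow> f / t \<in> D"
proof (cases "f = 0")
  case False
  then show ?thesis
    using dvr_unif_nonzero dvr_mem_iff[of "f / t"] by (auto simp: dvr_nonunit_iff dval_divide dval_unif)
qed (simp add: dvr_nonunit_iff subring_zero dvr_subring)

lemma dvr_nonunits: "nonunits D = (*) t ` D"
proof (intro equalityI subsetI)
  fix x assume "x \<in> nonunits D"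
  then show "x \<in> (*) t ` D"
    by (simp add: dvr_nonunit_iff_divide mem_image_mult_iff[OF dvr_unif_nonzero])
next
  fix x assume "x \<in> (*) t ` D"
  then show "x \<in> nonunits D"
    by (simp add: dvr_nonunit_iff_divide mem_image_mult_iff[OF dvr_unif_nonzero])
qed

lemma dvr_local: "local_subring D"
  unfolding local_subring_iff is_ideal_def
proof (intro conjI ballI)
  show "nonunits D \<subseteq> D"
    by (auto simp: nonunits_def)
qed (auto simp: dvr_subring dvr_nonunit_iff_divide add_divide_distrib subring_zero subring_add
      simp flip: times_divide_eq_right intro!: subring_mult)

lemma dvr_not_UNIV: "D \<noteq> UNIV"
  using dvr_unif_inverse by auto

lemma dvr_prime_cases:
  assumes P: "is_prime D P"
  shows "P = {0} \<or> P = nonunits D"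
proof (rule disjCI)
  assume ne: "P \<noteq> nonunits D"
  have PI: "is_ideal D P"
    by (rule prime_ideal[OF P])
  have "f = 0" if "f \<in> P" for f
  proof (rule ccontr)
    assume f: "f \<noteq> 0"
    define n where "n = nat (dval D t f)"
    have n: "dval D t f = int n"
      using dvr_mem_iff[OF f] ideal_sub[OF PI that] by (simp add: n_def)
    have "inverse (f / t powi dval D t f) * f \<in> P"
      using dval_unit[OF f] by (intro ideal_mult[OF PI] that) (rule unit_setD)
    then have "t ^ n \<in> P"
      using f by (simp add: n field_simps)
    then have "t \<in> P"
      using prime_power[OF dvr_subring P dvr_unif_mem] by blast
    then have "nonunits D \<subseteq> P"
      using ideal_mult_right[OF PI] by (auto simp: dvr_nonunits)
    then show False
      using ne prime_subset_nonunits[OF dvr_subring P] by blast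
  qed
  then show "P = {0}"
    using ideal_zero[OF PI] by blast
qed

lemma dvr_image_eq_iff:
  assumes "g \<noteq> 0" "h \<noteq> 0"
  shows "(*) g ` D = (*) h ` D \<longleftrightarrow> dval D t g = dval D t h"
  using assms by (auto simp: image_mult_eq_iff dvr_subring dvr_unit_iff dval_divide)

end

section \<open>The field of constants\<close>

lemma const_zero: "const 0 = (0 :: 'k::field ratfun2)"
  and const_one: "const 1 = (1 :: 'k::field ratfun2)"
  and const_add: "const (a + b) = (const a + const b :: 'k::field ratfun2)"
  and const_mult: "const (a * b) = (const a * const b :: 'k::field ratfun2)"
  and const_minus: "const (- a) = (- const a :: 'k::field ratfun2)"
  and const_diff: "const (a - b) = (const a - const b :: 'k::field ratfun2)"
  and const_eq_iff: "const a = (const b :: 'k::field ratfun2) \<longleftrightarrow> a = b"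
  by (simp_all add: const_def Zero_fract_def One_fract_def eq_fract flip: one_pCons)

lemma const_eq_0_iff: "const a = (0 :: 'k::field ratfun2) \<longleftrightarrow> a = 0"
  using const_eq_iff[of a 0] by (simp add: const_zero)

lemma const_inverse: "const (inverse a) = (inverse (const a) :: 'k::field ratfun2)"
proof (cases "a = 0")
  case False
  then have "const a * const (inverse a) = (1 :: 'k ratfun2)"
    by (simp add: const_one flip: const_mult)
  then show ?thesis
    by (simp add: inverse_unique)
qed (simp add: const_zero)

lemma const_divide: "const (a / b) = (const a / const b :: 'k::field ratfun2)"
  by (simp add: divide_inverse const_mult const_inverse)

lemma const_of_int: "const (of_int n) = (of_int n :: 'k::field ratfun2)"
proof -
  have "const (of_nat n) = (of_nat n :: 'k ratfun2)" for n
    by (induction n) (auto simp: const_zero const_one const_add)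
  then show ?thesis
    by (cases n) (auto simp: const_minus const_one const_diff)
qed

lemma const_subring: "is_subring (range const)"
  unfolding is_subring_def
  by (auto simp flip: const_one const_mult const_diff intro: rangeI)

lemma noetherian_const: "noetherian (range const)"
  by (rule noetherian_field[OF const_subring]) (auto simp flip: const_inverse)

lemma coordinate_ring_noetherian: "coordinate_ring A \<Longrightarrow> noetherian A"
  by (auto simp: coordinate_ring_def intro: noetherian_adjoin noetherian_const)

lemma coordinate_ring_const: "coordinate_ring A \<Longrightarrow> const c \<in> A"
  using adjoin_base by (fastforce simp: coordinate_ring_def)

lemma affine_model_def': "affine_model A = {localization A P | P. is_subring A \<and> is_prime A P}"
  by (simp add: affine_model_def primeideal_ring_on_iff)

section \<open>Points of a normal variety\<close>

locale normal_variety =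
  fixes M :: "ratfun set set"
  assumes variety: "variety M" and normal: "normal_model M"
begin

lemma pointE:
  assumes "p \<in> M"
  obtains A P where "coordinate_ring A" "noetherian A" "is_subring A" "is_prime A P"
    "p = localization A P" "affine_model A \<subseteq> M"
proof -
  obtain A where A: "coordinate_ring A" "p \<in> affine_model A" "affine_model A \<subseteq> M"
    using variety assms unfolding variety_def by blast
  then show ?thesis
    using that[of A] coordinate_ring_noetherian[OF A(1)] by (auto simp: affine_model_def')
qed

lemma point_local: "p \<in> M \<Longrightarrow> local_subring p"
  by (erule pointE) (simp add: local_localization)

lemma point_subring: "p \<in> M \<Longrightarrow> is_subring p"
  using point_local local_subring_is_subring by blast

lemma point_noetherian: "p \<in> M \<Longrightarrow> noetherian p"
  by (erule pointE) (simp add: noetherian_localization)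

lemma point_const: "p \<in> M \<Longrightarrow> const c \<in> p"
  by (erule pointE) (use subset_localization coordinate_ring_const in blast)

lemma point_const_unit: "p \<in> M \<Longrightarrow> c \<noteq> 0 \<Longrightarrow> const c \<in> unit_set p"
  by (rule unit_setI) (auto simp: point_const const_eq_0_iff simp flip: const_inverse)

lemma point_frac:
  assumes "p \<in> M"
  shows "\<exists>g\<in>p. g \<noteq> 0 \<and> g * f \<in> p"
proof -
  obtain A P where A: "coordinate_ring A" "is_subring A" "is_prime A P" "p = localization A P"
    using assms by (rule pointE)
  have "f \<in> localization A {0}"
    using A(1) by (simp add: coordinate_ring_def)
  then obtain a b where "f = a / b" "a \<in> A" "b \<in> A" "b \<noteq> 0"
    by (auto simp: localization_def)
  then show ?thesis
    using A subset_localization[OF A(2,3)] by (intro bexI[of _ b]) auto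
qed

lemma point_integrally_closed: "p \<in> M \<Longrightarrow> integrally_closed p"
  using normal by (simp add: normal_model_def)

text \<open>\<open>f\<close> is a root of the monic polynomial with the two terms
  \<open>X ^ n\<close> and \<open>- (f ^ n)\<close>.\<close>

lemma point_power_mem:
  assumes p: "p \<in> M" and mem: "f ^ n \<in> p" and n: "n > 0"
  shows "f \<in> p"
proof -
  let ?q = "Polynomial.monom 1 n - [:f ^ n:]"
  have coeff: "Polynomial.coeff ?q i = (if i = n then 1 else if i = 0 then - (f ^ n) else 0)" for i
    using n by (auto simp: coeff_pCons split: nat.split)
  have "degree ?q = n"
    using n by (intro antisym degree_le le_degree) (auto simp: coeff simp del: coeff_diff)
  then have "lead_coeff ?q = 1"
    by (simp add: coeff del: coeff_diff)
  moreover have "\<forall>i. Polynomial.coeff ?q i \<in> p"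
    using mem point_subring[OF p] by (auto simp: coeff subring_closed simp del: coeff_diff)
  moreover have "poly ?q f = 0"
    by (simp add: poly_monom)
  ultimately show ?thesis
    using point_integrally_closed[OF p] unfolding integrally_closed_def by blast
qed

lemma point_power_unit:
  assumes p: "p \<in> M" and mem: "f ^ n \<in> unit_set p" and n: "n > 0"
  shows "f \<in> unit_set p"
  by (rule unit_set_of_power[OF point_subring[OF p] point_power_mem[OF p unit_setD(1)[OF mem] n] mem n])

lemma localization_point:
  assumes "p \<in> M" "is_prime p Q"
  shows "localization p Q \<in> M"
proof -
  obtain A P where A: "is_subring A" "is_prime A P" "p = localization A P" "affine_model A \<subseteq> M"
    using assms(1) by (rule pointE)
  show ?thesis
    using A assms(2) localization_localization[OF A(1,2), of Q] prime_contraction[OF A(1,2), of Q]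
    by (auto simp: affine_model_def')
qed

text \<open>A point dominates itself, so \<open>p\<close> can serve as the common local ring in the
  definition of separatedness.\<close>

lemma dominates_point: "p \<in> M \<Longrightarrow> q \<in> M \<Longrightarrow> dominates p q \<Longrightarrow> p = q"
  using variety point_local[of p] unfolding variety_def separated_model_def
  by (metis dominates_def order_refl)

text \<open>To find the uniformizer, take any \<open>x\<close> outside \<open>D\<close>. The prime
  at which \<open>x\<close> is still not regular cannot be 0, since every function is a fraction of
  elements of \<open>D\<close>; so it is the maximal ideal, and the localization is \<open>D\<close>
  itself.\<close>

lemma codim_one_point_iff_dvr: "codim_one_point M D \<longleftrightarrow> D \<in> M \<and> (\<exists>t. is_dvr D t)"
proof
  assume "D \<in> M \<and> (\<exists>t. is_dvr D t)"
  then show "codim_one_point M D"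
    using dvr_prime_cases dvr_not_UNIV unfolding codim_one_point_def primeideal_ring_on_iff by blast
next
  assume D: "codim_one_point M D"
  then have DM: "D \<in> M" and "D \<noteq> UNIV" and
    primes: "\<And>P. is_prime D P \<Longrightarrow> P = {0} \<or> P = nonunits D"
    using point_subring by (auto simp: codim_one_point_def primeideal_ring_on_iff)
  then obtain x where "x \<notin> D"
    by blast
  then obtain Q t where Q: "is_prime D Q" "x \<notin> localization D Q" "is_dvr (localization D Q) t"
    using exists_dvr_avoiding[OF point_noetherian[OF DM] point_integrally_closed[OF DM] point_frac[OF DM]]
    by metis
  have "Q \<noteq> {0}"
  proof
    assume "Q = {0}"
    obtain g where "g \<in> D" "g \<noteq> 0" "g * x \<in> D"
      using point_frac[OF DM] by blast
    then have "(g * x) / g \<in> localization D Q"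
      using \<open>Q = {0}\<close> by (intro localizationI[OF point_subring[OF DM] Q(1)]) auto
    then show False
      using Q(2) \<open>g \<noteq> 0\<close> by simp
  qed
  then have "localization D Q = D"
    using primes[OF Q(1)] localization_nonunits(2)[OF point_local[OF DM]] by simp
  then show "D \<in> M \<and> (\<exists>t. is_dvr D t)"
    using DM Q(3) by auto
qed

text \<open>A normal noetherian domain is the intersection of those localizations that are discrete
  valuation rings; \<open>exists_dvr_avoiding\<close> finds one that misses
  \<open>f\<close>.\<close>

lemma hartogs:
  assumes p: "p \<in> M" and reg: "\<And>D. codim_one_point M D \<Longrightarrow> p \<subseteq> D \<Longrightarrow> f \<in> D"
  shows "f \<in> p"
proof (rule ccontr)
  assume "f \<notin> p"
  then obtain Q t where Q: "is_prime p Q" "f \<notin> localization p Q" "is_dvr (localization p Q) t"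
    using exists_dvr_avoiding[OF point_noetherian[OF p] point_integrally_closed[OF p] point_frac[OF p]]
    by metis
  then have "codim_one_point M (localization p Q)"
    using localization_point[OF p] codim_one_point_iff_dvr by blast
  then show False
    using reg Q subset_localization[OF point_subring[OF p] Q(1)] by blast
qed

end

section \<open>Derivations and Laurent polynomials\<close>

definition derivation :: "('k::field \<Rightarrow> 'k) \<Rightarrow> bool" where
  "derivation d \<longleftrightarrow> (\<forall>f g. d (f + g) = d f + d g) \<and> (\<forall>f g. d (f * g) = d f * g + f * d g)"

context
  fixes d :: "'k::field \<Rightarrow> 'k"
  assumes d: "derivation d"
begin

lemma derivation_add: "d (f + g) = d f + d g" and derivation_mult: "d (f * g) = d f * g + f * d g"
  using d by (simp_all add: derivation_def)

lemma derivation_zero: "d 0 = 0"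
  using derivation_add[of 0 0] by (metis add_0_right add_left_cancel)

lemma derivation_one: "d 1 = 0"
  using derivation_mult[of 1 1] by (metis mult_1_left mult_1_right add_0_right add_left_cancel)

lemma derivation_minus: "d (- f) = - d f"
  using derivation_add[of f "-f"] derivation_zero by (simp add: eq_neg_iff_add_eq_0 add.commute)

lemma derivation_diff: "d (f - g) = d f - d g"
  using derivation_add[of f "-g"] derivation_minus by simp

lemma derivation_sum: "d (sum f S) = (\<Sum>i\<in>S. d (f i))"
  by (induction S rule: infinite_finite_induct) (auto simp: derivation_zero derivation_add)

lemma derivation_inverse: "d (inverse f) = - d f * inverse f * inverse f"
proof (cases "f = 0")
  case False
  then have "f * d (inverse f) = - (d f * inverse f)"
    using derivation_mult[of f "inverse f"] derivation_one by (simp add: eq_neg_iff_add_eq_0 add.commute)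
  then have "inverse f * (f * d (inverse f)) = inverse f * - (d f * inverse f)"
    by (rule arg_cong)
  moreover have "inverse f * (f * d (inverse f)) = d (inverse f)"
    using False by (simp flip: mult.assoc)
  ultimately show ?thesis
    by (simp add: mult_ac)
qed (simp add: derivation_zero)

lemma derivation_divide: "g \<noteq> 0 \<Longrightarrow> d (f / g) = (d f * g - f * d g) / (g * g)"
  by (simp add: divide_inverse derivation_mult derivation_inverse) (simp add: field_simps)

lemma derivation_power: "d (f ^ n) = of_nat n * f ^ (n - 1) * d f"
proof (induction n)
  case (Suc n)
  then show ?case
    by (cases n) (simp_all add: derivation_mult algebra_simps)
qed (simp add: derivation_one)

lemma derivation_powi:
  assumes "f \<noteq> 0"
  shows "d (f powi n) = of_int n * f powi n * inverse f * d f"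
proof -
  have power: "d (f ^ m) = of_nat m * (f ^ m * inverse f) * d f" for m
    unfolding derivation_power using assms by (cases m) simp_all
  show ?thesis
  proof (cases "n \<ge> 0")
    case True
    then obtain m where m: "n = int m"
      using nonneg_int_cases by blast
    then show ?thesis
      using power[of m] by (simp add: m mult.assoc)
  next
    case False
    then obtain m where m: "n = - int m"
      by (metis int_cases2 of_nat_0_le_iff)
    have "d (inverse (f ^ m)) = of_int n * inverse (f ^ m) * inverse f * d f"
      unfolding derivation_inverse power using assms by (simp add: m)
    then show ?thesis
      using assms by (simp add: m power_int_minus)
  qed
qed

end

lemma derivation_fract_derivation:
  fixes d :: "'r::idom \<Rightarrow> 'r"
  assumes add: "\<And>a b. d (a + b) = d a + d b" and mult: "\<And>a b. d (a * b) = d a * b + a * d b"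
  shows "derivation (fract_derivation d)"
proof -
  have eq: "fract_derivation d (to_fract a / to_fract b) =
      (to_fract (d a) * to_fract b - to_fract a * to_fract (d b)) / (to_fract b * to_fract b)"
    if "b \<noteq> 0" for a b
    using fract_derivation_Fract[of d b a, OF mult that]
    by (simp add: Fract_conv_to_fract)
  show ?thesis
    unfolding derivation_def
  proof (intro conjI allI)
    fix f g :: "'r fract"
    obtain a b where ab: "f = to_fract a / to_fract b" "b \<noteq> 0"
      by (cases f) (auto simp: Fract_conv_to_fract)
    obtain c e where ce: "g = to_fract c / to_fract e" "e \<noteq> 0"
      by (cases g) (auto simp: Fract_conv_to_fract)
    have sum: "f + g = to_fract (a * e + c * b) / to_fract (b * e)"
      and prod: "f * g = to_fract (a * c) / to_fract (b * e)"
      using ab ce by (simp_all add: field_simps)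
    have "b * e \<noteq> 0"
      using ab ce by simp
    note eqs = eq[OF this] eq[OF ab(2)] eq[OF ce(2)]
    show "fract_derivation d (f + g) = fract_derivation d f + fract_derivation d g"
      unfolding sum eqs unfolding ab(1) ce(1) eqs
      using ab(2) ce(2) by (simp add: add mult field_simps)
    show "fract_derivation d (f * g) = fract_derivation d f * g + f * fract_derivation d g"
      unfolding prod eqs unfolding ab(1) ce(1) eqs
      using ab(2) ce(2) by (simp add: add mult field_simps)
  qed
qed

lemma derivation_partial_X: "derivation (partial_X :: 'k::field ratfun2 \<Rightarrow> _)"
  unfolding partial_X_def
  by (rule derivation_fract_derivation[OF _ map_poly_pderiv_mult])
    (rule poly_eqI, simp add: coeff_map_poly pderiv_add)

lemma derivation_partial_Y: "derivation (partial_Y :: 'k::field ratfun2 \<Rightarrow> _)"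
  unfolding partial_Y_def
  by (rule derivation_fract_derivation) (simp_all add: pderiv_add pderiv_mult algebra_simps)

lemma map_poly_pderiv_one: "map_poly pderiv 1 = 0"
  by (simp add: one_pCons map_poly_pCons)

lemma partial_const: "partial_X (const c) = 0" "partial_Y (const c) = 0"
  by (simp_all add: const_def partial_X_Fract partial_Y_Fract map_poly_pCons pderiv_pCons Zero_fract_def
      map_poly_pderiv_one)

lemma partial_coord:
  "partial_X coord_X = 1" "partial_Y coord_X = 0" "partial_X coord_Y = 0" "partial_Y coord_Y = 1"
  by (simp_all add: coord_X_def coord_Y_def partial_X_Fract partial_Y_Fract map_poly_pCons
      pderiv_pCons Zero_fract_def One_fract_def map_poly_pderiv_one flip: one_pCons)

lemma coord_nonzero: "coord_X \<noteq> (0 :: 'k::field ratfun2)" "coord_Y \<noteq> (0 :: 'k::field ratfun2)"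
  by (simp_all add: coord_X_def coord_Y_def Zero_fract_def eq_fract)

text \<open>Derivations and the action homomorphism are determined on constants and coordinates;
  this rule performs the reduction.\<close>

lemma poly2_induct [case_names const X Y add mult]:
  fixes P :: "'k::field ratfun2 \<Rightarrow> bool" and q :: "'k poly poly"
  assumes const: "\<And>c. P (const c)" and X: "P coord_X" and Y: "P coord_Y"
    and add: "\<And>f g. P f \<Longrightarrow> P g \<Longrightarrow> P (f + g)" and mult: "\<And>f g. P f \<Longrightarrow> P g \<Longrightarrow> P (f * g)"
  shows "P (to_fract q)"
proof (induction q)
  case 0
  then show ?case
    using const[of 0] by (simp add: const_zero)
next
  case (pCons a q)
  have "P (to_fract [:a:])"
  proof (induction a)
    case 0
    then show ?case
      using const[of 0] by (simp add: const_zero)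
  next
    case (pCons c a)
    have "[:pCons c a:] = [:[:c:]:] + [:[:0, 1:]:] * [:a:]"
      by simp
    then have "to_fract [:pCons c a:] = const c + coord_X * to_fract [:a:]"
      unfolding const_def coord_X_def to_fract_def[symmetric] to_fract_mult[symmetric] to_fract_add[symmetric]
      by simp
    then show ?case
      using const X add mult pCons by metis
  qed
  moreover have "to_fract (pCons a q) = to_fract [:a:] + coord_Y * to_fract q"
    unfolding coord_Y_def to_fract_def[symmetric] to_fract_mult[symmetric] to_fract_add[symmetric]
    by simp
  ultimately show ?case
    using Y add mult pCons by metis
qed

lemma ratfun2_cases:
  obtains p q where "q \<noteq> 0" "(f :: 'k::field ratfun2) = to_fract p / to_fract q"
  by (cases f) (auto simp: Fract_conv_to_fract)

lemma derivation_ratfun2_eq: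
  fixes d d' :: "'k::field ratfun2 \<Rightarrow> 'k ratfun2"
  assumes d: "derivation d" and d': "derivation d'" and const: "\<And>c. d (const c) = d' (const c)"
    and X: "d coord_X = d' coord_X" and Y: "d coord_Y = d' coord_Y"
  shows "d f = d' f"
proof -
  have *: "d (to_fract q) = d' (to_fract q)" for q
    by (induction q rule: poly2_induct)
      (auto simp: const X Y derivation_add[OF d] derivation_add[OF d'] derivation_mult[OF d] derivation_mult[OF d'])
  obtain p q where "q \<noteq> 0" "f = to_fract p / to_fract q"
    by (rule ratfun2_cases)
  then show ?thesis
    by (simp add: derivation_divide[OF d] derivation_divide[OF d'] *)
qed

definition theta_X :: "'k::field ratfun2 \<Rightarrow> 'k ratfun2" where
  "theta_X f = coord_X * partial_X f"

definition theta_Y :: "'k::field ratfun2 \<Rightarrow> 'k ratfun2" where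
  "theta_Y f = coord_Y * partial_Y f"

lemma derivation_theta: "derivation theta_X" "derivation theta_Y"
  unfolding derivation_def theta_X_def theta_Y_def
    derivation_add[OF derivation_partial_X] derivation_mult[OF derivation_partial_X]
    derivation_add[OF derivation_partial_Y] derivation_mult[OF derivation_partial_Y]
  by (simp_all add: algebra_simps)

lemma theta_const: "theta_X (const c) = 0" "theta_Y (const c) = 0"
  by (simp_all add: theta_X_def theta_Y_def partial_const)

lemma theta_coord:
  "theta_X coord_X = coord_X" "theta_X coord_Y = 0" "theta_Y coord_X = 0" "theta_Y coord_Y = coord_Y"
  by (simp_all add: theta_X_def theta_Y_def partial_coord)

text \<open>The invariant fields are dual to \<open>dX/X\<close> and \<open>dY/Y\<close>, hence the
  factor \<open>coord_X * coord_Y\<close>.\<close>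

lemma jacobian_theta:
  "jacobian a b = (theta_X a * theta_Y b - theta_Y a * theta_X b) / (coord_X * coord_Y)"
proof -
  have "theta_X a * theta_Y b - theta_Y a * theta_X b = coord_X * coord_Y * jacobian a b"
    by (simp add: jacobian_def theta_X_def theta_Y_def algebra_simps)
  then show ?thesis
    by (simp add: coord_nonzero)
qed

section \<open>Laurent monomials and Laurent polynomials\<close>

definition lmon :: "int \<times> int \<Rightarrow> 'k::field ratfun2" where
  "lmon k = coord_X powi fst k * coord_Y powi snd k"

lemma lmon_nonzero: "lmon k \<noteq> 0"
  by (simp add: lmon_def coord_nonzero)

lemma lmon_zero: "lmon 0 = 1"
  by (simp add: lmon_def)

lemma lmon_add: "lmon (k + l) = lmon k * lmon l"
  by (simp add: lmon_def power_int_add coord_nonzero)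

lemma lmon_uminus: "lmon (- k) = inverse (lmon k)"
  by (simp add: lmon_def power_int_minus)

lemma lmon_diff: "lmon (k - l) = lmon k / lmon l"
  using lmon_add[of k "- l"] by (simp add: lmon_uminus divide_inverse)

definition scale :: "int \<Rightarrow> int \<times> int \<Rightarrow> int \<times> int" where
  "scale n k = (n * fst k, n * snd k)"

lemma lmon_scale: "lmon (scale n k) = lmon k powi n"
  by (simp add: lmon_def scale_def power_int_mult_distrib mult.commute[of n] power_int_mult)

lemma lmon_power: "lmon k ^ n = lmon (scale (int n) k)"
  by (simp add: lmon_scale)

lemma lmon_coord: "lmon (1, 0) = coord_X" "lmon (0, 1) = coord_Y" "lmon (1, 1) = coord_X * coord_Y"
  by (simp_all add: lmon_def)

lemma theta_lmon: "theta_X (lmon k) = of_int (fst k) * lmon k" "theta_Y (lmon k) = of_int (snd k) * lmon k"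
  by (simp_all add: lmon_def derivation_mult[OF derivation_theta(1)] derivation_mult[OF derivation_theta(2)]
      derivation_powi[OF derivation_theta(1)] derivation_powi[OF derivation_theta(2)] coord_nonzero theta_coord)

definition laurent_sum :: "(int \<times> int) set \<Rightarrow> (int \<times> int \<Rightarrow> 'k::field) \<Rightarrow> 'k ratfun2" where
  "laurent_sum S c = (\<Sum>k\<in>S. const (c k) * lmon k)"

text \<open>Vandermonde elimination, one eigenvalue at a time: \<open>T - lam m\<close> removes the
  term \<open>m\<close> and multiplies the term \<open>l\<close> by
  \<open>lam l - lam m \<noteq> 0\<close>. \<open>W\<close> is kept abstract since it will be a
  local ring as well as a maximal ideal.\<close>

lemma eigen_components:
  fixes W :: "'k::field ratfun2 set" and T :: "'k ratfun2 \<Rightarrow> 'k ratfun2"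
  assumes W: "0 \<in> W" "\<And>f g. f \<in> W \<Longrightarrow> g \<in> W \<Longrightarrow> f - g \<in> W" "\<And>a f. f \<in> W \<Longrightarrow> const a * f \<in> W"
    and T: "\<And>c. T (laurent_sum S c) = laurent_sum S (\<lambda>k. lam k * c k)"
    and inj: "inj_on lam S"
    and stable: "\<And>c. laurent_sum S c \<in> W \<Longrightarrow> T (laurent_sum S c) \<in> W"
    and "finite S" and "laurent_sum S c \<in> W" and "l \<in> S" and "c l \<noteq> 0"
  shows "lmon l \<in> W"
proof -
  have "lmon l \<in> W" if "card {k\<in>S. c k \<noteq> 0} = n" "laurent_sum S c \<in> W" "l \<in> S" "c l \<noteq> 0" for n c l
    using that
  proof (induction n arbitrary: c l rule: less_induct)
    case (less n)
    show ?case
    proof (cases "\<exists>m\<in>S. m \<noteq> l \<and> c m \<noteq> 0")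
      case True
      then obtain m where m: "m \<in> S" "m \<noteq> l" "c m \<noteq> 0"
        by blast
      define c' where "c' k = (lam k - lam m) * c k" for k
      have "laurent_sum S c' = T (laurent_sum S c) - const (lam m) * laurent_sum S c"
        unfolding T by (simp add: laurent_sum_def c'_def const_mult const_diff sum_distrib_left algebra_simps sum_subtractf)
      then have mem: "laurent_sum S c' \<in> W"
        using less.prems(2) stable W by metis
      have "lam l \<noteq> lam m"
        using inj m less.prems(3) by (auto dest: inj_onD)
      then have "c' l \<noteq> 0"
        using less.prems by (simp add: c'_def)
      moreover have "{k\<in>S. c' k \<noteq> 0} \<subset> {k\<in>S. c k \<noteq> 0}"
        using m by (auto simp: c'_def)
      then have "card {k\<in>S. c' k \<noteq> 0} < n"
        using less.prems(1) \<open>finite S\<close> by (metis (no_types, lifting) finite_subset mem_Collect_eq psubset_card_mono subsetI)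
      ultimately show ?thesis
        using less.IH[of _ c' l] mem less.prems(3) by blast
    next
      case False
      then have "laurent_sum S c = (\<Sum>k\<in>S. if k = l then const (c l) * lmon l else 0)"
        unfolding laurent_sum_def by (intro sum.cong) (auto simp: const_zero)
      then have "laurent_sum S c = const (c l) * lmon l"
        using \<open>finite S\<close> less.prems(3) by simp
      then have "const (inverse (c l)) * (const (c l) * lmon l) \<in> W"
        using W less.prems(2) by metis
      moreover have "const (inverse (c l)) * (const (c l) * lmon l) = lmon l"
        using less.prems(4) by (simp add: const_inverse const_eq_0_iff)
      ultimately show ?thesis
        by simp
    qed
  qed
  then show ?thesis
    using assms by blast
qed

lemma laurent_ring_UNIV:
  "laurent_ring (UNIV :: 'k::field set) = {laurent_sum S c | S c. finite S \<and> (\<forall>k\<in>S. c k \<noteq> 0)}"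
  (is "?R = ?V")
proof
  define V where "V = {laurent_sum S c | S (c :: _ \<Rightarrow> 'k). finite S}"
  \<comment> \<open>Vanishing coefficients are dropped, so that every index of \<open>S\<close>
    belongs to a monomial that really occurs.\<close>
  have restrict: "laurent_sum S c = laurent_sum {k\<in>S. c k \<noteq> 0} c" if "finite S" for S and c :: "_ \<Rightarrow> 'k"
    unfolding laurent_sum_def using that by (intro sum.mono_neutral_right) (auto simp: const_zero)
  have "V \<subseteq> ?V"
  proof
    fix f assume "f \<in> V"
    then obtain S c where "f = laurent_sum S c" "finite S"
      by (auto simp: V_def)
    then have "f = laurent_sum {k\<in>S. c k \<noteq> 0} c" "finite {k\<in>S. c k \<noteq> 0}" "\<forall>k\<in>{k\<in>S. c k \<noteq> 0}. c k \<noteq> 0"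
      by (simp_all add: restrict[of S c, symmetric])
    then show "f \<in> ?V"
      by blast
  qed
  have add: "f + g \<in> V" if fg: "f \<in> V" "g \<in> V" for f g
  proof -
    from fg obtain S c S' c' where *: "f = laurent_sum S c" "g = laurent_sum S' c'" "finite S" "finite S'"
      by (auto simp: V_def)
    have ext: "laurent_sum A b = laurent_sum (S \<union> S') (\<lambda>k. if k \<in> A then b k else 0)"
      if "A = S \<or> A = S'" for A and b :: "_ \<Rightarrow> 'k"
      unfolding laurent_sum_def using that *(3,4)
      by (intro sum.mono_neutral_cong_left) (auto simp: const_zero)
    have "f + g = laurent_sum (S \<union> S') (\<lambda>k. (if k \<in> S then c k else 0) + (if k \<in> S' then c' k else 0))"
      unfolding *(1,2) ext[of S c, OF disjI1[OF refl]] ext[of S' c', OF disjI2[OF refl]]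
      by (simp add: laurent_sum_def const_add distrib_right sum.distrib)
    then show ?thesis
      unfolding V_def using *(3,4) by blast
  qed
  have term_mem: "const a * lmon l \<in> V" for a l
    unfolding V_def by (force simp: laurent_sum_def intro!: exI[of _ "{l}"] exI[of _ "\<lambda>_. a"])
  have sum_mem: "(\<Sum>i\<in>A. f i) \<in> V" if "\<And>i. i \<in> A \<Longrightarrow> f i \<in> V" for A :: "(int \<times> int) set" and f
    using that
  proof (induction A rule: infinite_finite_induct)
    case (insert x F)
    then show ?case
      by (simp add: add)
  qed (use term_mem[of 0 0] in \<open>simp_all add: const_zero\<close>)
  have mult: "f * g \<in> V" if fg: "f \<in> V" "g \<in> V" for f g
  proof -
    from fg obtain S c S' c' where *: "f = laurent_sum S c" "g = laurent_sum S' c'"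
      by (auto simp: V_def)
    have "f * g = (\<Sum>k\<in>S. \<Sum>l\<in>S'. const (c k * c' l) * lmon (k + l))"
      unfolding * laurent_sum_def sum_product
      by (intro sum.cong refl) (simp only: const_mult lmon_add mult_ac)
    then show ?thesis
      by (simp add: sum_mem term_mem)
  qed
  have const_mem: "const a \<in> V" for a
    using term_mem[of a 0] by (simp add: lmon_zero)
  have "is_subring V"
    unfolding is_subring_def
  proof (intro conjI ballI)
    show "1 \<in> V"
      using const_mem[of 1] by (simp add: const_one)
    fix f g assume fg: "f \<in> V" "g \<in> V"
    show "f * g \<in> V"
      using fg by (rule mult)
    have "f + const (-1) * g \<in> V"
      using fg by (intro add mult const_mem)
    then show "f - g \<in> V"
      by (simp add: const_minus const_one)
  qed
  moreover have "coord_X \<in> V" "inverse coord_X \<in> V" "coord_Y \<in> V" "inverse coord_Y \<in> V"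
    using term_mem[of 1 "(1,0)"] term_mem[of 1 "(-1,0)"] term_mem[of 1 "(0,1)"] term_mem[of 1 "(0,-1)"]
    by (simp_all add: const_one lmon_def power_int_minus)
  ultimately have "?R \<subseteq> V"
    unfolding laurent_ring_def using const_mem by (intro adjoin_least) auto
  then show "?R \<subseteq> ?V"
    using \<open>V \<subseteq> ?V\<close> by blast
next
  have R: "is_subring ?R"
    by (simp add: laurent_ring_def adjoin_subring)
  have "const a \<in> ?R" for a
    using adjoin_base[of "range const"] by (auto simp: laurent_ring_def)
  moreover have "coord_X \<in> unit_set ?R" "coord_Y \<in> unit_set ?R"
    using adjoin_gens[of "{coord_X, inverse coord_X, coord_Y, inverse coord_Y}" "range const"]
    by (auto simp: laurent_ring_def coord_nonzero intro!: unit_setI)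
  then have "lmon k \<in> unit_set ?R" for k
    unfolding lmon_def by (intro unit_set_mult[OF R] unit_set_powi[OF R])
  then have "lmon k \<in> ?R" for k
    by (rule unit_setD)
  ultimately show "?V \<subseteq> ?R"
    by (auto simp: laurent_sum_def intro!: subring_sum[OF R] subring_mult[OF R])
qed

lemma laurent_ring_subring: "is_subring (laurent_ring A)"
  by (simp add: laurent_ring_def adjoin_subring)

lemma to_fract_mem_laurent_ring: "to_fract q \<in> laurent_ring UNIV"
proof (induction q rule: poly2_induct)
  case (const c)
  then show ?case
    using adjoin_base[of "range const"] by (auto simp: laurent_ring_def)
next
  case X
  then show ?case
    using adjoin_gens[of "{coord_X, inverse coord_X, coord_Y, inverse coord_Y}"] by (auto simp: laurent_ring_def)
next
  case Y
  then show ?case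
    using adjoin_gens[of "{coord_X, inverse coord_X, coord_Y, inverse coord_Y}"] by (auto simp: laurent_ring_def)
qed (auto intro: subring_add subring_mult laurent_ring_subring)

lemma to_fract_power: "to_fract (x ^ n) = to_fract x ^ n"
  by (induction n) simp_all

lemma lmon_nat_polynomial: "\<exists>q. lmon (int n, int m) = (to_fract q :: 'k::field ratfun2)"
proof
  show "lmon (int n, int m) = (to_fract ([:[:0, 1:]:] ^ n * [:0, 1:] ^ m) :: 'k ratfun2)"
    unfolding to_fract_mult to_fract_power by (simp add: lmon_def coord_X_def coord_Y_def to_fract_def)
qed

text \<open>Clearing negative exponents by a monomial transfers questions about the Laurent ring to
  the factorial polynomial ring.\<close>

lemma laurent_ring_denominator:
  assumes "f \<in> laurent_ring (UNIV :: 'k::field set)"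
  obtains n q where "f * lmon (int n, int n) = to_fract q"
proof -
  define B :: "'k ratfun2 set" where "B = {f. \<exists>n q. f * lmon (int n, int n) = to_fract q}"
  have "is_subring B"
    unfolding is_subring_def
  proof (intro conjI ballI)
    show "1 \<in> B"
      unfolding B_def by (intro CollectI exI[of _ 0] exI[of _ 1]) (simp add: lmon_def)
    fix f g assume "f \<in> B" "g \<in> B"
    then obtain n q m r where *: "f * lmon (int n, int n) = to_fract q" "g * lmon (int m, int m) = to_fract r"
      by (auto simp: B_def)
    obtain a b :: "'k poly poly" where ab: "lmon (int n, int n) = to_fract a" "lmon (int m, int m) = to_fract b"
      using lmon_nat_polynomial by metis
    have nm: "lmon (int (n + m), int (n + m)) = lmon (int n, int n) * (lmon (int m, int m) :: 'k ratfun2)"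
      by (simp flip: lmon_add)
    have "(f - g) * lmon (int (n + m), int (n + m)) = to_fract (q * b - r * a)"
      unfolding nm by (simp add: algebra_simps flip: * ab)
    moreover have "(f * g) * lmon (int (n + m), int (n + m)) = to_fract (q * r)"
      unfolding nm by (simp add: algebra_simps flip: * ab)
    ultimately show "f - g \<in> B" "f * g \<in> B"
      unfolding B_def by blast+
  qed
  moreover have "const c \<in> B" for c
    unfolding B_def by (intro CollectI exI[of _ 0] exI[of _ "[:[:c:]:]"]) (simp add: lmon_def const_def to_fract_def)
  moreover have "{coord_X, inverse coord_X, coord_Y, inverse coord_Y} \<subseteq> B"
  proof -
    have mem: "g \<in> B" if "g * lmon (int 1, int 1) = lmon (int n, int m)" for g n m
    proof -
      obtain q where "lmon (int n, int m) = (to_fract q :: 'k ratfun2)"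
        using lmon_nat_polynomial by blast
      then have "g * lmon (int 1, int 1) = to_fract q"
        using that by simp
      then show ?thesis
        unfolding B_def by blast
    qed
    have "coord_X \<in> B" "inverse coord_X \<in> B" "coord_Y \<in> B" "inverse coord_Y \<in> B"
      by (rule mem[of _ 2 1] mem[of _ 0 1] mem[of _ 1 2] mem[of _ 1 0],
        simp add: lmon_def coord_nonzero power2_eq_square)+
    then show ?thesis
      by simp
  qed
  ultimately have "laurent_ring UNIV \<subseteq> B"
    unfolding laurent_ring_def by (intro adjoin_least) auto
  then show ?thesis
    using assms that by (auto simp: B_def)
qed

section \<open>The infinitesimal torus action\<close>

text \<open>The local ring of the product with the torus at the unit section \<open>S = T = 1\<close>: evaluation there
  is a left inverse of the action, and the derivatives there are the invariant vector fields.\<close>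

definition eval_one :: "'k::field poly poly \<Rightarrow> 'k" where
  "eval_one a = poly (poly a 1) 1"

lemma eval_one_simps:
  "eval_one (a + b) = eval_one a + eval_one b" "eval_one (a - b) = eval_one a - eval_one b"
  "eval_one (a * b) = eval_one a * eval_one b" "eval_one 1 = 1" "eval_one 0 = 0"
  by (simp_all add: eval_one_def)

definition regular_at_one :: "'k::field ratfun2 set" where
  "regular_at_one = {to_fract a / to_fract b | a b. eval_one b \<noteq> 0}"

definition eval_at_one :: "'k::field ratfun2 \<Rightarrow> 'k" where
  "eval_at_one x = (THE y. \<forall>a b. eval_one b \<noteq> 0 \<and> x = to_fract a / to_fract b \<longrightarrow> y = eval_one a / eval_one b)"

lemma eval_one_nonzero: "eval_one b \<noteq> 0 \<Longrightarrow> b \<noteq> 0"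
  by (auto simp: eval_one_simps)

lemma eval_at_one_eq:
  assumes "eval_one b \<noteq> 0"
  shows "eval_at_one (to_fract a / to_fract b) = eval_one a / eval_one b"
  unfolding eval_at_one_def
proof (rule the_equality)
  show "\<forall>a' b'. eval_one b' \<noteq> 0 \<and> to_fract a / to_fract b = to_fract a' / to_fract b' \<longrightarrow>
    eval_one a / eval_one b = eval_one a' / eval_one b'"
  proof (intro allI impI, elim conjE)
    fix a' b' assume b': "eval_one b' \<noteq> 0" and eq: "to_fract a / to_fract b = to_fract a' / to_fract b'"
    then have "b \<noteq> 0" "b' \<noteq> 0"
      using assms eval_one_nonzero by auto
    then have "to_fract (a * b') = to_fract (a' * b)"
      using eq frac_eq_eq[of "to_fract b" "to_fract b'" "to_fract a" "to_fract a'"] by simp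
    then have "eval_one (a * b') = eval_one (a' * b)"
      unfolding to_fract_eq_iff by simp
    then show "eval_one a / eval_one b = eval_one a' / eval_one b'"
      using assms b' by (simp add: eval_one_simps frac_eq_eq)
  qed
qed (use assms in blast)

lemma regular_at_oneI: "eval_one b \<noteq> 0 \<Longrightarrow> to_fract a / to_fract b \<in> regular_at_one"
  by (auto simp: regular_at_one_def)

lemma regular_at_oneE:
  assumes "x \<in> regular_at_one"
  obtains a b where "x = to_fract a / to_fract b" "eval_one b \<noteq> 0" "b \<noteq> 0"
    "eval_at_one x = eval_one a / eval_one b"
  using assms eval_at_one_eq eval_one_nonzero by (force simp: regular_at_one_def)

lemma regular_at_one_add:
  assumes "x \<in> regular_at_one" "y \<in> regular_at_one"
  shows "x + y \<in> regular_at_one" "eval_at_one (x + y) = eval_at_one x + eval_at_one y"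
proof -
  obtain a b where ab: "x = to_fract a / to_fract b" "eval_one b \<noteq> 0" "b \<noteq> 0"
    "eval_at_one x = eval_one a / eval_one b"
    using assms(1) by (rule regular_at_oneE)
  obtain c e where ce: "y = to_fract c / to_fract e" "eval_one e \<noteq> 0" "e \<noteq> 0"
    "eval_at_one y = eval_one c / eval_one e"
    using assms(2) by (rule regular_at_oneE)
  have eq: "x + y = to_fract (a * e + c * b) / to_fract (b * e)"
    using ab ce by (simp add: add_frac_eq)
  have ne: "eval_one (b * e) \<noteq> 0"
    using ab ce by (simp add: eval_one_simps)
  show "x + y \<in> regular_at_one"
    unfolding eq by (rule regular_at_oneI[OF ne])
  show "eval_at_one (x + y) = eval_at_one x + eval_at_one y"
    unfolding eq eval_at_one_eq[OF ne] using ab ce by (simp add: eval_one_simps add_frac_eq)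
qed

lemma regular_at_one_mult:
  assumes "x \<in> regular_at_one" "y \<in> regular_at_one"
  shows "x * y \<in> regular_at_one" "eval_at_one (x * y) = eval_at_one x * eval_at_one y"
proof -
  obtain a b where ab: "x = to_fract a / to_fract b" "eval_one b \<noteq> 0" "b \<noteq> 0"
    "eval_at_one x = eval_one a / eval_one b"
    using assms(1) by (rule regular_at_oneE)
  obtain c e where ce: "y = to_fract c / to_fract e" "eval_one e \<noteq> 0" "e \<noteq> 0"
    "eval_at_one y = eval_one c / eval_one e"
    using assms(2) by (rule regular_at_oneE)
  have eq: "x * y = to_fract (a * c) / to_fract (b * e)"
    using ab ce by simp
  have ne: "eval_one (b * e) \<noteq> 0"
    using ab ce by (simp add: eval_one_simps)
  show "x * y \<in> regular_at_one"
    unfolding eq by (rule regular_at_oneI[OF ne])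
  show "eval_at_one (x * y) = eval_at_one x * eval_at_one y"
    unfolding eq eval_at_one_eq[OF ne] using ab ce by (simp add: eval_one_simps)
qed

lemma regular_at_one_inverse:
  assumes "x \<in> regular_at_one" "eval_at_one x \<noteq> 0"
  shows "inverse x \<in> regular_at_one"
proof -
  obtain a b where ab: "x = to_fract a / to_fract b" "eval_one b \<noteq> 0" "b \<noteq> 0"
    "eval_at_one x = eval_one a / eval_one b"
    using assms(1) by (rule regular_at_oneE)
  then have "eval_one a \<noteq> 0" "inverse x = to_fract b / to_fract a"
    using assms(2) by auto
  then show ?thesis
    by (simp add: regular_at_oneI)
qed

lemma regular_at_one_const: "const c \<in> regular_at_one" "eval_at_one (const c) = c"
proof -
  have eq: "const c = to_fract [:[:c:]:] / to_fract 1"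
    by (simp add: const_def to_fract_def)
  have ne: "eval_one (1 :: 'a poly poly) \<noteq> 0"
    by (simp add: eval_one_simps)
  show "const c \<in> regular_at_one" "eval_at_one (const c) = c"
    unfolding eq using regular_at_oneI[OF ne] eval_at_one_eq[OF ne] by (simp_all add: eval_one_def)
qed

lemma regular_at_one_coord:
  "(coord_X :: 'k::field ratfun2) \<in> regular_at_one" "eval_at_one coord_X = (1 :: 'k)"
  "(coord_Y :: 'k ratfun2) \<in> regular_at_one" "eval_at_one coord_Y = (1 :: 'k)"
proof -
  have eq: "coord_X = (to_fract [:[:0, 1:]:] / to_fract 1 :: 'k ratfun2)" "coord_Y = (to_fract [:0, 1:] / to_fract 1 :: 'k ratfun2)"
    by (simp_all add: coord_X_def coord_Y_def to_fract_def)
  have ne: "eval_one (1 :: 'k poly poly) \<noteq> 0"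
    by (simp add: eval_one_simps)
  show "(coord_X :: 'k::field ratfun2) \<in> regular_at_one" "eval_at_one coord_X = (1 :: 'k)"
    "(coord_Y :: 'k ratfun2) \<in> regular_at_one" "eval_at_one coord_Y = (1 :: 'k)"
    unfolding eq using regular_at_oneI[OF ne] eval_at_one_eq[OF ne] by (simp_all add: eval_one_def)
qed

lemma regular_at_one_partial:
  assumes "x \<in> regular_at_one"
  shows "partial_X x \<in> regular_at_one" "partial_Y x \<in> regular_at_one"
proof -
  obtain a b where "x = to_fract a / to_fract b" and ab: "eval_one b \<noteq> 0" "b \<noteq> 0"
    using assms by (elim regular_at_oneE)
  then have x: "x = Fract a b"
    by (simp add: Fract_conv_to_fract)
  have ne: "eval_one (b * b) \<noteq> 0"
    using ab by (simp add: eval_one_simps)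
  have "Fract c (b * b) \<in> regular_at_one" for c
    unfolding Fract_conv_to_fract by (rule regular_at_oneI[OF ne])
  then show "partial_X x \<in> regular_at_one" "partial_Y x \<in> regular_at_one"
    unfolding x partial_X_Fract[OF ab(2)] partial_Y_Fract[OF ab(2)] by blast+
qed

lemma eval_derivation_mult:
  assumes d: "derivation d" "\<And>x. x \<in> regular_at_one \<Longrightarrow> d x \<in> regular_at_one"
    and "x \<in> regular_at_one" "y \<in> regular_at_one"
  shows "eval_at_one (d (x * y)) = eval_at_one (d x) * eval_at_one y + eval_at_one x * eval_at_one (d y)"
  using assms by (simp add: derivation_mult[OF d(1)] regular_at_one_add regular_at_one_mult)

locale torus_action =
  fixes act :: "'k::field ratfun2 \<Rightarrow> 'k ratfun2 ratfun2"
  assumes act_add: "act (f + g) = act f + act g" and act_mult: "act (f * g) = act f * act g"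
    and act_const: "act (const c) = const (const c)"
    and act_X: "act coord_X = coord_X * const coord_X"
    and act_Y: "act coord_Y = coord_Y * const coord_Y"
begin

text \<open>For polynomials this is the substitution of 1 for both torus coordinates. The image of a
  denominator \<open>to_fract q\<close> has the nonzero value \<open>to_fract q\<close> there, so it
  is invertible at the unit section and quotients follow.\<close>

lemma act_regular: "act f \<in> regular_at_one \<and> eval_at_one (act f) = f"
proof -
  have poly: "act (to_fract q) \<in> regular_at_one \<and> eval_at_one (act (to_fract q)) = to_fract q" for q
    by (induction q rule: poly2_induct)
      (auto simp: act_add act_mult act_const act_X act_Y regular_at_one_add regular_at_one_mult
        regular_at_one_const regular_at_one_coord)
  obtain p q where pq: "q \<noteq> 0" "f = to_fract p / to_fract q"
    by (rule ratfun2_cases)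
  have q: "eval_at_one (act (to_fract q)) \<noteq> 0"
    using poly[of q] pq by simp
  then have "act (to_fract q) \<noteq> 0"
    using regular_at_one_const(2)[of 0] by (auto simp: const_zero)
  moreover have "f * to_fract q = to_fract p"
    using pq by simp
  then have *: "act f * act (to_fract q) = act (to_fract p)"
    by (simp flip: act_mult)
  ultimately have "act f = act (to_fract p) * inverse (act (to_fract q))"
    by (simp add: field_simps)
  then have reg: "act f \<in> regular_at_one"
    using poly[of p] poly[of q] q by (simp add: regular_at_one_mult regular_at_one_inverse)
  then have "eval_at_one (act f) * to_fract q = to_fract p"
    using * poly[of p] poly[of q] regular_at_one_mult(2) by metis
  then have "eval_at_one (act f) * to_fract q = f * to_fract q"
    using \<open>f * to_fract q = to_fract p\<close> by simp
  then show ?thesis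
    using reg pq(1) by simp
qed

text \<open>The derivative of \<open>f(S X, T Y)\<close> by \<open>S\<close> at
  \<open>S = T = 1\<close> is \<open>X\<close> times the \<open>X\<close>-derivative of
  \<open>f\<close>. Both sides are derivations in \<open>f\<close>, so agreement on generators
  suffices.\<close>

lemma act_partial:
  "eval_at_one (partial_X (act f)) = theta_X f" "eval_at_one (partial_Y (act f)) = theta_Y f"
proof -
  have der: "derivation (\<lambda>f. eval_at_one (d (act f)))"
    if d: "derivation d" "\<And>x :: 'k ratfun2 ratfun2. x \<in> regular_at_one \<Longrightarrow> d x \<in> regular_at_one" for d
    using act_regular unfolding derivation_def
    by (simp add: act_add act_mult eval_derivation_mult[OF d] derivation_add[OF d(1)] regular_at_one_add d(2))
  have zero: "eval_at_one 0 = (0 :: 'k ratfun2)"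
    using regular_at_one_const(2)[of "0 :: 'k ratfun2"] by (simp add: const_zero)
  note simps = act_const act_X act_Y partial_const partial_coord theta_const theta_coord zero
    eval_derivation_mult[OF derivation_partial_X] eval_derivation_mult[OF derivation_partial_Y]
    regular_at_one_partial regular_at_one_const regular_at_one_coord
    regular_at_one_const(2)[of 1, unfolded const_one]
  show "eval_at_one (partial_X (act f)) = theta_X f"
    by (rule derivation_ratfun2_eq[OF der[OF derivation_partial_X] derivation_theta(1)])
      (simp_all add: simps)
  show "eval_at_one (partial_Y (act f)) = theta_Y f"
    by (rule derivation_ratfun2_eq[OF der[OF derivation_partial_Y] derivation_theta(2)])
      (simp_all add: simps)
qed

end

text \<open>The conditions on values and derivatives must be carried together, because the product
  rule mixes them. Inverse coordinates bring no denominators, as the coordinates take the value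
  1.\<close>

lemma laurent_ring_at_one:
  fixes p :: "'k::field ratfun2 set"
  assumes p: "is_subring p" and x: "x \<in> laurent_ring p"
  shows "x \<in> regular_at_one \<and> eval_at_one x \<in> p \<and> eval_at_one (partial_X x) \<in> p \<and> eval_at_one (partial_Y x) \<in> p"
proof -
  define B where "B = {x \<in> regular_at_one. eval_at_one x \<in> p \<and>
    eval_at_one (partial_X x) \<in> p \<and> eval_at_one (partial_Y x) \<in> p}"
  have zero: "eval_at_one 0 = (0 :: 'k ratfun2)" and one: "eval_at_one 1 = (1 :: 'k ratfun2)"
    using regular_at_one_const(2)[of "0 :: 'k ratfun2"] regular_at_one_const(2)[of "1 :: 'k ratfun2"]
    by (simp_all add: const_zero const_one)
  note derX = eval_derivation_mult[OF derivation_partial_X] and derY = eval_derivation_mult[OF derivation_partial_Y]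
  have const: "const c \<in> B" if "c \<in> p" for c
    using that p by (simp add: B_def regular_at_one_const partial_const zero subring_zero)
  have add: "x + y \<in> B" if "x \<in> B" "y \<in> B" for x y
    using that p by (auto simp: B_def regular_at_one_add derivation_add[OF derivation_partial_X]
        derivation_add[OF derivation_partial_Y] regular_at_one_partial subring_add)
  have mult: "x * y \<in> B" if "x \<in> B" "y \<in> B" for x y
    using that p by (auto simp: B_def regular_at_one_mult derX derY regular_at_one_partial subring_add subring_mult)
  have "is_subring B"
    unfolding is_subring_def
  proof (intro conjI ballI)
    show "1 \<in> B"
      using const[of 1] p by (simp add: const_one subring_one)
    fix x y assume xy: "x \<in> B" "y \<in> B"
    show "x * y \<in> B"
      using xy by (rule mult)
    have "x + const (- 1) * y \<in> B"
      using xy p by (intro add mult const) (auto intro: subring_uminus subring_one)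
    then show "x - y \<in> B"
      by (simp add: const_minus const_one)
  qed
  moreover have "const ` p \<subseteq> B"
    using const by auto
  moreover have "{coord_X, inverse coord_X, coord_Y, inverse coord_Y} \<subseteq> B"
  proof -
    have coord: "coord_X \<in> B" "coord_Y \<in> B"
      using p by (simp_all add: B_def regular_at_one_coord partial_coord zero one subring_zero subring_one)
    have inverse: "inverse z \<in> B" if z: "z \<in> B" "eval_at_one z = 1" "z \<noteq> 0" for z
    proof -
      have reg: "z \<in> regular_at_one" "inverse z \<in> regular_at_one"
        using z by (auto simp: B_def intro: regular_at_one_inverse)
      have zz: "z * inverse z = 1"
        using z by simp
      have ev: "eval_at_one (inverse z) = 1"
        using regular_at_one_mult(2)[OF reg] z by (simp add: zz one)
      have "eval_at_one (partial_X z) + eval_at_one (partial_X (inverse z)) = 0"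
        "eval_at_one (partial_Y z) + eval_at_one (partial_Y (inverse z)) = 0"
        using derX[OF regular_at_one_partial(1) reg] derY[OF regular_at_one_partial(2) reg] z(2) ev
        by (simp_all add: zz zero derivation_one[OF derivation_partial_X] derivation_one[OF derivation_partial_Y])
      then have "eval_at_one (partial_X (inverse z)) = - eval_at_one (partial_X z)"
        "eval_at_one (partial_Y (inverse z)) = - eval_at_one (partial_Y z)"
        by (simp_all add: add_eq_0_iff)
      then show ?thesis
        using z p ev reg by (auto simp: B_def subring_uminus subring_one)
    qed
    show ?thesis
      using coord inverse by (simp add: regular_at_one_coord coord_nonzero)
  qed
  ultimately have "laurent_ring p \<subseteq> B"
    unfolding laurent_ring_def by (rule adjoin_least)
  then show ?thesis
    using x by (auto simp: B_def)
qed

locale toric_model = normal_variety M for M +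
  assumes torus_subset: "torus \<subseteq> M" and action: "torus_action_extends M"
begin

text \<open>The unit element fixes \<open>p\<close>: the point \<open>q\<close> of the product over
  \<open>p\<close> on the unit section dominates the image of some \<open>p'\<close>, evaluation
  there shows that \<open>p\<close> dominates \<open>p'\<close>, and separatedness gives
  \<open>p' = p\<close>. Hence the image of \<open>f\<close> lies in \<open>q\<close>, and its
  derivatives at the unit section take values in \<open>p\<close>.\<close>

lemma point_theta:
  assumes p: "p \<in> M" and f: "f \<in> p"
  shows "theta_X f \<in> p" "theta_Y f \<in> p"
proof -
  obtain act where act: "act \<in> ring_hom (ring_on UNIV) (ring_on UNIV)"
    "\<And>c. act (const c) = const (const c)" "act coord_X = coord_X * const coord_X"
    "act coord_Y = coord_Y * const coord_Y" "\<And>q. q \<in> torus_times M \<Longrightarrow> \<exists>p\<in>M. dominates q (act ` p)"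
    using action unfolding torus_action_extends_def by blast
  interpret torus_action act
    using act by unfold_locales (auto simp: ring_hom_def)
  have sp: "is_subring p" and lp: "is_ideal p (nonunits p)"
    using point_local[OF p] by (simp_all add: local_subring_iff)
  define A where "A = laurent_ring p"
  \<comment> \<open>The prime of the point of the product that lies over \<open>p\<close> on the
    unit section.\<close>
  define P where "P = {x \<in> A. eval_at_one x \<in> nonunits p}"
  have A: "is_subring A"
    by (simp add: A_def laurent_ring_subring)
  note at = laurent_ring_at_one[OF sp, folded A_def]
  have zero: "eval_at_one 0 = (0 :: ratfun)" and one: "eval_at_one 1 = (1 :: ratfun)"
    using regular_at_one_const(2)[of "0 :: ratfun"] regular_at_one_const(2)[of "1 :: ratfun"]
    by (simp_all add: const_zero const_one)
  have P: "is_prime A P"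
    unfolding is_prime_def is_ideal_def
  proof (intro conjI ballI impI)
    show "P \<subseteq> A" "0 \<in> P" "1 \<notin> P"
      using A ideal_zero[OF lp] unit_set_one[OF sp]
      by (auto simp: P_def zero one subring_zero nonunits_eq)
    fix x y assume "y \<in> P"
    then have y: "y \<in> A" "eval_at_one y \<in> nonunits p"
      by (simp_all add: P_def)
    show "x + y \<in> P" if "x \<in> P"
      using that y at A ideal_add[OF lp] by (auto simp: P_def regular_at_one_add subring_add)
    show "x * y \<in> P" if "x \<in> A"
      using that y at A ideal_mult[OF lp] by (auto simp: P_def regular_at_one_mult subring_mult)
  next
    fix x y assume xy: "x \<in> A" "y \<in> A" "x * y \<in> P"
    then have "eval_at_one x * eval_at_one y \<in> nonunits p"
      using at by (simp add: P_def regular_at_one_mult)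
    then show "x \<in> P \<or> y \<in> P"
      using xy at unit_set_mult[OF sp, of "eval_at_one x" "eval_at_one y"] by (auto simp: P_def nonunits_eq)
  qed
  define q where "q = localization A P"
  have "q \<in> torus_times M"
    using p A P by (auto simp: torus_times_def affine_model_def' A_def q_def)
  then obtain p' where p': "p' \<in> M" "dominates q (act ` p')"
    using act(5) by blast
  have q: "eval_at_one x \<in> p \<and> eval_at_one (partial_X x) \<in> p \<and> eval_at_one (partial_Y x) \<in> p \<and>
    (eval_at_one x \<in> unit_set p \<longrightarrow> x \<in> unit_set q)" if reg: "x \<in> q" "x \<in> regular_at_one" for x
  proof -
    obtain a b where ab: "a \<in> A" "b \<in> A - P" "b \<noteq> 0" "x = a / b"
      using reg(1) unfolding q_def by (rule localizationE[OF A P])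
    have ev_b: "eval_at_one b \<in> unit_set p"
      using ab at[of b] by (auto simp: P_def nonunits_eq)
    have eq: "x * b = a"
      using ab by simp
    have b: "b \<in> regular_at_one" and a: "a \<in> regular_at_one"
      using at ab by auto
    have ev: "eval_at_one x * eval_at_one b = eval_at_one a"
      using regular_at_one_mult(2)[OF reg(2) b] eq by simp
    have div: "y \<in> p" if "y * eval_at_one b \<in> p" for y
    proof -
      have "y * eval_at_one b * inverse (eval_at_one b) \<in> p"
        using that unit_setD(2)[OF ev_b] subring_mult[OF sp] by blast
      then show ?thesis
        using unit_setD(3)[OF ev_b] by (simp add: mult.assoc)
    qed
    have ev_x: "eval_at_one x \<in> p"
      by (rule div) (use ev at[OF ab(1)] in simp)
    have "eval_at_one (partial_X x) * eval_at_one b = eval_at_one (partial_X a) - eval_at_one x * eval_at_one (partial_X b)"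
      "eval_at_one (partial_Y x) * eval_at_one b = eval_at_one (partial_Y a) - eval_at_one x * eval_at_one (partial_Y b)"
      using eval_derivation_mult[OF derivation_partial_X regular_at_one_partial(1) reg(2) b]
        eval_derivation_mult[OF derivation_partial_Y regular_at_one_partial(2) reg(2) b] eq
      by (simp_all add: eq_diff_eq)
    then have "eval_at_one (partial_X x) * eval_at_one b \<in> p" "eval_at_one (partial_Y x) * eval_at_one b \<in> p"
      using at[of a] at[of b] ab \<open>eval_at_one x \<in> p\<close> by (simp_all add: subring_diff[OF sp] subring_mult[OF sp])
    then have "eval_at_one (partial_X x) \<in> p" "eval_at_one (partial_Y x) \<in> p"
      using div by blast+
    moreover have "x \<in> unit_set q" if "eval_at_one x \<in> unit_set p"
    proof -
      have "eval_at_one a \<in> unit_set p"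
        using unit_set_mult[OF sp that ev_b] ev by simp
      then have "a \<notin> P"
        by (simp add: P_def nonunits_eq)
      then show ?thesis
        using unit_localization_iff[OF A P ab(1,2)] ab(4) by (simp add: q_def)
    qed
    ultimately show ?thesis
      using ev_x by blast
  qed
  have sub: "act ` p' \<subseteq> q" and nonunit: "nonunits (act ` p') \<subseteq> nonunits q"
    using p'(2) by (simp_all add: dominates_def)
  have "p' \<subseteq> p"
    using q sub act_regular by fastforce
  moreover have "nonunits p' \<subseteq> nonunits p"
  proof
    fix g assume g: "g \<in> nonunits p'"
    then have "g \<in> p'" "g \<notin> unit_set p'"
      by (simp_all add: nonunits_eq)
    have "act g \<notin> unit_set (act ` p')"
    proof
      assume unit: "act g \<in> unit_set (act ` p')"
      then obtain h where h: "h \<in> p'" "inverse (act g) = act h"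
        by (auto dest: unit_setD(2))
      then have "act g * act h = act 1"
        using unit_setD(3)[OF unit] act(2)[of 1] by (simp add: const_one flip: h(2))
      then have "eval_at_one (act (g * h)) = eval_at_one (act 1)"
        by (simp add: act_mult)
      then have "g * h = 1"
        using act_regular by metis
      then have "g \<in> unit_set p'"
        using h \<open>g \<in> p'\<close> inverse_unique[of g h] by (auto intro!: unit_setI)
      then show False
        using \<open>g \<notin> unit_set p'\<close> by simp
    qed
    then have "act g \<in> nonunits q"
      using nonunit \<open>g \<in> p'\<close> by (auto simp: nonunits_eq)
    then have "g \<notin> unit_set p"
      using q[of "act g"] act_regular by (auto simp: nonunits_eq)
    then show "g \<in> nonunits p"
      using \<open>g \<in> p'\<close> \<open>p' \<subseteq> p\<close> by (auto simp: nonunits_eq)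
  qed
  ultimately have "p' = p"
    using dominates_point[OF p p'(1)] by (simp add: dominates_def)
  then have "act f \<in> q"
    using sub f by auto
  then show "theta_X f \<in> p" "theta_Y f \<in> p"
    using q[of "act f"] act_regular act_partial by auto
qed

end

section \<open>Boundary divisors\<close>

lemma const_of_nat: "const (of_nat n) = of_nat n"
  using const_of_int[of "int n"] by simp

lemma lmon_mem_laurent_ring: "lmon k \<in> laurent_ring UNIV"
proof -
  have "lmon k = laurent_sum {k} (\<lambda>_. 1)" "finite {k}" "\<forall>k\<in>{k}. (1::'a) \<noteq> 0"
    by (simp_all add: laurent_sum_def const_one)
  then show ?thesis
    unfolding laurent_ring_UNIV by blast
qed

definition dot :: "int \<times> int \<Rightarrow> int \<times> int \<Rightarrow> int" where
  "dot u k = fst u * fst k + snd u * snd k"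

lemma dot_add: "dot u (k + l) = dot u k + dot u l"
  and dot_diff: "dot u (k - l) = dot u k - dot u l"
  and dot_scale: "dot u (scale n k) = n * dot u k"
  and dot_zero: "dot u 0 = 0"
  by (simp_all add: dot_def scale_def algebra_simps)

lemma dot_self_pos: "u \<noteq> 0 \<Longrightarrow> dot u u > 0"
  by (cases u) (auto simp: dot_def zero_prod_def sum_squares_gt_zero_iff)

lemma laurent_sum_shift: "laurent_sum S c / lmon l = laurent_sum ((\<lambda>k. k - l) ` S) (\<lambda>k. c (k + l))"
proof -
  have "laurent_sum ((\<lambda>k. k - l) ` S) (\<lambda>k. c (k + l)) = (\<Sum>k\<in>S. const (c k) * lmon (k - l))"
    unfolding laurent_sum_def by (subst sum.reindex) (auto simp: inj_on_def o_def)
  also have "\<dots> = laurent_sum S c / lmon l"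
    by (simp add: laurent_sum_def lmon_diff sum_divide_distrib)
  finally show ?thesis ..
qed

lemma derivation_laurent_sum:
  assumes d: "derivation d" and const: "\<And>c. d (const c) = 0"
    and eigen: "\<And>k. d (lmon k) = const (lam k) * lmon k"
  shows "d (laurent_sum S c) = laurent_sum S (\<lambda>k. lam k * c k)"
  unfolding laurent_sum_def derivation_sum[OF d]
  by (intro sum.cong refl) (simp add: derivation_mult[OF d] const eigen const_mult)

lemma derivation_combination:
  assumes "\<And>c. d (const c) = 0" "\<And>c. d' (const c) = 0" "derivation d" "derivation d'"
  shows "derivation (\<lambda>f. const a * d f + const b * d' f)"
  using assms(3,4) unfolding derivation_def by (simp add: algebra_simps)

section \<open>Polynomials in one function, with constant coefficients\<close>

definition cpoly :: "'k::field ratfun2 \<Rightarrow> 'k poly \<Rightarrow> 'k ratfun2" where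
  "cpoly z P = poly (map_poly const P) z"

lemma cpoly_pCons: "cpoly z (pCons a P) = const a + z * cpoly z P" and cpoly_0: "cpoly z 0 = 0"
  by (simp_all add: cpoly_def map_poly_pCons const_zero)

lemma cpoly_1: "cpoly z 1 = 1"
  by (simp add: one_pCons cpoly_pCons cpoly_0 const_one)

lemma cpoly_add: "cpoly z (P + Q) = cpoly z P + cpoly z Q"
  by (induction P Q rule: poly_induct2) (simp_all add: cpoly_pCons cpoly_0 const_add algebra_simps)

lemma cpoly_smult: "cpoly z (Polynomial.smult a P) = const a * cpoly z P"
  by (induction P) (simp_all add: cpoly_pCons cpoly_0 const_mult algebra_simps)

lemma cpoly_mult: "cpoly z (P * Q) = cpoly z P * cpoly z Q"
  by (induction P) (simp_all add: cpoly_pCons cpoly_0 cpoly_add cpoly_smult const_zero algebra_simps)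

lemma cpoly_diff: "cpoly z (P - Q) = cpoly z P - cpoly z Q"
  using cpoly_add[of z "P - Q" Q] by (simp add: algebra_simps)

lemma cpoly_power: "cpoly z (P ^ n) = cpoly z P ^ n"
  by (induction n) (simp_all add: cpoly_1 cpoly_mult)

lemma cpoly_monom: "cpoly z (Polynomial.monom a n) = const a * z ^ n"
  by (induction n) (simp_all add: monom_0 monom_Suc cpoly_pCons cpoly_0 const_zero algebra_simps)

lemma cpoly_altdef: "cpoly z P = (\<Sum>i\<le>degree P. const (Polynomial.coeff P i) * z ^ i)"
proof -
  have "cpoly z (\<Sum>i\<in>A. f i) = (\<Sum>i\<in>A. cpoly z (f i))" for A :: "nat set" and f
    by (induction A rule: infinite_finite_induct) (auto simp: cpoly_0 cpoly_add)
  then have "cpoly z (\<Sum>i\<le>degree P. Polynomial.monom (Polynomial.coeff P i) i) =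
      (\<Sum>i\<le>degree P. const (Polynomial.coeff P i) * z ^ i)"
    by (simp add: cpoly_monom)
  then show ?thesis
    by (simp add: poly_as_sum_of_monoms)
qed

text \<open>The eigenvalue on the monomial with exponents \<open>a, b\<close> is
  \<open>a + \<i> b\<close>. These numbers differ for different pairs of integers, so one operator
  separates all monomials.\<close>

definition theta_mix :: "ratfun \<Rightarrow> ratfun" where
  "theta_mix f = const 1 * theta_X f + const \<i> * theta_Y f"

context toric_model
begin

lemma lmon_component_mem:
  assumes p: "p \<in> M" and f: "laurent_sum S c \<in> p" "finite S" "l \<in> S" "c l \<noteq> 0"
  shows "lmon l \<in> p"
proof -
  let ?lam = "\<lambda>k :: int \<times> int. of_int (fst k) + \<i> * of_int (snd k)"
  have sp: "is_subring p"
    by (rule point_subring[OF p])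
  have der: "derivation theta_mix"
    unfolding theta_mix_def by (intro derivation_combination theta_const derivation_theta)
  have eigen: "theta_mix (lmon k) = const (?lam k) * lmon k" for k
    by (simp add: theta_mix_def theta_lmon const_add const_mult const_of_int const_one algebra_simps)
  have const0: "theta_mix (const a) = 0" for a
    by (simp add: theta_mix_def theta_const)
  have stable: "theta_mix g \<in> p" if "g \<in> p" for g
    unfolding theta_mix_def using that p
    by (intro subring_add[OF sp] subring_mult[OF sp] point_const point_theta)
  show ?thesis
  proof (rule eigen_components[where T = theta_mix and W = p and S = S and c = c])
    show "theta_mix (laurent_sum S c) = laurent_sum S (\<lambda>k. ?lam k * c k)" for c
      by (rule derivation_laurent_sum[OF der const0 eigen])
    show "inj_on ?lam S"
      by (auto simp: inj_on_def complex_eq_iff)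
  qed (use f p stable in \<open>auto intro: subring_zero[OF sp] subring_diff[OF sp] subring_mult[OF sp] point_const\<close>)
qed

end

locale boundary = toric_model M for M +
  fixes D :: "ratfun set" and t :: ratfun
  assumes D_point: "D \<in> M" and dvr: "is_dvr D t"
    and boundary: "coord_X \<notin> unit_set D \<or> coord_Y \<notin> unit_set D"
begin

definition weight :: "int \<times> int" where
  "weight = (dval D t coord_X, dval D t coord_Y)"

abbreviation (input) "u \<equiv> weight"

lemmas D_subring = dvr_subring[OF dvr]

lemma D_ideal: "is_ideal D (nonunits D)"
  using dvr_local[OF dvr] by (rule local_subring_ideal)

lemma weight_nonzero: "u \<noteq> 0"
  using boundary dvr_unit_iff[OF dvr] coord_nonzero[where 'k = complex] by (auto simp: weight_def zero_prod_def)

lemma dval_lmon: "dval D t (lmon k) = dot u k"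
  by (simp add: lmon_def dval_mult[OF dvr] dval_powi[OF dvr] coord_nonzero dot_def weight_def algebra_simps)

lemma lmon_mem_iff: "lmon k \<in> D \<longleftrightarrow> dot u k \<ge> 0"
  and lmon_nonunit_iff: "lmon k \<in> nonunits D \<longleftrightarrow> dot u k \<ge> 1"
  and lmon_unit_iff: "lmon k \<in> unit_set D \<longleftrightarrow> dot u k = 0"
  using dvr_mem_iff[OF dvr lmon_nonzero] dvr_nonunit_iff[OF dvr] dvr_unit_iff[OF dvr]
  by (simp_all add: dval_lmon lmon_nonzero)

text \<open>Its eigenvalue on \<open>lmon k\<close> is the determinant of \<open>u\<close> and
  \<open>k\<close>: it annihilates \<open>lmon u\<close> and separates the monomials of weight
  0.\<close>

definition theta_perp :: "ratfun \<Rightarrow> ratfun" where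
  "theta_perp f = const (of_int (- snd u)) * theta_X f + const (of_int (fst u)) * theta_Y f"

lemma derivation_theta_perp: "derivation theta_perp"
  unfolding theta_perp_def by (intro derivation_combination theta_const derivation_theta)

lemma theta_perp_lmon: "theta_perp (lmon k) = const (of_int (fst u * snd k - snd u * fst k)) * lmon k"
  by (simp add: theta_perp_def theta_lmon const_of_int const_minus const_diff const_mult algebra_simps)

text \<open>Comparing \<open>f\<close> with a power of a monomial that \<open>theta_perp\<close> annihilates shows that the
  valuation of \<open>theta_perp f\<close> is at least that of \<open>f\<close>.\<close>

lemma theta_perp_nonunits:
  assumes f: "f \<in> nonunits D"
  shows "theta_perp f \<in> nonunits D"
proof (cases "f = 0 \<or> theta_perp f = 0")
  case True
  then show ?thesis
    using ideal_zero[OF D_ideal] derivation_zero[OF derivation_theta_perp] by auto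
next
  case False
  define e where "e = nat (dval D t f)"
  define d where "d = nat (dot u u)"
  define b where "b = (lmon u :: ratfun)"
  have e: "dval D t f = int e" "e > 0"
    using f False dvr_nonunit_iff[OF dvr, of f] by (auto simp: e_def)
  have d: "dot u u = int d" "d > 0"
    using dot_self_pos[OF weight_nonzero] by (auto simp: d_def)
  have b: "b \<noteq> 0" "dval D t b = int d"
    by (simp_all add: b_def lmon_nonzero dval_lmon d)
  have "theta_perp b = 0"
    by (simp add: b_def theta_perp_lmon const_zero)
  then have be: "theta_perp (b ^ e) = 0"
    by (simp add: derivation_power[OF derivation_theta_perp])
  \<comment> \<open>\<open>f ^ d\<close> and \<open>b ^ e\<close> have the same valuation, and
    \<open>theta_perp\<close> differentiates only the numerator. Regularity of the derivative of
    \<open>g\<close> therefore bounds the valuation of \<open>theta_perp f\<close> below by that of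
    \<open>f\<close>.\<close>
  define g where "g = f ^ d / b ^ e"
  have g: "g \<noteq> 0" "dval D t g = 0"
    using False b e by (auto simp: g_def dval_divide[OF dvr] dval_power[OF dvr] mult.commute)
  then have "g \<in> D"
    using dvr_mem_iff[OF dvr] by simp
  then have "theta_perp g \<in> D"
    unfolding theta_perp_def using D_point
    by (intro subring_add[OF D_subring] subring_mult[OF D_subring] point_const point_theta)
  have "theta_perp g = theta_perp (f ^ d) / b ^ e"
    unfolding g_def using b be by (simp add: derivation_divide[OF derivation_theta_perp])
  also have "\<dots> = of_nat d * f ^ (d - 1) * theta_perp f / b ^ e"
    by (simp add: derivation_power[OF derivation_theta_perp])
  finally have tg: "theta_perp g = of_nat d * (f ^ (d - 1) * theta_perp f / b ^ e)"
    by simp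
  \<comment> \<open>Characteristic zero: the integer \<open>d\<close> is a nonzero constant, hence a
    unit of \<open>D\<close>.\<close>
  have "inverse (of_nat d :: ratfun) \<in> D"
    using point_const[OF D_point, of "inverse (of_nat d)"] by (simp add: const_inverse const_of_nat)
  then have "inverse (of_nat d) * theta_perp g \<in> D"
    using \<open>theta_perp g \<in> D\<close> subring_mult[OF D_subring] by blast
  moreover have nz: "(of_nat d :: ratfun) \<noteq> 0"
    using d(2) const_of_nat[of d, where 'a = complex] const_eq_0_iff[of "of_nat d :: complex"] by simp
  moreover have "inverse (of_nat d) * (of_nat d * h) = h" for h :: ratfun
    using nz by (simp flip: mult.assoc)
  ultimately have "f ^ (d - 1) * theta_perp f / b ^ e \<in> D"
    unfolding tg by metis
  moreover have "f ^ (d - 1) * theta_perp f / b ^ e \<noteq> 0"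
    using False b by simp
  ultimately have "dval D t (f ^ (d - 1) * theta_perp f / b ^ e) \<ge> 0"
    using dvr_mem_iff[OF dvr] by blast
  then have "int (d - 1) * int e + dval D t (theta_perp f) - int e * int d \<ge> 0"
    using False b e by (simp add: dval_divide[OF dvr] dval_mult[OF dvr] dval_power[OF dvr])
  moreover have "int (d - 1) * int e - int e * int d = - int e"
    using d(2) by (simp add: algebra_simps)
  ultimately have "dval D t (theta_perp f) \<ge> int e"
    by linarith
  then show ?thesis
    using e(2) by (simp add: dvr_nonunit_iff[OF dvr])
qed

lemma weight_perp_inj: "inj_on (\<lambda>k. of_int (fst u * snd k - snd u * fst k) :: complex) {k. dot u k = 0}"
proof (rule inj_onI)
  fix k l assume kl: "k \<in> {k. dot u k = 0}" "l \<in> {k. dot u k = 0}"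
    and eq: "of_int (fst u * snd k - snd u * fst k) = (of_int (fst u * snd l - snd u * fst l) :: complex)"
  define m where "m = k - l"
  have m: "fst u * fst m + snd u * snd m = 0" "fst u * snd m - snd u * fst m = 0"
    using kl eq by (auto simp: m_def dot_def algebra_simps simp flip: of_int_mult of_int_diff of_int_add)
  \<comment> \<open>The weight of \<open>m\<close> and its determinant with \<open>u\<close> recover
    \<open>m\<close> up to the factor \<open>dot u u > 0\<close>.\<close>
  have "dot u u * fst m = fst u * (fst u * fst m + snd u * snd m) - snd u * (fst u * snd m - snd u * fst m)"
    "dot u u * snd m = snd u * (fst u * fst m + snd u * snd m) + fst u * (fst u * snd m - snd u * fst m)"
    by (simp_all add: dot_def algebra_simps)
  then have "fst m = 0" "snd m = 0"
    using m dot_self_pos[OF weight_nonzero] by auto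
  then show "k = l"
    by (simp add: m_def prod_eq_iff)
qed

text \<open>No term has negative weight by \<open>lmon_component_mem\<close>, and terms of positive
  weight lie in the maximal ideal anyway. The remaining part of weight 0 is split by
  \<open>theta_perp\<close>, and any term of it would put a unit into the maximal ideal.\<close>

lemma lmon_component_nonunit:
  assumes f: "laurent_sum S c \<in> nonunits D" "finite S" "l \<in> S" "c l \<noteq> 0"
  shows "lmon l \<in> nonunits D"
proof -
  define S1 where "S1 = {k\<in>S. c k \<noteq> 0}"
  define S0 where "S0 = {k\<in>S1. dot u k = 0}"
  have ge: "dot u k \<ge> 0" if "k \<in> S1" for k
  proof -
    have "laurent_sum S c \<in> D"
      using f(1) by (simp add: nonunits_def)
    then have "lmon k \<in> D"
      using lmon_component_mem[OF D_point _ f(2)] that by (simp add: S1_def)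
    then show ?thesis
      by (simp add: lmon_mem_iff)
  qed
  have fin: "finite S1" "finite S0"
    using f(2) by (simp_all add: S1_def S0_def)
  have "laurent_sum S c = laurent_sum S1 c"
    unfolding laurent_sum_def S1_def using f(2) by (intro sum.mono_neutral_right) (auto simp: const_zero)
  also have "\<dots> = laurent_sum (S1 - S0) c + laurent_sum S0 c"
    unfolding laurent_sum_def using fin by (intro sum.subset_diff) (auto simp: S0_def)
  finally have split: "laurent_sum S c = laurent_sum (S1 - S0) c + laurent_sum S0 c" .
  have "laurent_sum (S1 - S0) c \<in> nonunits D"
    unfolding laurent_sum_def
  proof (rule ideal_sum[OF D_ideal])
    fix k assume "k \<in> S1 - S0"
    then have "lmon k \<in> nonunits D"
      using ge[of k] by (auto simp: S0_def lmon_nonunit_iff)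
    then show "const (c k) * lmon k \<in> nonunits D"
      by (intro ideal_mult[OF D_ideal] point_const D_point)
  qed
  then have f0: "laurent_sum S0 c \<in> nonunits D"
    using ideal_diff[OF D_subring D_ideal f(1)] split by (metis add_diff_cancel_left')
  have False if l: "l \<in> S0"
  proof -
    have "lmon l \<in> nonunits D"
    proof (rule eigen_components[where T = theta_perp and W = "nonunits D" and S = S0 and c = c])
      show "theta_perp (laurent_sum S0 c) = laurent_sum S0 (\<lambda>k. of_int (fst u * snd k - snd u * fst k) * c k)" for c
        by (rule derivation_laurent_sum[OF derivation_theta_perp _ theta_perp_lmon])
          (simp add: theta_perp_def theta_const)
      show "inj_on (\<lambda>k. of_int (fst u * snd k - snd u * fst k) :: complex) S0"
        by (rule inj_on_subset[OF weight_perp_inj]) (auto simp: S0_def)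
      show "f - g \<in> nonunits D" if "f \<in> nonunits D" "g \<in> nonunits D" for f g
        using ideal_diff[OF D_subring D_ideal] that by blast
    qed (use l f0 fin D_point in \<open>auto intro: ideal_zero[OF D_ideal] ideal_mult[OF D_ideal] point_const
        theta_perp_nonunits simp: S0_def S1_def\<close>)
    then show False
      using l by (simp add: S0_def lmon_nonunit_iff)
  qed
  then show ?thesis
    using f ge[of l] by (force simp: S0_def S1_def lmon_nonunit_iff)
qed

text \<open>After division by a monomial of least weight all terms are regular, and the constant
  term that is then present keeps the quotient out of the maximal ideal. So the valuation of a
  Laurent polynomial is the least weight of its terms.\<close>

lemma laurent_ring_unit_multiple:
  assumes f: "f \<in> laurent_ring UNIV" "f \<noteq> 0"
  obtains l where "f / lmon l \<in> unit_set D"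
proof -
  obtain S c where S: "f = laurent_sum S c" "finite S" "\<forall>k\<in>S. c k \<noteq> 0"
    using f(1) by (auto simp: laurent_ring_UNIV)
  have "S \<noteq> {}"
    using f(2) S(1) by (auto simp: laurent_sum_def)
  define l where "l = arg_min_on (dot u) S"
  have l: "l \<in> S" "\<And>k. k \<in> S \<Longrightarrow> dot u l \<le> dot u k"
    using arg_min_if_finite[OF S(2) \<open>S \<noteq> {}\<close>, of "dot u"] by (auto simp: l_def not_less)
  have eq: "f / lmon l = laurent_sum ((\<lambda>k. k - l) ` S) (\<lambda>k. c (k + l))"
    unfolding S(1) by (rule laurent_sum_shift)
  have mem: "f / lmon l \<in> D"
    unfolding eq laurent_sum_def
    using l D_point by (intro subring_sum[OF D_subring] subring_mult[OF D_subring] point_const)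
      (auto simp: lmon_mem_iff dot_diff)
  have "f / lmon l \<notin> nonunits D"
  proof
    assume "f / lmon l \<in> nonunits D"
    moreover have "0 \<in> (\<lambda>k. k - l) ` S"
      using l(1) by force
    ultimately have "lmon 0 \<in> nonunits D"
      using lmon_component_nonunit[of "(\<lambda>k. k - l) ` S" "\<lambda>k. c (k + l)" 0] S(2,3) l(1)
      unfolding eq by simp
    then show False
      by (simp add: lmon_nonunit_iff dot_zero)
  qed
  then show ?thesis
    using mem that by (simp add: nonunits_eq)
qed

lemma lmon_unit_multiple:
  assumes f: "f \<noteq> 0"
  obtains l where "f / lmon l \<in> unit_set D"
proof -
  obtain p q where pq: "q \<noteq> 0" "f = to_fract p / to_fract q"
    by (rule ratfun2_cases)
  then have "to_fract p \<noteq> 0" "to_fract q \<noteq> 0"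
    using f by auto
  then obtain k l where "to_fract p / lmon k \<in> unit_set D" "to_fract q / lmon l \<in> unit_set D"
    using laurent_ring_unit_multiple to_fract_mem_laurent_ring by metis
  then have "(to_fract p / lmon k) / (to_fract q / lmon l) \<in> unit_set D"
    by (rule unit_set_divide[OF D_subring])
  moreover have "(to_fract p / lmon k) / (to_fract q / lmon l) = f / lmon (k - l)"
    using pq by (simp add: lmon_diff lmon_nonzero)
  ultimately show ?thesis
    using that by metis
qed

text \<open>A uniformizer is a unit times a monomial, and that monomial has weight 1. In other
  words, \<open>u\<close> is a primitive vector.\<close>

lemma weight_surj: obtains l where "dot u l = 1"
proof -
  obtain l where l: "t / lmon l \<in> unit_set D"
    using lmon_unit_multiple[OF dvr_unif_nonzero[OF dvr]] .
  then have "dval D t (t / lmon l) = 0"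
    by (simp add: dvr_unit_iff[OF dvr])
  then show ?thesis
    using that[of l] dvr_unif_nonzero[OF dvr]
    by (simp add: dval_divide[OF dvr] lmon_nonzero dval_lmon dval_unif[OF dvr])
qed

text \<open>A quarter turn of \<open>u\<close>, and primitive like \<open>u\<close>: the direction
  of the polygon edge that belongs to \<open>D\<close>. Its monomial \<open>z\<close> is a
  coordinate on the divisor.\<close>

definition edge :: "int \<times> int" where
  "edge = (- snd u, fst u)"

abbreviation z :: ratfun where
  "z \<equiv> lmon edge"

lemma dot_edge: "dot u edge = 0"
  by (simp add: dot_def edge_def)

lemma edge_nonzero: "edge \<noteq> 0"
  using weight_nonzero by (auto simp: edge_def zero_prod_def prod_eq_iff)

lemma z_unit: "z \<in> unit_set D"
  by (simp add: lmon_unit_iff dot_edge)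

lemma z_nonzero: "z \<noteq> 0"
  by (rule lmon_nonzero)

lemma dot_zero_multiple:
  assumes "dot u k = 0"
  obtains j where "k = scale j edge"
proof -
  obtain l where l: "dot u l = 1"
    by (rule weight_surj)
  \<comment> \<open>\<open>l\<close> and \<open>edge\<close> form a basis of determinant
    \<open>dot u l = 1\<close>, and \<open>j\<close> is the coordinate of \<open>k\<close> along
    \<open>edge\<close>.\<close>
  define j where "j = fst l * snd k - snd l * fst k"
  have "- snd u * j = dot u l * fst k - fst l * dot u k" "fst u * j = dot u l * snd k - snd l * dot u k"
    by (simp_all add: j_def dot_def algebra_simps)
  then have "k = scale j edge"
    using assms l by (simp add: scale_def edge_def prod_eq_iff mult.commute)
  then show ?thesis
    by (rule that)
qed

text \<open>The residue of \<open>z\<close> is transcendental over the constants: the powers of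
  \<open>z\<close> are distinct monomials of weight 0, and none of them lies in the maximal
  ideal.\<close>

lemma cpoly_unit:
  assumes "P \<noteq> 0"
  shows "cpoly z P \<in> unit_set D"
proof -
  let ?g = "\<lambda>i::nat. scale (int i) edge"
  have inj: "inj_on ?g A" for A
    using edge_nonzero by (auto simp: inj_on_def scale_def zero_prod_def prod_eq_iff)
  have "cpoly z P = (\<Sum>i\<le>degree P. const (Polynomial.coeff P i) * lmon (?g i))"
    by (simp add: cpoly_altdef lmon_power)
  also have "\<dots> = laurent_sum (?g ` {..degree P}) (\<lambda>k. Polynomial.coeff P (inv_into UNIV ?g k))"
    unfolding laurent_sum_def by (subst sum.reindex[OF inj]) (simp add: inv_into_f_f[OF inj])
  finally have eq: "cpoly z P = laurent_sum (?g ` {..degree P}) (\<lambda>k. Polynomial.coeff P (inv_into UNIV ?g k))" .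
  have "cpoly z P \<notin> nonunits D"
  proof
    assume "cpoly z P \<in> nonunits D"
    then have "lmon (?g (degree P)) \<in> nonunits D"
      unfolding eq using assms by (intro lmon_component_nonunit) (auto simp: inv_into_f_f[OF inj])
    then show False
      by (simp add: lmon_nonunit_iff dot_scale dot_edge)
  qed
  moreover have "cpoly z P \<in> D"
    unfolding cpoly_altdef using z_unit D_point
    by (intro subring_sum[OF D_subring] subring_mult[OF D_subring] subring_power[OF D_subring] point_const)
      (auto dest: unit_setD)
  ultimately show ?thesis
    by (simp add: nonunits_eq)
qed

lemma laurent_leading_part:
  assumes f: "f \<in> laurent_ring UNIV" "f \<in> D"
  obtains P n where "f - cpoly z P / z ^ n \<in> nonunits D"
proof -
  obtain S c where S: "f = laurent_sum S c" "finite S" "\<forall>k\<in>S. c k \<noteq> 0"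
    using f(1) by (auto simp: laurent_ring_UNIV)
  define B where "B = {cpoly z P / z ^ n | P n. True}"
  have add: "x + y \<in> B" if xy: "x \<in> B" "y \<in> B" for x y
  proof -
    from xy obtain P n Q m where *: "x = cpoly z P / z ^ n" "y = cpoly z Q / z ^ m"
      by (auto simp: B_def)
    have "x + y = cpoly z (P * Polynomial.monom 1 m + Q * Polynomial.monom 1 n) / z ^ (n + m)"
      using z_nonzero by (simp add: * cpoly_add cpoly_mult cpoly_monom const_one power_add add_frac_eq)
    then show ?thesis
      unfolding B_def by blast
  qed
  have term_mem: "const a * lmon (scale j edge) \<in> B" for a j
  proof (cases "j \<ge> 0")
    case True
    then have "const a * lmon (scale j edge) = cpoly z (Polynomial.monom a (nat j)) / z ^ 0"
      by (simp add: cpoly_monom lmon_power)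
    then show ?thesis
      unfolding B_def by blast
  next
    case False
    then have "const a * lmon (scale j edge) = cpoly z [:a:] / z ^ nat (- j)"
      by (simp add: cpoly_pCons cpoly_0 lmon_scale power_int_def divide_inverse power_inverse)
    then show ?thesis
      unfolding B_def by blast
  qed
  define S0 where "S0 = {k\<in>S. dot u k = 0}"
  have "(\<Sum>k\<in>A. const (c k) * lmon k) \<in> B" if "finite A" "A \<subseteq> S0" for A
    using that
  proof (induction A rule: finite_induct)
    case empty
    then show ?case
      using term_mem[of 0 0] by (simp add: const_zero)
  next
    case (insert k A)
    have "dot u k = 0"
      using insert.prems by (simp add: S0_def)
    then obtain j where "k = scale j edge"
      by (rule dot_zero_multiple)
    then show ?case
      using insert add term_mem by simp
  qed
  then have "laurent_sum S0 c \<in> B"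
    using S(2) by (simp add: laurent_sum_def S0_def)
  moreover have "f - laurent_sum S0 c \<in> nonunits D"
  proof -
    have "f = laurent_sum (S - S0) c + laurent_sum S0 c"
      unfolding S(1) laurent_sum_def using S(2) by (intro sum.subset_diff) (auto simp: S0_def)
    then have "f - laurent_sum S0 c = laurent_sum (S - S0) c"
      by simp
    moreover have "laurent_sum (S - S0) c \<in> nonunits D"
      unfolding laurent_sum_def
    proof (rule ideal_sum[OF D_ideal])
      fix k assume k: "k \<in> S - S0"
      then have "lmon k \<in> D"
        using lmon_component_mem[OF D_point _ S(2), of c k] f(2) S by auto
      then have "lmon k \<in> nonunits D"
        using k by (auto simp: S0_def lmon_nonunit_iff lmon_mem_iff)
      then show "const (c k) * lmon k \<in> nonunits D"
        by (intro ideal_mult[OF D_ideal] point_const D_point)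
    qed
    ultimately show ?thesis
      by simp
  qed
  moreover from \<open>laurent_sum S0 c \<in> B\<close> obtain P n where "laurent_sum S0 c = cpoly z P / z ^ n"
    unfolding B_def by blast
  ultimately show ?thesis
    using that[of P n] by simp
qed

text \<open>A copy of the residue field inside \<open>D\<close>, the rational functions of
  \<open>z\<close>. With representatives in the function field no quotient ring is formed:
  congruence means that the difference lies in \<open>nonunits D\<close>.\<close>

definition residues :: "ratfun set" where
  "residues = {cpoly z P / cpoly z Q | P Q. Q \<noteq> 0}"

text \<open>Write \<open>f\<close> as a quotient of Laurent polynomials with a unit of
  \<open>D\<close> below and keep their parts of weight 0, which are Laurent polynomials in
  \<open>z\<close>.\<close>

lemma D_residue:
  assumes f: "f \<in> D"
  obtains r where "r \<in> residues" "f - r \<in> nonunits D"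
proof -
  obtain p q where pq: "q \<noteq> 0" "f = to_fract p / to_fract q"
    by (rule ratfun2_cases)
  then obtain l where l: "to_fract q / lmon l \<in> unit_set D"
    using laurent_ring_unit_multiple[OF to_fract_mem_laurent_ring, of q] by auto
  define a b :: ratfun where "a = to_fract p / lmon l" and "b = to_fract q / lmon l"
  have R: "x / lmon l \<in> laurent_ring UNIV" if "x \<in> laurent_ring UNIV" for x :: ratfun
    using subring_mult[OF laurent_ring_subring that lmon_mem_laurent_ring[of "- l"]]
    by (simp add: lmon_uminus divide_inverse)
  have ab: "a \<in> laurent_ring UNIV" "b \<in> laurent_ring UNIV" "f = a / b" "b \<in> unit_set D"
    using pq l by (auto simp: a_def b_def R to_fract_mem_laurent_ring lmon_nonzero)
  have "b \<noteq> 0" "b \<in> D"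
    using ab(4) by (auto dest: unit_setD)
  have "a = f * b"
    using ab \<open>b \<noteq> 0\<close> by simp
  then have "a \<in> D"
    using f \<open>b \<in> D\<close> subring_mult[OF D_subring] by simp
  obtain P n where P: "a - cpoly z P / z ^ n \<in> nonunits D"
    using laurent_leading_part[OF ab(1) \<open>a \<in> D\<close>] .
  obtain Q m where Q: "b - cpoly z Q / z ^ m \<in> nonunits D"
    using laurent_leading_part[OF ab(2) \<open>b \<in> D\<close>] .
  define a0 b0 where "a0 = cpoly z P / z ^ n" and "b0 = cpoly z Q / z ^ m"
  have "Q \<noteq> 0"
  proof
    assume "Q = 0"
    then show False
      using Q ab(4) by (simp add: cpoly_0 nonunits_eq)
  qed
  then have b0: "b0 \<in> unit_set D"
    unfolding b0_def using z_unit cpoly_unit by (intro unit_set_divide[OF D_subring] unit_set_power[OF D_subring])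
  have "a0 = a - (a - a0)"
    by simp
  then have "a0 \<in> D"
    using subring_diff[OF D_subring \<open>a \<in> D\<close>, of "a - a0"] P by (simp add: a0_def nonunits_def)
  have "f - a0 / b0 = inverse (b * b0) * (b0 * (a - a0) - a0 * (b - b0))"
    using \<open>b \<noteq> 0\<close> unit_setD(3)[OF b0] ab(3) by (simp add: field_simps)
  moreover have "inverse (b * b0) \<in> D" "b0 \<in> D"
    using unit_setD(2)[OF unit_set_mult[OF D_subring ab(4) b0]] unit_setD(1)[OF b0] .
  then have "inverse (b * b0) * (b0 * (a - a0) - a0 * (b - b0)) \<in> nonunits D"
    using P Q \<open>a0 \<in> D\<close> unfolding a0_def[symmetric] b0_def[symmetric]
    by (blast intro: ideal_mult[OF D_ideal] ideal_diff[OF D_subring D_ideal])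
  then have res: "f - a0 / b0 \<in> nonunits D"
    using calculation by simp
  have "a0 / b0 = cpoly z (P * Polynomial.monom 1 m) / cpoly z (Q * Polynomial.monom 1 n)"
    using z_nonzero by (simp add: a0_def b0_def cpoly_mult cpoly_monom const_one)
  moreover have "Q * Polynomial.monom 1 n \<noteq> 0"
    using \<open>Q \<noteq> 0\<close> by simp
  ultimately have "a0 / b0 \<in> residues"
    unfolding residues_def by blast
  then show ?thesis
    using that res by metis
qed

end

section \<open>Valuation rings and the canonical module\<close>

lemma submodule_span_principal:
  assumes D: "is_subring D" and sub: "S \<subseteq> (*) g ` D" and g: "g \<in> S"
  shows "submodule_span D S = (*) g ` D"
proof
  show "submodule_span D S \<subseteq> (*) g ` D"
  proof
    fix x assume "x \<in> submodule_span D S"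
    then obtain T c where T: "x = (\<Sum>s\<in>T. c s * s)" "T \<subseteq> S" "\<forall>s\<in>T. c s \<in> D"
      by (auto simp: submodule_span_def)
    have "\<forall>s\<in>T. \<exists>d\<in>D. s = g * d"
      using T(2) sub by blast
    then obtain d where d: "\<And>s. s \<in> T \<Longrightarrow> d s \<in> D \<and> s = g * d s"
      by metis
    have "x = (\<Sum>s\<in>T. g * (c s * d s))"
      unfolding T(1)
    proof (rule sum.cong[OF refl])
      fix s assume "s \<in> T"
      then have "s = g * d s"
        using d by blast
      then have "c s * s = c s * (g * d s)"
        by (rule arg_cong)
      then show "c s * s = g * (c s * d s)"
        by (simp only: mult.left_commute)
    qed
    then have "x = g * (\<Sum>s\<in>T. c s * d s)"
      by (simp add: sum_distrib_left)
    moreover have "(\<Sum>s\<in>T. c s * d s) \<in> D"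
      using T(3) d by (intro subring_sum[OF D] subring_mult[OF D]) auto
    ultimately show "x \<in> (*) g ` D"
      by blast
  qed
  show "(*) g ` D \<subseteq> submodule_span D S"
  proof
    fix x assume "x \<in> (*) g ` D"
    then obtain d where d: "x = g * d" "d \<in> D"
      by blast
    have "x = (\<Sum>s\<in>{g}. d * s)" "finite {g}" "{g} \<subseteq> S" "\<forall>s\<in>{g}. d \<in> D"
      using d g by (auto simp: mult.commute)
    then show "x \<in> submodule_span D S"
      unfolding submodule_span_def mem_Collect_eq by (intro exI[of _ "{g}"] exI[of _ "\<lambda>_. d"]) simp
  qed
qed

section \<open>Centres of valuation rings on projective models\<close>

definition valuation_ring :: "'k::field set \<Rightarrow> bool" where
  "valuation_ring V \<longleftrightarrow> is_subring V \<and> (\<forall>f. f \<noteq> 0 \<longrightarrow> f \<in> V \<or> inverse f \<in> V)"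

lemma valuation_ring_local:
  assumes V: "valuation_ring V"
  shows "local_subring V"
proof -
  have sV: "is_subring V" and total: "\<And>f. f \<noteq> 0 \<Longrightarrow> f \<in> V \<or> inverse f \<in> V"
    using V by (auto simp: valuation_ring_def)
  have mult: "a * x \<in> nonunits V" if ax: "a \<in> V" "x \<in> nonunits V" for a x
  proof -
    have x: "x \<in> V" "x \<notin> unit_set V"
      using ax by (auto simp: nonunits_eq)
    have "a * x \<notin> unit_set V"
    proof
      assume unit: "a * x \<in> unit_set V"
      have "inverse (a * x) * a \<in> V"
        using unit_setD(2)[OF unit] ax subring_mult[OF sV] by blast
      moreover have "inverse (a * x) * a = inverse x"
        using unit_setD(3)[OF unit] by (simp add: field_simps)
      ultimately have "inverse x \<in> V"
        by (simp only:)
      then show False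
        using x unit_setD(3)[OF unit] by (simp add: unit_set_def)
    qed
    then show ?thesis
      using ax x subring_mult[OF sV] by (simp add: nonunits_eq)
  qed
  have add: "x + y \<in> nonunits V" if xy: "x \<in> nonunits V" "y \<in> nonunits V" for x y
  proof (cases "x = 0 \<or> y = 0")
    case False
    then have "x / y \<in> V \<or> y / x \<in> V"
      using total[of "x / y"] by auto
    moreover have "x + y = (x / y + 1) * y" "x + y = (y / x + 1) * x"
      using False by (simp_all add: field_simps)
    ultimately show ?thesis
      using mult xy subring_add[OF sV _ subring_one[OF sV]] by metis
  qed (use xy in auto)
  show ?thesis
    unfolding local_subring_iff is_ideal_def
    using sV add mult subring_zero[OF sV] by (auto simp: nonunits_eq unit_set_def)
qed

text \<open>The valuative criterion of properness: divide by a homogeneous coordinate of least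
  value. The ring of that chart then lies in \<open>V\<close>, and the maximal ideal of
  \<open>V\<close> cuts out the prime of the centre.\<close>

lemma projective_center:
  assumes "projective_model M" "M \<noteq> {}" and V: "valuation_ring V" "range const \<subseteq> V"
  obtains p where "p \<in> M" "dominates V p"
proof -
  have sV: "is_subring V" and total: "\<And>f. f \<noteq> 0 \<Longrightarrow> f \<in> V \<or> inverse f \<in> V"
    using V by (auto simp: valuation_ring_def)
  have lV: "local_subring V"
    by (rule valuation_ring_local[OF V(1)])
  obtain F where F: "finite F"
    "M = (\<Union>g\<in>F - {0}. affine_model (adjoin (range const) ((\<lambda>f. f / g) ` F)))"
    using assms(1) unfolding projective_model_def by blast
  have least: "\<exists>g\<in>G. \<forall>f\<in>G. f / g \<in> V" if "finite G" "G \<noteq> {}" "0 \<notin> G" for G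
    using that
  proof (induction G rule: finite_ne_induct)
    case (singleton x)
    then show ?case
      using subring_one[OF sV] by simp
  next
    case (insert x G)
    then obtain g where g: "g \<in> G" "\<And>f. f \<in> G \<Longrightarrow> f / g \<in> V"
      by auto
    have nz: "x \<noteq> 0" "g \<noteq> 0"
      using insert g by auto
    show ?case
    proof (cases "x / g \<in> V")
      case True
      then show ?thesis
        using g by auto
    next
      case False
      then have "g / x \<in> V"
        using total[of "x / g"] nz by auto
      moreover have "f / x = f / g * (g / x)" for f
        using nz by simp
      ultimately have "\<forall>f\<in>G. f / x \<in> V"
        using g subring_mult[OF sV] by metis
      then show ?thesis
        using nz subring_one[OF sV] by auto
    qed
  qed
  have "F - {0} \<noteq> {}"
    using F(2) assms(2) by auto
  then obtain g where g: "g \<in> F - {0}" "\<forall>f\<in>F - {0}. f / g \<in> V"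
    using least[of "F - {0}"] F(1) by auto
  define B where "B = adjoin (range const) ((\<lambda>f. f / g) ` F)"
  have B: "is_subring B"
    by (simp add: B_def adjoin_subring)
  have "f / g \<in> V" if "f \<in> F" for f
    using g that subring_zero[OF sV] by (cases "f = 0") auto
  then have "B \<subseteq> V"
    unfolding B_def using V(2) by (intro adjoin_least sV) auto
  define P where "P = B \<inter> nonunits V"
  have pV: "is_prime V (nonunits V)" and iV: "is_ideal V (nonunits V)"
    using localization_nonunits(1)[OF lV] local_subring_ideal[OF lV] by auto
  have "x \<in> P \<or> y \<in> P" if "x \<in> B" "y \<in> B" "x * y \<in> P" for x y
    using prime_mult[OF pV, of x y] \<open>B \<subseteq> V\<close> that by (auto simp: P_def)
  then have P: "is_prime B P"
    using B \<open>B \<subseteq> V\<close> prime_one[OF pV] ideal_zero[OF iV] ideal_add[OF iV] ideal_mult[OF iV]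
    unfolding is_prime_def is_ideal_def P_def by (auto intro: subring_closed subset_eq)
  define p where "p = localization B P"
  have "p \<in> M"
    using g(1) B P unfolding F(2) p_def affine_model_def' B_def by blast
  have unit: "b \<in> unit_set V" if "b \<in> B - P" for b
    using that \<open>B \<subseteq> V\<close> by (auto simp: P_def nonunits_eq)
  have "p \<subseteq> V"
  proof
    fix x assume "x \<in> p"
    then obtain a b where "a \<in> B" "b \<in> B - P" "x = a / b"
      unfolding p_def by (rule localizationE[OF B P]) blast
    then show "x \<in> V"
      using \<open>B \<subseteq> V\<close> unit_setD(2)[OF unit] by (auto simp: divide_inverse intro: subring_mult[OF sV])
  qed
  moreover have "nonunits p \<subseteq> nonunits V"
  proof
    fix x assume "x \<in> nonunits p"
    then obtain a b where "a \<in> P" "b \<in> B - P" "x = a / b"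
      unfolding p_def nonunits_localization[OF B P] by blast
    then show "x \<in> nonunits V"
      using unit_setD(2)[OF unit] by (auto simp: divide_inverse P_def intro: ideal_mult_right[OF iV])
  qed
  ultimately show ?thesis
    using that \<open>p \<in> M\<close> by (simp add: dominates_def)
qed

section \<open>Two-forms at points of codimension one\<close>

context toric_model
begin

text \<open>\<open>dX \<and> dY\<close> is a generator: \<open>D\<close> is stable under the
  invariant fields and the product of the coordinates is a unit, so every Jacobian is
  regular.\<close>

lemma torus_codim_one_canonical:
  assumes D: "D \<in> M" and X: "coord_X \<in> unit_set D" and Y: "coord_Y \<in> unit_set D"
  shows "submodule_span D {jacobian a b | a b. a \<in> D \<and> b \<in> D} = D"
proof -
  have sD: "is_subring D"
    by (rule point_subring[OF D])
  have "submodule_span D {jacobian a b | a b. a \<in> D \<and> b \<in> D} = (*) 1 ` D"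
  proof (rule submodule_span_principal[OF sD])
    have "jacobian coord_X coord_Y = (1 :: ratfun)"
      by (simp add: jacobian_def partial_coord)
    then show "1 \<in> {jacobian a b | a b. a \<in> D \<and> b \<in> D}"
      using unit_setD(1)[OF X] unit_setD(1)[OF Y] by force
    have "jacobian a b \<in> D" if "a \<in> D" "b \<in> D" for a b
      unfolding jacobian_theta divide_inverse
      using that point_theta[OF D] unit_setD(2)[OF unit_set_mult[OF sD X Y]]
      by (intro subring_mult[OF sD] subring_diff[OF sD])
    then show "{jacobian a b | a b. a \<in> D \<and> b \<in> D} \<subseteq> (*) 1 ` D"
      by auto
  qed
  then show ?thesis
    by simp
qed

end

context boundary
begin

text \<open>Its eigenvalue on \<open>lmon k\<close> is the weight \<open>dot u k\<close>. It behaves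
  like \<open>t d/dt\<close> for a uniformizer \<open>t\<close> and annihilates \<open>z\<close> and
  with it all \<open>residues\<close>.\<close>

definition theta_radial :: "ratfun \<Rightarrow> ratfun" where
  "theta_radial f = const (of_int (fst u)) * theta_X f + const (of_int (snd u)) * theta_Y f"

lemma derivation_theta_radial: "derivation theta_radial"
  unfolding theta_radial_def by (intro derivation_combination theta_const derivation_theta)

lemma theta_radial_lmon: "theta_radial (lmon k) = const (of_int (dot u k)) * lmon k"
  by (simp add: theta_radial_def theta_lmon dot_def const_of_int const_add const_mult algebra_simps)

lemma theta_radial_residue: "r \<in> residues \<Longrightarrow> theta_radial r = 0"
proof -
  have z: "theta_radial z = 0"
    by (simp add: theta_radial_lmon dot_edge const_zero)
  have const: "theta_radial (const a) = 0" for a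
    by (simp add: theta_radial_def theta_const)
  have poly: "theta_radial (cpoly z P) = 0" for P
    by (induction P)
      (simp_all add: cpoly_0 cpoly_pCons z const derivation_zero[OF derivation_theta_radial]
        derivation_add[OF derivation_theta_radial] derivation_mult[OF derivation_theta_radial])
  assume "r \<in> residues"
  then obtain P Q where "r = cpoly z P / cpoly z Q" "Q \<noteq> 0"
    by (auto simp: residues_def)
  then show ?thesis
    using unit_setD(3)[OF cpoly_unit] by (simp add: derivation_divide[OF derivation_theta_radial] poly)
qed

text \<open>Split \<open>f\<close> into a residue, which is annihilated, and a multiple of a
  monomial of weight 1, whose derivative is again a multiple of that monomial.\<close>

lemma theta_radial_nonunit:
  assumes f: "f \<in> D"
  shows "theta_radial f \<in> nonunits D"
proof -
  obtain r where r: "r \<in> residues" "f - r \<in> nonunits D"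
    using D_residue[OF f] .
  obtain l where l: "dot u l = 1"
    by (rule weight_surj)
  define h where "h = (f - r) / lmon l"
  have "h \<in> D"
  proof (cases "h = 0")
    case False
    then show ?thesis
      using r(2) l by (auto simp: h_def dvr_mem_iff[OF dvr] dvr_nonunit_iff[OF dvr] dval_divide[OF dvr] lmon_nonzero dval_lmon)
  qed (simp add: subring_zero[OF D_subring])
  have "theta_radial h \<in> D"
    unfolding theta_radial_def using D_point \<open>h \<in> D\<close>
    by (intro subring_add[OF D_subring] subring_mult[OF D_subring] point_const point_theta)
  have "theta_radial f = theta_radial (f - r)"
    using theta_radial_residue[OF r(1)] by (simp add: derivation_diff[OF derivation_theta_radial])
  also have "f - r = lmon l * h"
    by (simp add: h_def lmon_nonzero)
  also have "theta_radial \<dots> = (h + theta_radial h) * lmon l"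
    using l by (simp add: derivation_mult[OF derivation_theta_radial] theta_radial_lmon const_one algebra_simps)
  finally show ?thesis
    using \<open>h \<in> D\<close> \<open>theta_radial h \<in> D\<close> l
    by (simp add: ideal_mult[OF D_ideal] subring_add[OF D_subring] lmon_nonunit_iff)
qed

text \<open>Cramer's rule: times a component of \<open>u\<close>, the wedge is a combination of the
  radial derivatives of \<open>a\<close> and \<open>b\<close>, which lie in the maximal ideal. One
  of the components is a nonzero constant and can be cancelled.\<close>

lemma wedge_nonunit:
  assumes a: "a \<in> D" and b: "b \<in> D"
  shows "theta_X a * theta_Y b - theta_Y a * theta_X b \<in> nonunits D"
proof -
  define w where "w = theta_X a * theta_Y b - theta_Y a * theta_X b"
  note th = point_theta[OF D_point a] point_theta[OF D_point b] theta_radial_nonunit[OF a] theta_radial_nonunit[OF b]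
  have "const (of_int (fst u)) * w = theta_Y b * theta_radial a - theta_Y a * theta_radial b"
    "const (of_int (snd u)) * w = theta_X a * theta_radial b - theta_X b * theta_radial a"
    by (simp_all add: w_def theta_radial_def algebra_simps)
  then have mem: "const (of_int (fst u)) * w \<in> nonunits D" "const (of_int (snd u)) * w \<in> nonunits D"
    using th by (simp_all add: ideal_diff[OF D_subring D_ideal] ideal_mult[OF D_ideal])
  have cancel: "w \<in> nonunits D" if "const c * w \<in> nonunits D" "c \<noteq> 0" for c
  proof -
    have eq: "const (inverse c) * (const c * w) = w"
      using that(2) const_eq_0_iff[of c] by (simp add: const_inverse)
    have "const (inverse c) * (const c * w) \<in> nonunits D"
      by (rule ideal_mult[OF D_ideal point_const[OF D_point] that(1)])
    then show ?thesis
      unfolding eq .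
  qed
  have "fst u \<noteq> 0 \<or> snd u \<noteq> 0"
    using weight_nonzero by (auto simp: zero_prod_def prod_eq_iff)
  then show ?thesis
    using cancel[OF mem(1)] cancel[OF mem(2)] by (auto simp: w_def)
qed

text \<open>The invariant form \<open>dX/X \<and> dY/Y\<close> has a simple pole along
  \<open>D\<close>, so a monomial of weight 1 times it generates. The shift by \<open>(1, 1)\<close>
  appears because forms are written relative to \<open>dX \<and> dY\<close>.\<close>

lemma boundary_canonical:
  assumes l: "dot u l = 1"
  shows "submodule_span D {jacobian a b | a b. a \<in> D \<and> b \<in> D} = (*) (lmon (l - (1, 1))) ` D"
proof -
  have "submodule_span D {jacobian a b | a b. a \<in> D \<and> b \<in> D} = (*) (lmon (l + edge - (1, 1))) ` D"
  proof (rule submodule_span_principal[OF D_subring])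
    have "fst l * snd edge - snd l * fst edge = dot u l"
      by (simp add: edge_def dot_def)
    then have "theta_X (lmon l) * theta_Y z - theta_Y (lmon l) * theta_X z = lmon l * (z :: ratfun)"
      unfolding theta_lmon using l by (simp add: algebra_simps flip: of_int_mult of_int_diff)
    then have "jacobian (lmon l) z = lmon (l + edge - (1, 1))"
      by (simp add: jacobian_theta lmon_diff lmon_add lmon_coord)
    moreover have "lmon l \<in> D" "z \<in> D"
      using l by (simp_all add: lmon_mem_iff dot_edge)
    ultimately show "lmon (l + edge - (1, 1)) \<in> {jacobian a b | a b. a \<in> D \<and> b \<in> D}"
      by force
    show "{jacobian a b | a b. a \<in> D \<and> b \<in> D} \<subseteq> (*) (lmon (l + edge - (1, 1))) ` D"
    proof clarify
      fix a b assume ab: "a \<in> D" "b \<in> D"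
      define w where "w = theta_X a * theta_Y b - theta_Y a * theta_X b"
      have "w \<in> nonunits D"
        unfolding w_def using ab by (rule wedge_nonunit)
      then have "w / lmon (l + edge) \<in> D"
        by (cases "w = 0") (use l in \<open>auto simp: dvr_mem_iff[OF dvr] dvr_nonunit_iff[OF dvr] dval_divide[OF dvr]
            lmon_nonzero dval_lmon dot_add dot_edge subring_zero[OF D_subring]\<close>)
      moreover have "jacobian a b / lmon (l + edge - (1, 1)) = w / lmon (l + edge)"
        by (simp add: jacobian_theta w_def lmon_diff lmon_coord lmon_nonzero coord_nonzero)
      ultimately show "jacobian a b \<in> (*) (lmon (l + edge - (1, 1))) ` D"
        by (simp add: mem_image_mult_iff lmon_nonzero)
    qed
  qed
  also have "lmon (l + edge - (1, 1)) = lmon (l - (1, 1)) * z"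
    by (simp add: lmon_diff lmon_add)
  also have "(*) (lmon (l - (1, 1)) * z) ` D = (*) (lmon (l - (1, 1))) ` D"
    by (rule image_mult_unit[OF D_subring z_unit])
  finally show ?thesis .
qed

end

section \<open>Composite valuations\<close>

context boundary
begin

lemma cpoly_eq_iff: "cpoly z P = cpoly z Q \<longleftrightarrow> P = Q"
  using unit_setD(3)[OF cpoly_unit[of "P - Q"]] by (auto simp: cpoly_diff)

lemma cpoly_eq_0_iff: "cpoly z P = 0 \<longleftrightarrow> P = 0"
  using cpoly_eq_iff[of P 0] by (simp add: cpoly_0)

lemma cpoly_frac_eq:
  "Q \<noteq> 0 \<Longrightarrow> Q' \<noteq> 0 \<Longrightarrow> cpoly z P / cpoly z Q = cpoly z P' / cpoly z Q' \<longleftrightarrow> P * Q' = P' * Q"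
  by (simp add: frac_eq_eq cpoly_eq_0_iff cpoly_eq_iff flip: cpoly_mult)

lemma fraction_set_subring:
  assumes "1 \<in> N" "\<And>P Q P' Q'. Q \<in> N \<Longrightarrow> Q' \<in> N \<Longrightarrow> Q * Q' \<in> N" "0 \<notin> N"
  shows "is_subring {cpoly z P / cpoly z Q | P Q. Q \<in> N}"
  unfolding is_subring_def
proof (intro conjI ballI)
  have "(1 :: ratfun) = cpoly z 1 / cpoly z 1"
    by (simp add: cpoly_1)
  then show "1 \<in> {cpoly z P / cpoly z Q | P Q. Q \<in> N}"
    using assms(1) by blast
  fix x y assume "x \<in> {cpoly z P / cpoly z Q | P Q. Q \<in> N}" "y \<in> {cpoly z P / cpoly z Q | P Q. Q \<in> N}"
  then obtain P Q P' Q' where *: "x = cpoly z P / cpoly z Q" "Q \<in> N" "y = cpoly z P' / cpoly z Q'" "Q' \<in> N"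
    by blast
  then have nz: "cpoly z Q \<noteq> 0" "cpoly z Q' \<noteq> 0"
    using assms(3) by (auto simp: cpoly_eq_0_iff)
  have "x - y = cpoly z (P * Q' - P' * Q) / cpoly z (Q * Q')"
    using nz by (simp add: * cpoly_diff cpoly_mult diff_frac_eq)
  moreover have "x * y = cpoly z (P * P') / cpoly z (Q * Q')"
    by (simp add: * cpoly_mult)
  moreover have "Q * Q' \<in> N"
    using assms(2) * by blast
  ultimately show "x - y \<in> {cpoly z P / cpoly z Q | P Q. Q \<in> N}" "x * y \<in> {cpoly z P / cpoly z Q | P Q. Q \<in> N}"
    by blast+
qed

lemma residues_subring: "is_subring residues"
  using fraction_set_subring[of "- {0}"] by (simp add: residues_def)

lemma residue_unit: "r \<in> residues \<Longrightarrow> r \<noteq> 0 \<Longrightarrow> r \<in> unit_set D"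
  by (auto simp: residues_def cpoly_eq_0_iff intro!: unit_set_divide[OF D_subring] cpoly_unit)

lemma residue_mem: "r \<in> residues \<Longrightarrow> r \<in> D"
  using residue_unit[of r] subring_zero[OF D_subring] by (cases "r = 0") (auto dest: unit_setD)

definition residue_valuation :: "ratfun set \<Rightarrow> bool" where
  "residue_valuation V \<longleftrightarrow> V \<subseteq> residues \<and> is_subring V \<and> range const \<subseteq> V \<and>
    (\<forall>r\<in>residues. r \<noteq> 0 \<longrightarrow> r \<in> V \<or> inverse r \<in> V)"

text \<open>The composite of the valuation of \<open>D\<close> with one of its residue field \<open>\<complex>(z)\<close>.\<close>

definition composite :: "ratfun set \<Rightarrow> ratfun set" where
  "composite V = {f \<in> D. \<exists>r\<in>V. f - r \<in> nonunits D}"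

lemma composite_subset: "composite V \<subseteq> D"
  by (auto simp: composite_def)

lemma unit_residue_unit:
  assumes "r \<in> D" "d - r \<in> nonunits D" "d \<in> D"
  shows "d \<in> unit_set D \<longleftrightarrow> r \<in> unit_set D"
  using assms ideal_add[OF D_ideal assms(2), of r] ideal_diff[OF D_subring D_ideal _ assms(2), of d]
  by (auto simp: nonunits_eq)

lemma inverse_residue:
  assumes "d \<in> unit_set D" "r \<in> unit_set D" "d - r \<in> nonunits D"
  shows "inverse d - inverse r \<in> nonunits D"
proof -
  have "inverse d - inverse r = - (inverse d * inverse r * (d - r))"
    using unit_setD(3)[OF assms(1)] unit_setD(3)[OF assms(2)] by (simp add: field_simps)
  then show ?thesis
    using assms by (simp add: ideal_uminus[OF D_subring D_ideal] ideal_mult[OF D_ideal] subring_mult[OF D_subring] unit_setD)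
qed

text \<open>The maximal ideal of \<open>D\<close> lies in every composite. If neither a function nor
  its inverse belongs to it, the function is a unit of \<open>D\<close>, and its residue
  decides.\<close>

lemma composite_valuation:
  assumes V: "residue_valuation V"
  shows "valuation_ring (composite V)" "range const \<subseteq> composite V"
proof -
  have sV: "is_subring V" and VR: "V \<subseteq> residues" and const: "range const \<subseteq> V"
    and total: "\<And>r. r \<in> residues \<Longrightarrow> r \<noteq> 0 \<Longrightarrow> r \<in> V \<or> inverse r \<in> V"
    using V by (auto simp: residue_valuation_def)
  have VD: "r \<in> D" if "r \<in> V" for r
    using that VR residue_mem by blast
  have V_mem: "r \<in> composite V" if "r \<in> V" for r
    using that VD ideal_zero[OF D_ideal] by (auto simp: composite_def intro!: bexI[of _ r])
  show "range const \<subseteq> composite V"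
    using const V_mem by blast
  have "is_subring (composite V)"
    unfolding is_subring_def
  proof (intro conjI ballI)
    show "1 \<in> composite V"
      using V_mem subring_one[OF sV] by blast
    fix f g assume "f \<in> composite V" "g \<in> composite V"
    then obtain r s where *: "f \<in> D" "r \<in> V" "f - r \<in> nonunits D" "g \<in> D" "s \<in> V" "g - s \<in> nonunits D"
      by (auto simp: composite_def)
    have "f - g - (r - s) = (f - r) - (g - s)" "f * g - r * s = g * (f - r) + r * (g - s)"
      by (simp_all add: algebra_simps)
    then have "f - g - (r - s) \<in> nonunits D" "f * g - r * s \<in> nonunits D"
      using * VD ideal_diff[OF D_subring D_ideal] ideal_add[OF D_ideal] ideal_mult[OF D_ideal] by metis+
    then show "f - g \<in> composite V" "f * g \<in> composite V"
      using * subring_diff[OF sV] subring_mult[OF sV] subring_diff[OF D_subring] subring_mult[OF D_subring]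
      unfolding composite_def by blast+
  qed
  moreover have "f \<in> composite V \<or> inverse f \<in> composite V" if f: "f \<noteq> 0" for f
  proof -
    have nonunit: "g \<in> composite V" if "g \<in> nonunits D" for g
      using that subring_zero[OF sV] by (auto simp: composite_def nonunits_eq intro!: bexI[of _ 0])
    consider "f \<in> nonunits D" | "inverse f \<in> nonunits D" | "f \<in> unit_set D"
      using f dvr_nonunit_iff[OF dvr, of f] dvr_nonunit_iff[OF dvr, of "inverse f"] dval_inverse[OF dvr f]
        dvr_unit_iff[OF dvr, of f] by linarith
    then show ?thesis
    proof cases
      case 3
      then obtain r where r: "r \<in> residues" "f - r \<in> nonunits D"
        using D_residue[of f] by (auto dest: unit_setD)
      then have ru: "r \<in> unit_set D"
        using unit_residue_unit[of r f] residue_mem 3 by (auto dest: unit_setD)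
      have "inverse f - inverse r \<in> nonunits D"
        by (rule inverse_residue[OF 3 ru r(2)])
      then show ?thesis
        using total[OF r(1)] ru 3 r(2) unfolding composite_def unit_set_def by blast
    qed (use nonunit in auto)
  qed
  ultimately show "valuation_ring (composite V)"
    by (simp add: valuation_ring_def)
qed

text \<open>Distinct residues are incongruent, because nonzero residues are units of
  \<open>D\<close>.\<close>

lemma composite_residue:
  assumes V: "V \<subseteq> residues" and r: "r \<in> residues" "r \<in> composite V"
  shows "r \<in> V"
proof -
  obtain s where s: "s \<in> V" "r - s \<in> nonunits D"
    using r(2) by (auto simp: composite_def)
  have "r - s \<in> residues"
    using V r(1) s(1) subring_diff[OF residues_subring] by blast
  then have "r - s = 0"
    using residue_unit[of "r - s"] s(2) by (auto simp: nonunits_eq)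
  then show ?thesis
    using s(1) by simp
qed

lemma composite_unit:
  assumes V: "V \<subseteq> residues" and r: "r \<in> unit_set V" and d: "d \<in> D" "d - r \<in> nonunits D"
  shows "d \<in> unit_set (composite V)"
proof -
  have rD: "r \<in> unit_set D"
    using V r residue_unit by (auto simp: unit_set_def)
  then have dD: "d \<in> unit_set D"
    using unit_residue_unit[of r d] d by (auto dest: unit_setD)
  then show ?thesis
    using inverse_residue[OF dD rD d(2)] d r unit_setD[OF dD] unfolding composite_def unit_set_def by blast
qed

section \<open>Places of the residue field of a boundary divisor\<close>

definition place_at :: "complex \<Rightarrow> ratfun set" where
  "place_at c = {cpoly z P / cpoly z Q | P Q. poly Q c \<noteq> 0}"

definition place_infinity :: "ratfun set" where
  "place_infinity = {cpoly z P / cpoly z Q | P Q. Q \<noteq> 0 \<and> degree P \<le> degree Q}"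

lemma place_at_normal_form:
  assumes "r \<in> residues" "r \<noteq> 0"
  obtains m n P Q where "poly P c \<noteq> 0" "poly Q c \<noteq> 0"
    "r = cpoly z ([:- c, 1:] ^ m * P) / cpoly z ([:- c, 1:] ^ n * Q)"
proof -
  obtain P Q where PQ: "r = cpoly z P / cpoly z Q" "Q \<noteq> 0"
    using assms(1) by (auto simp: residues_def)
  then have "P \<noteq> 0"
    using assms(2) by (auto simp: cpoly_0)
  obtain P' where P': "P = [:- c, 1:] ^ order c P * P'" "\<not> [:- c, 1:] dvd P'"
    using order_decomp[OF \<open>P \<noteq> 0\<close>] by blast
  obtain Q' where Q': "Q = [:- c, 1:] ^ order c Q * Q'" "\<not> [:- c, 1:] dvd Q'"
    using order_decomp[OF PQ(2)] by blast
  show ?thesis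
    using that[of P' Q' "order c P" "order c Q"] PQ(1) P' Q' by (simp add: poly_eq_0_iff_dvd)
qed

lemma place_at_valuation: "residue_valuation (place_at c)"
  unfolding residue_valuation_def
proof (intro conjI ballI impI)
  have "Q \<noteq> 0" if "poly Q c \<noteq> 0" for Q
    using that by auto
  then show "place_at c \<subseteq> residues"
    unfolding place_at_def residues_def by blast
  show "is_subring (place_at c)"
    using fraction_set_subring[of "{Q. poly Q c \<noteq> 0}"] by (simp add: place_at_def)
  show "range const \<subseteq> place_at c"
  proof clarify
    fix a :: complex
    have "const a = cpoly z [:a:] / cpoly z 1"
      by (simp add: cpoly_pCons cpoly_0 cpoly_1)
    moreover have "poly 1 c \<noteq> 0"
      by simp
    ultimately show "const a \<in> place_at c"
      unfolding place_at_def by blast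
  qed
  fix r assume r: "r \<in> residues" "r \<noteq> 0"
  obtain m n P Q where *: "poly P c \<noteq> 0" "poly Q c \<noteq> 0"
    "r = cpoly z ([:- c, 1:] ^ m * P) / cpoly z ([:- c, 1:] ^ n * Q)"
    using place_at_normal_form[OF r] .
  have nz: "cpoly z [:- c, 1:] \<noteq> 0"
    by (simp add: cpoly_eq_0_iff)
  show "r \<in> place_at c \<or> inverse r \<in> place_at c"
  proof (cases "n \<le> m")
    case True
    then have "r = cpoly z ([:- c, 1:] ^ (m - n) * P) / cpoly z Q"
      unfolding *(3) cpoly_mult cpoly_power using nz by (simp add: power_diff)
    then show ?thesis
      using *(2) unfolding place_at_def by blast
  next
    case False
    then have "inverse r = cpoly z ([:- c, 1:] ^ (n - m) * Q) / cpoly z P"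
      unfolding *(3) cpoly_mult cpoly_power using nz by (simp add: power_diff)
    then show ?thesis
      using *(1) unfolding place_at_def by blast
  qed
qed

lemma place_infinity_valuation: "residue_valuation place_infinity"
  unfolding residue_valuation_def
proof (intro conjI ballI impI)
  show "place_infinity \<subseteq> residues"
    by (auto simp: place_infinity_def residues_def)
  show "is_subring place_infinity"
    unfolding is_subring_def
  proof (intro conjI ballI)
    have "(1 :: ratfun) = cpoly z 1 / cpoly z 1"
      by (simp add: cpoly_1)
    moreover have "(1 :: complex poly) \<noteq> 0 \<and> degree (1 :: complex poly) \<le> degree (1 :: complex poly)"
      by simp
    ultimately show "1 \<in> place_infinity"
      unfolding place_infinity_def by blast
    fix x y assume "x \<in> place_infinity" "y \<in> place_infinity"
    then obtain P Q P' Q' where *: "x = cpoly z P / cpoly z Q" "Q \<noteq> 0" "degree P \<le> degree Q"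
      "y = cpoly z P' / cpoly z Q'" "Q' \<noteq> 0" "degree P' \<le> degree Q'"
      unfolding place_infinity_def by blast
    have QQ: "Q * Q' \<noteq> 0" "degree (Q * Q') = degree Q + degree Q'"
      using * by (auto simp: degree_mult_eq)
    have deg: "degree (P * Q') \<le> degree Q + degree Q'" "degree (P' * Q) \<le> degree Q + degree Q'"
      "degree (P * P') \<le> degree Q + degree Q'"
      using * degree_mult_le[of P Q'] degree_mult_le[of P' Q] degree_mult_le[of P P'] by linarith+
    have "x - y = cpoly z (P * Q' - P' * Q) / cpoly z (Q * Q')"
      using * by (simp add: cpoly_diff cpoly_mult diff_frac_eq cpoly_eq_0_iff)
    moreover have "degree (P * Q' - P' * Q) \<le> degree (Q * Q')"
      unfolding QQ by (rule degree_diff_le[OF deg(1,2)])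
    ultimately show "x - y \<in> place_infinity"
      unfolding place_infinity_def using QQ(1) by blast
    have "x * y = cpoly z (P * P') / cpoly z (Q * Q')"
      by (simp add: * cpoly_mult)
    moreover have "Q * Q' \<noteq> 0 \<and> degree (P * P') \<le> degree (Q * Q')"
      using QQ deg(3) by simp
    ultimately show "x * y \<in> place_infinity"
      unfolding place_infinity_def by blast
  qed
  show "range const \<subseteq> place_infinity"
  proof clarify
    fix a :: complex
    have "const a = cpoly z [:a:] / cpoly z 1"
      by (simp add: cpoly_pCons cpoly_0 cpoly_1)
    moreover have "(1 :: complex poly) \<noteq> 0 \<and> degree [:a:] \<le> degree (1 :: complex poly)"
      by simp
    ultimately show "const a \<in> place_infinity"
      unfolding place_infinity_def by blast
  qed
  fix r assume r: "r \<in> residues" "r \<noteq> 0"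
  then obtain P Q where PQ: "r = cpoly z P / cpoly z Q" "Q \<noteq> 0"
    by (auto simp: residues_def)
  then have "P \<noteq> 0" "inverse r = cpoly z Q / cpoly z P"
    using r(2) by (auto simp: cpoly_0)
  then show "r \<in> place_infinity \<or> inverse r \<in> place_infinity"
    using PQ linear[of "degree P" "degree Q"] unfolding place_infinity_def by blast
qed

text \<open>At 0 and at infinity \<open>z\<close> generates the value group; at the other places it
  is a unit. This is why just these two places lead to monomial composites.\<close>

lemma residue_at_zero:
  assumes "r \<in> residues" "r \<noteq> 0"
  obtains j where "r / z powi j \<in> unit_set (place_at 0)"
proof -
  obtain m n P Q where *: "poly P 0 \<noteq> 0" "poly Q 0 \<noteq> 0"
    "r = cpoly z ([:- 0, 1:] ^ m * P) / cpoly z ([:- 0, 1:] ^ n * Q)"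
    using place_at_normal_form[OF assms, of 0] .
  have "cpoly z [:- 0, 1:] = z"
    by (simp add: cpoly_pCons cpoly_0 const_zero const_one)
  then have eq: "r / z powi (int m - int n) = cpoly z P / cpoly z Q"
    using z_nonzero unfolding *(3) cpoly_mult cpoly_power by (simp add: power_int_diff)
  have "inverse (cpoly z P / cpoly z Q) = cpoly z Q / cpoly z P"
    by simp
  then have "cpoly z P / cpoly z Q \<in> unit_set (place_at 0)"
    using * unfolding unit_set_def place_at_def by (auto simp: cpoly_eq_0_iff)
  then show ?thesis
    using that eq by metis
qed

lemma residue_at_infinity:
  assumes "r \<in> residues" "r \<noteq> 0"
  obtains j where "r / z powi j \<in> unit_set place_infinity"
proof -
  obtain P Q where PQ: "r = cpoly z P / cpoly z Q" "Q \<noteq> 0"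
    using assms(1) by (auto simp: residues_def)
  then have "P \<noteq> 0"
    using assms(2) by (auto simp: cpoly_0)
  \<comment> \<open>Suitable powers of \<open>z\<close> equalize the degrees of numerator and
    denominator.\<close>
  define P' Q' where "P' = P * Polynomial.monom 1 (degree Q)" and "Q' = Q * Polynomial.monom 1 (degree P)"
  have "P' \<noteq> 0" "Q' \<noteq> 0" "degree P' = degree Q'"
    using PQ(2) \<open>P \<noteq> 0\<close> by (simp_all add: P'_def Q'_def degree_mult_eq degree_monom_eq)
  have place: "cpoly z A / cpoly z B \<in> place_infinity" if "B \<noteq> 0" "degree A \<le> degree B" for A B
    unfolding place_infinity_def using that by blast
  have "cpoly z P' / cpoly z Q' \<in> unit_set place_infinity"
    using place[of Q' P'] place[of P' Q'] \<open>P' \<noteq> 0\<close> \<open>Q' \<noteq> 0\<close> \<open>degree P' = degree Q'\<close>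
    by (simp add: unit_set_def cpoly_eq_0_iff)
  moreover have "r / z powi (int (degree P) - int (degree Q)) = cpoly z P' / cpoly z Q'"
    using z_nonzero by (simp add: PQ(1) P'_def Q'_def cpoly_mult cpoly_monom const_one power_int_diff)
  ultimately show ?thesis
    using that by metis
qed

text \<open>A function is a monomial times a unit of \<open>D\<close>, and the residue of that unit
  contributes a power of \<open>z\<close>, again a monomial. So the composites at 0 and at infinity
  are monomial valuations of rank two.\<close>

lemma composite_unit_multiple:
  assumes V: "V \<subseteq> residues" "is_subring V" and unit: "\<And>r. r \<in> residues \<Longrightarrow> r \<noteq> 0 \<Longrightarrow> \<exists>j. r / z powi j \<in> unit_set V"
    and f: "f \<noteq> 0"
  shows "\<exists>l. f / lmon l \<in> unit_set (composite V)"
proof -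
  obtain k where k: "f / lmon k \<in> unit_set D"
    using lmon_unit_multiple[OF f] .
  obtain r where r: "r \<in> residues" "f / lmon k - r \<in> nonunits D"
    using D_residue[OF unit_setD(1)[OF k]] .
  have "r \<noteq> 0"
    using r(2) k by (auto simp: nonunits_eq)
  then obtain j where j: "r / z powi j \<in> unit_set V"
    using unit r(1) by blast
  have zj: "inverse (z powi j) \<in> D"
    using unit_setD(2)[OF unit_set_powi[OF D_subring z_unit]] .
  have "f / lmon k / z powi j - r / z powi j = inverse (z powi j) * (f / lmon k - r)"
    by (simp add: divide_inverse algebra_simps)
  then have "f / lmon k / z powi j - r / z powi j \<in> nonunits D"
    using ideal_mult[OF D_ideal zj r(2)] by simp
  moreover have "f / lmon k / z powi j \<in> D"
    using subring_mult[OF D_subring unit_setD(1)[OF k] zj] by (simp only: divide_inverse)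
  ultimately have "f / lmon k / z powi j \<in> unit_set (composite V)"
    using composite_unit[OF V(1) j] by blast
  moreover have "f / lmon k / z powi j = f / lmon (k + scale j edge)"
    by (simp add: lmon_add lmon_scale)
  ultimately show ?thesis
    by metis
qed

lemma z_powi_residue: "z powi j \<in> residues"
proof (cases "j \<ge> 0")
  case True
  then have "z powi j = cpoly z (Polynomial.monom 1 (nat j)) / cpoly z 1"
    by (simp add: cpoly_monom const_one cpoly_1 power_int_def)
  then show ?thesis
    unfolding residues_def using one_neq_zero by blast
next
  case False
  then have "z powi j = cpoly z 1 / cpoly z (Polynomial.monom 1 (nat (- j)))"
    by (simp add: cpoly_monom const_one cpoly_1 power_int_def divide_inverse power_inverse)
  moreover have "Polynomial.monom 1 (nat (- j)) \<noteq> (0 :: complex poly)"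
    by simp
  ultimately show ?thesis
    unfolding residues_def by blast
qed

lemma z_powi_place_zero:
  assumes "z powi j \<in> composite (place_at 0)"
  shows "j \<ge> 0"
proof (rule ccontr)
  assume neg: "\<not> j \<ge> 0"
  have "z powi j \<in> place_at 0"
    using composite_residue[OF _ z_powi_residue assms] place_at_valuation by (simp add: residue_valuation_def)
  then obtain P Q where PQ: "z powi j = cpoly z P / cpoly z Q" "poly Q 0 \<noteq> 0"
    by (auto simp: place_at_def)
  have "z powi j = cpoly z 1 / cpoly z (Polynomial.monom 1 (nat (- j)))"
    using neg by (simp add: cpoly_monom const_one cpoly_1 power_int_def divide_inverse power_inverse)
  moreover have "Q \<noteq> 0"
    using PQ(2) by auto
  ultimately have "Q = P * Polynomial.monom 1 (nat (- j))"
    using PQ(1) cpoly_frac_eq[of "Polynomial.monom 1 (nat (- j))" Q 1 P] by simp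
  then have "poly Q 0 = poly P 0 * 0 ^ nat (- j)"
    by (simp add: poly_monom)
  then show False
    using PQ(2) neg by (simp add: power_0_left)
qed

lemma z_powi_place_infinity:
  assumes "z powi j \<in> composite place_infinity"
  shows "j \<le> 0"
proof (rule ccontr)
  assume pos: "\<not> j \<le> 0"
  have "z powi j \<in> place_infinity"
    using composite_residue[OF _ z_powi_residue assms] place_infinity_valuation by (simp add: residue_valuation_def)
  then obtain P Q where PQ: "z powi j = cpoly z P / cpoly z Q" "Q \<noteq> 0" "degree P \<le> degree Q"
    by (auto simp: place_infinity_def)
  have "z powi j = cpoly z (Polynomial.monom 1 (nat j)) / cpoly z 1"
    using pos by (simp add: cpoly_monom const_one cpoly_1 power_int_def)
  then have "Polynomial.monom 1 (nat j) * Q = P"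
    using PQ cpoly_frac_eq[of 1 Q "Polynomial.monom 1 (nat j)" P] by simp
  then have "degree P = nat j + degree Q"
    using PQ(2) degree_mult_eq[of "Polynomial.monom 1 (nat j)" Q] by (simp add: degree_monom_eq)
  then show False
    using PQ(3) pos by simp
qed

text \<open>A denominator of least degree has no root: regularity at the root would make the
  numerator vanish there too, and the common factor could be cancelled. So the denominator is
  constant, and regularity at infinity bounds the degree of the numerator.\<close>

lemma constant_of_no_poles:
  assumes at: "\<And>c. r \<in> place_at c" and inf: "r \<in> place_infinity"
  obtains a where "r = const a"
proof -
  define S where "S = {degree Q | P Q. Q \<noteq> 0 \<and> r = cpoly z P / cpoly z Q}"
  have "S \<noteq> {}"
    using inf unfolding S_def place_infinity_def by blast
  then obtain n where n: "n \<in> S" "\<And>m. m \<in> S \<Longrightarrow> n \<le> m"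
    using exists_least_iff[of "\<lambda>n. n \<in> S"] by (metis all_not_in_conv not_less)
  then obtain P Q where PQ: "Q \<noteq> 0" "r = cpoly z P / cpoly z Q" "n = degree Q"
    unfolding S_def by blast
  have "degree Q = 0"
  proof (rule ccontr)
    assume "degree Q \<noteq> 0"
    then obtain c where c: "poly Q c = 0"
      using fundamental_theorem_of_algebra[of Q] constant_degree[of Q] by auto
    obtain P' Q' where *: "r = cpoly z P' / cpoly z Q'" "poly Q' c \<noteq> 0"
      using at[of c] by (auto simp: place_at_def)
    then have "Q' \<noteq> 0"
      by auto
    then have "P * Q' = P' * Q"
      using cpoly_frac_eq[OF PQ(1), of Q' P P'] PQ(2) *(1) by simp
    then have "poly P c * poly Q' c = 0"
      using c by (metis mult_zero_right poly_mult)
    then have "poly P c = 0"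
      using * by simp
    then obtain P1 where P1: "P = [:- c, 1:] * P1"
      by (auto simp: poly_eq_0_iff_dvd)
    obtain Q1 where Q1: "Q = [:- c, 1:] * Q1"
      using c by (auto simp: poly_eq_0_iff_dvd)
    have "Q1 \<noteq> 0"
      using PQ(1) Q1 by auto
    have "cpoly z [:- c, 1:] \<noteq> 0"
      by (simp add: cpoly_eq_0_iff)
    then have "r = cpoly z P1 / cpoly z Q1"
      unfolding PQ(2) P1 Q1 cpoly_mult by simp
    then have "degree Q1 \<in> S"
      unfolding S_def using \<open>Q1 \<noteq> 0\<close> by blast
    moreover have "degree Q = Suc (degree Q1)"
      using \<open>Q1 \<noteq> 0\<close> unfolding Q1 by (subst degree_mult_eq) auto
    ultimately show False
      using n(2)[of "degree Q1"] PQ(3) by simp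
  qed
  then obtain q where q: "Q = [:q:]" "q \<noteq> 0"
    using PQ(1) by (auto elim: degree_eq_zeroE)
  obtain P2 Q2 where P2: "r = cpoly z P2 / cpoly z Q2" "Q2 \<noteq> 0" "degree P2 \<le> degree Q2"
    using inf by (auto simp: place_infinity_def)
  then have "P * Q2 = P2 * Q"
    using cpoly_frac_eq[OF PQ(1) P2(2), of P P2] PQ(2) by simp
  then have eq: "P * Q2 = Polynomial.smult q P2"
    using q by (simp add: mult.commute)
  have "degree P = 0"
  proof (cases "P = 0")
    case False
    have "degree P + degree Q2 = degree P2"
      using False P2(2) q(2) eq by (metis degree_mult_eq degree_smult_eq)
    then show ?thesis
      using P2(3) by simp
  qed simp
  then obtain a where "P = [:a:]"
    by (auto elim: degree_eq_zeroE)
  then have "r = const (a / q)"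
    using PQ(2) q(1) by (simp add: cpoly_pCons cpoly_0 const_divide)
  then show ?thesis
    by (rule that)
qed

end

section \<open>Lattice points, and line bundles on the torus\<close>

text \<open>The apex is moved to 0 and the edge lies at distance
  \<open>a = - \<kappa> j \<ge> 2\<close>. The triangle over the segment from \<open>p\<close> to
  \<open>p + e\<close> meets the line next to the edge in a segment of length
  \<open>(a - 1) / a\<close> in units of \<open>e\<close>, whose ends are multiples of
  \<open>1 / a\<close>; such a segment contains a lattice point. Shrinking towards 0 by
  \<open>(a - 1) / a\<close> makes all inequalities strict, since every \<open>\<kappa> i\<close> is
  negative.\<close>

lemma second_interior_point_aux:
  fixes u :: "'i \<Rightarrow> int \<times> int" and \<kappa> :: "'i \<Rightarrow> int"
  assumes neg: "\<And>i. i \<in> I \<Longrightarrow> \<kappa> i \<le> - 1"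
    and p: "\<And>i. i \<in> I \<Longrightarrow> dot (u i) p \<ge> \<kappa> i"
    and q: "\<And>i. i \<in> I \<Longrightarrow> dot (u i) (p + scale n (- snd (u j), fst (u j))) \<ge> \<kappa> i"
    and n: "n > 0" and j: "dot (u j) p = \<kappa> j" "\<kappa> j \<le> - 2" and l: "dot (u j) l = 1"
  shows "\<exists>x. x \<noteq> 0 \<and> (\<forall>i\<in>I. dot (u i) x \<ge> \<kappa> i + 1)"
proof -
  define e where "e = (- snd (u j), fst (u j))"
  define a where "a = - \<kappa> j"
  \<comment> \<open>In the basis \<open>l, e\<close> the point \<open>p\<close> is
    \<open>- a * l + c * e\<close>. The point \<open>x\<close> is to satisfy
    \<open>a * x = (a - 1) * p + t * e\<close>, so \<open>t\<close> has to be congruent to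
    \<open>c\<close> modulo \<open>a\<close>; the remainder also satisfies
    \<open>t \<le> a - 1\<close>.\<close>
  define c where "c = fst l * snd p - snd l * fst p"
  define t where "t = c mod a"
  define x where "x = scale (- (a - 1)) l + scale (c - c div a) e"
  have a: "a \<ge> 2"
    using j by (simp add: a_def)
  have t: "0 \<le> t" "t \<le> a - 1"
    using a by (simp_all add: t_def)
  have "fst p = dot (u j) l * fst p" "snd p = dot (u j) l * snd p"
    using l by simp_all
  moreover have "dot (u j) l * fst p = dot (u j) p * fst l + c * fst e" "dot (u j) l * snd p = dot (u j) p * snd l + c * snd e"
    by (simp_all add: dot_def c_def e_def algebra_simps)
  ultimately have pe: "fst p = - a * fst l + c * fst e" "snd p = - a * snd l + c * snd e"
    using j by (simp_all add: a_def)
  have "a * (c div a) = c - t"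
    by (simp add: t_def minus_mod_eq_mult_div)
  then have eq: "a * (c - c div a) = (a - 1) * c + t"
    by (simp add: algebra_simps)
  have "scale a x = scale (- (a * (a - 1))) l + scale (a * (c - c div a)) e"
    by (simp add: x_def scale_def prod_eq_iff algebra_simps)
  then have ax: "scale a x = scale (a - 1) p + scale t e"
    unfolding eq by (simp add: scale_def prod_eq_iff pe algebra_simps)
  have "dot (u i) x \<ge> \<kappa> i + 1" if i: "i \<in> I" for i
  proof -
    \<comment> \<open>Convexity: \<open>p + e\<close> lies between \<open>p\<close> and
      \<open>p + scale n e\<close>.\<close>
    have "n * dot (u i) (p + e) = (n - 1) * dot (u i) p + dot (u i) (p + scale n e)"
      by (simp add: dot_add dot_scale algebra_simps)
    also have "\<dots> \<ge> (n - 1) * \<kappa> i + \<kappa> i"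
      using p[OF i] q[OF i] n by (intro add_mono mult_left_mono) (simp_all add: e_def)
    finally have "n * dot (u i) (p + e) \<ge> n * \<kappa> i"
      by (simp add: algebra_simps)
    then have pe: "dot (u i) (p + e) \<ge> \<kappa> i"
      using n by simp
    have "a * dot (u i) x = (a - 1 - t) * dot (u i) p + t * dot (u i) (p + e)"
      using arg_cong[OF ax, of "dot (u i)"] by (simp add: dot_add dot_scale algebra_simps)
    also have "\<dots> \<ge> (a - 1 - t) * \<kappa> i + t * \<kappa> i"
      using p[OF i] pe t by (intro add_mono mult_left_mono) simp_all
    finally have "a * dot (u i) x \<ge> a * \<kappa> i - \<kappa> i"
      by (simp add: algebra_simps)
    then have "a * dot (u i) x > a * \<kappa> i"
      using neg[OF i] by linarith
    then have "dot (u i) x > \<kappa> i"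
      using a by simp
    then show ?thesis
      by simp
  qed
  moreover have "dot (u j) x = - (a - 1)"
    using l by (simp add: x_def dot_add dot_scale) (simp add: dot_def e_def)
  then have "x \<noteq> 0"
    using a dot_zero[of "u j"] by auto
  ultimately show ?thesis
    by blast
qed

text \<open>The triangle with apex \<open>m\<close> over a primitive segment of the edge contains a lattice point on the line
  that is parallel to the edge and at lattice distance one from it.\<close>

lemma second_interior_point:
  fixes u :: "'i \<Rightarrow> int \<times> int" and \<kappa> :: "'i \<Rightarrow> int"
  assumes m: "\<And>i. i \<in> I \<Longrightarrow> dot (u i) m \<ge> \<kappa> i + 1"
    and p: "\<And>i. i \<in> I \<Longrightarrow> dot (u i) p \<ge> \<kappa> i" and q: "\<And>i. i \<in> I \<Longrightarrow> dot (u i) q \<ge> \<kappa> i"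
    and pq: "q - p = scale n (- snd (u j), fst (u j))" "n \<noteq> 0"
    and j: "dot (u j) p = \<kappa> j" "dot (u j) q = \<kappa> j" "dot (u j) m \<ge> \<kappa> j + 2" and l: "dot (u j) l = 1"
  shows "\<exists>x. x \<noteq> m \<and> (\<forall>i\<in>I. dot (u i) x \<ge> \<kappa> i + 1)"
proof -
  define e where "e = (- snd (u j), fst (u j))"
  define \<kappa>' where "\<kappa>' i = \<kappa> i - dot (u i) m" for i
  have qp: "q = p + scale n e"
    using pq(1) by (simp add: e_def algebra_simps)
  \<comment> \<open>The sign of \<open>n\<close> decides which end of the edge plays the role of
    \<open>p\<close>.\<close>
  have "\<exists>x. x \<noteq> 0 \<and> (\<forall>i\<in>I. dot (u i) x \<ge> \<kappa>' i + 1)"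
  proof (cases "n > 0")
    case True
    have eq: "(p - m) + scale n e = q - m"
      by (simp add: qp)
    have "dot (u i) (p - m + scale n (- snd (u j), fst (u j))) \<ge> \<kappa>' i" if "i \<in> I" for i
      unfolding eq[unfolded e_def] using q[OF that] by (simp add: \<kappa>'_def dot_diff)
    moreover have "\<kappa>' i \<le> - 1" "dot (u i) (p - m) \<ge> \<kappa>' i" if "i \<in> I" for i
      using m[OF that] p[OF that] by (simp_all add: \<kappa>'_def dot_diff)
    moreover have "dot (u j) (p - m) = \<kappa>' j" "\<kappa>' j \<le> - 2"
      using j by (simp_all add: \<kappa>'_def dot_diff)
    ultimately show ?thesis
      using second_interior_point_aux[of I \<kappa>' u "p - m" n j l] True l by blast
  next
    case False
    have eq: "(q - m) + scale (- n) e = p - m"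
      by (simp add: qp scale_def prod_eq_iff)
    have "dot (u i) (q - m + scale (- n) (- snd (u j), fst (u j))) \<ge> \<kappa>' i" if "i \<in> I" for i
      unfolding eq[unfolded e_def] using p[OF that] by (simp add: \<kappa>'_def dot_diff)
    moreover have "\<kappa>' i \<le> - 1" "dot (u i) (q - m) \<ge> \<kappa>' i" if "i \<in> I" for i
      using m[OF that] q[OF that] by (simp_all add: \<kappa>'_def dot_diff)
    moreover have "dot (u j) (q - m) = \<kappa>' j" "\<kappa>' j \<le> - 2"
      using j by (simp_all add: \<kappa>'_def dot_diff)
    moreover have "- n > 0"
      using False pq(2) by simp
    ultimately show ?thesis
      using second_interior_point_aux[of I \<kappa>' u "q - m" "- n" j l] l by blast
  qed
  then obtain x where x: "x \<noteq> 0" "\<And>i. i \<in> I \<Longrightarrow> dot (u i) x \<ge> \<kappa>' i + 1"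
    by blast
  then have "x + m \<noteq> m" "\<forall>i\<in>I. dot (u i) (x + m) \<ge> \<kappa> i + 1"
    by (auto simp: dot_add \<kappa>'_def dest: x(2))
  then show ?thesis
    by blast
qed

section \<open>Recovering a noetherian ring from its localizations\<close>

lemma noetherian_prime_containing:
  assumes A: "noetherian A" and I: "is_ideal A I" "1 \<notin> I"
  obtains P where "is_prime A P" "I \<subseteq> P"
proof -
  have sA: "is_subring A"
    by (rule noetherian_subring[OF A])
  define S where "S = {J. is_ideal A J \<and> 1 \<notin> J \<and> I \<subseteq> J}"
  have "S \<noteq> {}"
    using I by (auto simp: S_def)
  then obtain J where J: "J \<in> S" "\<And>J'. J' \<in> S \<Longrightarrow> J \<subseteq> J' \<Longrightarrow> J' = J"
    using noetherian_maximal[OF A, of S] by (metis (mono_tags, lifting) S_def mem_Collect_eq)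
  have iJ: "is_ideal A J" and "1 \<notin> J" "I \<subseteq> J"
    using J(1) by (auto simp: S_def)
  have "a \<in> J \<or> b \<in> J" if ab: "a \<in> A" "b \<in> A" "a * b \<in> J" for a b
  proof (cases "a \<in> J")
    case False
    then have "a \<notin> J" .
    define J' where "J' = {j + a * r | j r. j \<in> J \<and> r \<in> A}"
    have "is_ideal A J'"
      unfolding is_ideal_def
    proof (intro conjI ballI)
      show "J' \<subseteq> A"
        using ideal_sub[OF iJ] ab by (auto simp: J'_def intro: subring_add[OF sA] subring_mult[OF sA])
      have "0 + a * 0 \<in> J'"
        unfolding J'_def using ideal_zero[OF iJ] subring_zero[OF sA] by blast
      then show "0 \<in> J'"
        by simp
      fix x y assume "y \<in> J'"
      then obtain j r where y: "y = j + a * r" "j \<in> J" "r \<in> A"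
        by (auto simp: J'_def)
      {
        assume "x \<in> J'"
        then obtain j' r' where x: "x = j' + a * r'" "j' \<in> J" "r' \<in> A"
          by (auto simp: J'_def)
        have "x + y = (j' + j) + a * (r' + r)"
          by (simp add: x y algebra_simps)
        then show "x + y \<in> J'"
          unfolding J'_def using x y ideal_add[OF iJ] subring_add[OF sA] by blast
      }
      {
        assume "x \<in> A"
        have "x * y = x * j + a * (x * r)"
          by (simp add: y algebra_simps)
        then show "x * y \<in> J'"
          unfolding J'_def using \<open>x \<in> A\<close> y ideal_mult[OF iJ] subring_mult[OF sA] by blast
      }
    qed
    moreover have "J \<subseteq> J'"
    proof
      fix x assume "x \<in> J"
      then have "x + a * 0 \<in> J'"
        unfolding J'_def using subring_zero[OF sA] by blast
      then show "x \<in> J'"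
        by simp
    qed
    moreover have "0 + a * 1 \<in> J'"
      unfolding J'_def using ideal_zero[OF iJ] subring_one[OF sA] by blast
    then have "J' \<noteq> J"
      using \<open>a \<notin> J\<close> by auto
    ultimately have "1 \<in> J'"
      using J(2)[of J'] \<open>I \<subseteq> J\<close> by (auto simp: S_def)
    then obtain i r where ir: "1 = i + a * r" "i \<in> J" "r \<in> A"
      by (auto simp: J'_def)
    have "b = b * (i + a * r)"
      using ir(1) by simp
    also have "\<dots> = b * i + r * (a * b)"
      by (simp add: algebra_simps)
    also have "\<dots> \<in> J"
      by (rule ideal_add[OF iJ ideal_mult[OF iJ ab(2) ir(2)] ideal_mult[OF iJ ir(3) ab(3)]])
    finally show ?thesis ..
  qed simp
  then have "is_prime A J"
    using iJ \<open>1 \<notin> J\<close> by (simp add: is_prime_def)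
  then show ?thesis
    using that \<open>I \<subseteq> J\<close> by blast
qed

text \<open>The denominators of \<open>f\<close> form an ideal that is contained in no prime, so it
  contains 1.\<close>

lemma noetherian_mem_of_localizations:
  assumes A: "noetherian A" and f: "\<And>P. is_prime A P \<Longrightarrow> f \<in> localization A P"
  shows "f \<in> A"
proof (rule ccontr)
  assume "f \<notin> A"
  have sA: "is_subring A"
    by (rule noetherian_subring[OF A])
  define I where "I = {a \<in> A. a * f \<in> A}"
  have "is_ideal A I"
    unfolding is_ideal_def I_def
    by (auto simp: distrib_right mult.assoc subring_zero[OF sA] subring_add[OF sA] subring_mult[OF sA])
  moreover have "1 \<notin> I"
    using \<open>f \<notin> A\<close> by (simp add: I_def)
  ultimately obtain P where P: "is_prime A P" "I \<subseteq> P"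
    using noetherian_prime_containing[OF A] by blast
  obtain a b where ab: "a \<in> A" "b \<in> A - P" "b \<noteq> 0" "f = a / b"
    using f[OF P(1)] by (rule localizationE[OF sA P(1)])
  then have "b \<in> I"
    by (simp add: I_def)
  then show False
    using P ab by blast
qed

lemma noetherian_laurent_ring: "noetherian (laurent_ring UNIV)"
  unfolding laurent_ring_def by (intro noetherian_adjoin noetherian_const) simp

lemma dval_prod:
  assumes "is_dvr D t" "\<And>i. i \<in> S \<Longrightarrow> f i \<noteq> 0"
  shows "dval D t (prod f S) = (\<Sum>i\<in>S. dval D t (f i))"
  using assms(2)
proof (induction S rule: infinite_finite_induct)
  case (insert i S)
  then show ?case
    using dval_mult[OF assms(1), of "f i" "prod f S"] by simp
qed (simp_all add: dval_one[OF assms(1)])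

section \<open>Local generators of line bundles\<close>

definition line_generator :: "ratfun set set \<Rightarrow> sheaf \<Rightarrow> ratfun set \<Rightarrow> ratfun \<Rightarrow> bool" where
  "line_generator M L p g \<longleftrightarrow> g \<noteq> 0 \<and> (\<forall>q\<in>M. p \<subseteq> q \<longrightarrow> L q = (*) g ` q)"

text \<open>A basic neighbourhood is given by the regularity of finitely many functions. It contains
  all generizations of its point, as larger local rings contain the same functions, so a local
  generator serves all of them.\<close>

lemma zariski_neighbourhood:
  assumes "openin (zariski M) U" "p \<in> U"
  shows "p \<in> M \<and> (\<exists>F. finite F \<and> F \<subseteq> p \<and> (\<forall>q\<in>M. F \<subseteq> q \<longrightarrow> q \<in> U))"
proof -
  have "generate_topology_on (range (\<lambda>f. {p \<in> M. f \<in> p})) U"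
    using assms(1) by (simp add: zariski_def openin_topology_generated_by_iff)
  then show ?thesis
    using assms(2)
  proof (induction arbitrary: p rule: generate_topology_on.induct)
    case (Int a b)
    obtain F where "p \<in> M" "finite F" "F \<subseteq> p" "\<forall>q\<in>M. F \<subseteq> q \<longrightarrow> q \<in> a"
      using Int.IH(1)[of p] Int.prems by auto
    moreover obtain G where "finite G" "G \<subseteq> p" "\<forall>q\<in>M. G \<subseteq> q \<longrightarrow> q \<in> b"
      using Int.IH(2)[of p] Int.prems by auto
    ultimately show ?case
      by (intro conjI exI[of _ "F \<union> G"]) auto
  next
    case (UN K)
    then obtain k where k: "k \<in> K" "p \<in> k"
      by auto
    obtain F where "p \<in> M" "finite F" "F \<subseteq> p" "\<forall>q\<in>M. F \<subseteq> q \<longrightarrow> q \<in> k"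
      using UN.IH[OF k] by auto
    then show ?case
      using k(1) by (intro conjI exI[of _ F]) auto
  next
    case (Basis s)
    then obtain f where "s = {p \<in> M. f \<in> p}"
      by auto
    then show ?case
      using Basis.prems by (intro conjI exI[of _ "{f}"]) auto
  qed auto
qed

lemma line_bundle_local:
  assumes "line_bundle M L" "p \<in> M"
  obtains g F where "g \<noteq> 0" "finite F" "F \<subseteq> p" "\<And>q. q \<in> M \<Longrightarrow> F \<subseteq> q \<Longrightarrow> L q = (*) g ` q"
proof -
  obtain U g where U: "openin (zariski M) U" "p \<in> U" "g \<noteq> 0" "\<And>q. q \<in> U \<Longrightarrow> L q = (*) g ` q"
    using assms unfolding line_bundle_def by metis
  then show ?thesis
    using zariski_neighbourhood[OF U(1,2)] that by metis
qed

lemma line_bundle_generator: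
  assumes "line_bundle M L" "p \<in> M"
  obtains g where "line_generator M L p g"
  using line_bundle_local[OF assms] that unfolding line_generator_def by (metis order_trans)

section \<open>Divisors that meet the torus\<close>

context toric_model
begin

definition torus_divisor :: "ratfun set \<Rightarrow> bool" where
  "torus_divisor D \<longleftrightarrow> codim_one_point M D \<and> coord_X \<in> unit_set D \<and> coord_Y \<in> unit_set D"

lemma torus_divisorD:
  assumes "torus_divisor D"
  shows "D \<in> M" "is_subring D" "\<exists>t. is_dvr D t" "coord_X \<in> unit_set D" "coord_Y \<in> unit_set D"
  using assms codim_one_point_iff_dvr point_subring by (auto simp: torus_divisor_def)

lemma lmon_unit_torus:
  assumes "is_subring D" "coord_X \<in> unit_set D" "coord_Y \<in> unit_set D"
  shows "lmon k \<in> unit_set D"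
  unfolding lmon_def using assms by (intro unit_set_mult unit_set_powi)

lemma laurent_ring_subset_torus:
  assumes p: "p \<in> M" and units: "coord_X \<in> unit_set p" "coord_Y \<in> unit_set p"
  shows "laurent_ring UNIV \<subseteq> p"
  unfolding laurent_ring_def using units point_const[OF p]
  by (intro adjoin_least point_subring[OF p]) (auto dest: unit_setD)

text \<open>The maximal ideal of \<open>p\<close> cuts out a prime of the Laurent ring and so a
  point of the torus that is dominated by \<open>p\<close>; separatedness identifies the
  two.\<close>

lemma torus_point_localization:
  assumes p: "p \<in> M" and units: "coord_X \<in> unit_set p" "coord_Y \<in> unit_set p"
  shows "is_prime (laurent_ring UNIV) (nonunits p \<inter> laurent_ring UNIV)"
    "p = localization (laurent_ring UNIV) (nonunits p \<inter> laurent_ring UNIV)"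
proof -
  let ?R = "laurent_ring UNIV"
  let ?P = "nonunits p \<inter> ?R"
  have R: "is_subring ?R" "?R \<subseteq> p"
    using laurent_ring_subring laurent_ring_subset_torus[OF assms] by auto
  have sp: "is_subring p"
    by (rule point_subring[OF p])
  have pp: "is_prime p (nonunits p)"
    by (rule localization_nonunits(1)[OF point_local[OF p]])
  have ip: "is_ideal p (nonunits p)"
    by (rule prime_ideal[OF pp])
  have "x \<in> ?P \<or> y \<in> ?P" if "x \<in> ?R" "y \<in> ?R" "x * y \<in> ?P" for x y
    using prime_mult[OF pp, of x y] R(2) that by auto
  moreover have "a * x \<in> ?P" if "a \<in> ?R" "x \<in> ?P" for a x
    using ideal_mult[OF ip, of a x] subring_mult[OF R(1)] R(2) that by auto
  ultimately show P: "is_prime ?R ?P"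
    using R(1) prime_one[OF pp] ideal_zero[OF ip] ideal_add[OF ip]
    unfolding is_prime_def is_ideal_def by (auto intro: subring_add subring_zero)
  let ?q = "localization ?R ?P"
  have q: "?q \<in> M"
    using torus_subset R(1) P by (auto simp: torus_def affine_model_def')
  have unit: "b \<in> unit_set p" if "b \<in> ?R - ?P" for b
    using that R(2) by (auto simp: nonunits_eq)
  have "?q \<subseteq> p"
  proof
    fix x assume "x \<in> ?q"
    then obtain a b where "a \<in> ?R" "b \<in> ?R - ?P" "x = a / b"
      by (rule localizationE[OF R(1) P]) blast
    then show "x \<in> p"
      using R(2) unit_setD(2)[OF unit] by (auto simp: divide_inverse intro: subring_mult[OF sp])
  qed
  moreover have "nonunits ?q \<subseteq> nonunits p"
  proof
    fix x assume "x \<in> nonunits ?q"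
    then obtain a b where "a \<in> ?P" "b \<in> ?R - ?P" "x = a / b"
      unfolding nonunits_localization[OF R(1) P] by blast
    then show "x \<in> nonunits p"
      using unit_setD(2)[OF unit] by (auto simp: divide_inverse intro: ideal_mult_right[OF ip])
  qed
  ultimately show "p = ?q"
    using dominates_point[OF p q] by (simp add: dominates_def)
qed

lemma torus_point_fraction:
  assumes p: "p \<in> M" and units: "coord_X \<in> unit_set p" "coord_Y \<in> unit_set p" and f: "f \<in> p"
  obtains a c where "f = to_fract a / to_fract c" "to_fract c \<in> unit_set p"
proof -
  have sp: "is_subring p"
    by (rule point_subring[OF p])
  have "f \<in> localization (laurent_ring UNIV) (nonunits p \<inter> laurent_ring UNIV)"
    using torus_point_localization(2)[OF p units] f by simp
  then obtain x y where xy: "x \<in> laurent_ring UNIV" "y \<in> laurent_ring UNIV" "y \<notin> nonunits p" "f = x / y"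
    by (auto simp: localization_def)
  have y: "y \<in> unit_set p"
    using xy(2,3) laurent_ring_subset_torus[OF p units] by (auto simp: nonunits_eq)
  obtain n a where a: "x * lmon (int n, int n) = to_fract a"
    using laurent_ring_denominator[OF xy(1)] .
  obtain m c where c: "y * lmon (int m, int m) = to_fract c"
    using laurent_ring_denominator[OF xy(2)] .
  obtain r s where rs: "lmon (int n, int n) = (to_fract r :: ratfun)" "lmon (int m, int m) = (to_fract s :: ratfun)"
    using lmon_nat_polynomial by metis
  have "to_fract (c * r) = y * (lmon (int m, int m) * lmon (int n, int n))"
    by (simp add: rs flip: c)
  moreover have "\<dots> \<in> unit_set p"
    using y lmon_unit_torus[OF sp units] by (intro unit_set_mult[OF sp])
  ultimately have unit: "to_fract (c * r) \<in> unit_set p"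
    by simp
  have "to_fract (a * s) = x * (lmon (int m, int m) * lmon (int n, int n))"
    by (simp add: rs mult_ac flip: a)
  moreover have "to_fract (c * r) = y * (lmon (int m, int m) * lmon (int n, int n))"
    by (simp add: rs flip: c)
  ultimately have "f = to_fract (a * s) / to_fract (c * r)"
    using xy(4) by (simp add: lmon_nonzero del: to_fract_mult)
  then show ?thesis
    using that unit by blast
qed

text \<open>Height-one primes of a factorial ring are principal: some prime factor of the numerator
  of a uniformizer lies in the maximal ideal, and a comparison of powers shows that it divides every
  polynomial there.\<close>

lemma torus_divisor_prime:
  assumes D: "torus_divisor D"
  obtains \<pi> :: "complex poly poly" where "prime \<pi>" "\<And>b. to_fract b \<in> nonunits D \<longleftrightarrow> \<pi> dvd b"
proof -
  obtain t where t: "is_dvr D t"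
    using torus_divisorD(3)[OF D] by blast
  note DM = torus_divisorD(1)[OF D] and sD = torus_divisorD(2)[OF D] and units = torus_divisorD(4,5)[OF D]
  have poly: "to_fract b \<in> D" for b
    using to_fract_mem_laurent_ring laurent_ring_subset_torus[OF DM units] by blast
  have pD: "is_prime D (nonunits D)"
    by (rule localization_nonunits(1)[OF dvr_local[OF t]])
  obtain a c where ac: "t = to_fract a / to_fract c" "to_fract c \<in> unit_set D"
    using torus_point_fraction[OF DM units dvr_unif_mem[OF t]] .
  have "a \<noteq> 0"
    using ac(1) dvr_unif_nonzero[OF t] by auto
  moreover have "to_fract a \<in> nonunits D"
  proof -
    have "t \<in> nonunits D"
      by (simp add: dvr_nonunit_iff[OF t] dval_unif[OF t])
    then have "t * to_fract c \<in> nonunits D"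
      using ideal_mult_right[OF prime_ideal[OF pD]] poly by blast
    moreover have "t * to_fract c = to_fract a"
      using ac unit_setD(3)[OF ac(2)] by simp
    ultimately show ?thesis
      by simp
  qed
  ultimately have "\<exists>\<pi>. prime \<pi> \<and> to_fract \<pi> \<in> nonunits D"
  proof (induction a rule: prime_divisors_induct)
    case (unit x)
    then obtain y where "1 = x * y"
      by auto
    then have "to_fract x * to_fract y = 1"
      by (metis to_fract_1 to_fract_mult)
    then have "1 \<in> nonunits D"
      using ideal_mult_right[OF prime_ideal[OF pD] unit(3) poly] by metis
    then show ?case
      using prime_one[OF pD] by simp
  next
    case (factor p x)
    then have "to_fract p \<in> nonunits D \<or> to_fract x \<in> nonunits D"
      using prime_mult[OF pD poly poly] by simp
    then show ?case
      using factor by auto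
  qed auto
  then obtain \<pi> where \<pi>: "prime \<pi>" "to_fract \<pi> \<in> nonunits D"
    by blast
  have "\<pi> dvd b" if b: "to_fract b \<in> nonunits D" for b
  proof (cases "b = 0")
    case False
    define d where "d = nat (dval D t (to_fract b))"
    define e where "e = nat (dval D t (to_fract \<pi>))"
    have "\<pi> \<noteq> 0"
      using \<pi>(1) by auto
    have de: "dval D t (to_fract b) = int d" "dval D t (to_fract \<pi>) = int e" "d > 0" "e > 0"
      using b \<pi>(2) False \<open>\<pi> \<noteq> 0\<close> by (auto simp: d_def e_def dvr_nonunit_iff[OF t])
    \<comment> \<open>With valuations equalized, \<open>g\<close> is regular, hence a fraction of
      polynomials whose denominator \<open>y\<close> is a unit. Clearing denominators gives that
      \<open>\<pi>\<close> divides \<open>b ^ e * y\<close>, but it cannot divide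
      \<open>y\<close>.\<close>
    define g where "g = to_fract b ^ e / to_fract \<pi> ^ d"
    have "g \<in> D"
      using de False \<open>\<pi> \<noteq> 0\<close>
      by (simp add: g_def dvr_mem_iff[OF t] dval_divide[OF t] dval_power[OF t])
    then obtain x y where xy: "g = to_fract x / to_fract y" "to_fract y \<in> unit_set D"
      using torus_point_fraction[OF DM units] by blast
    have "to_fract (b ^ e * y) = to_fract (\<pi> ^ d * x)"
      using xy(1) unit_setD(3)[OF xy(2)] \<open>\<pi> \<noteq> 0\<close> unfolding g_def
      by (simp add: to_fract_power frac_eq_eq mult.commute)
    then have "b ^ e * y = \<pi> ^ d * x"
      unfolding to_fract_eq_iff .
    moreover have "\<pi> dvd \<pi> ^ d"
      using de(3) by simp
    ultimately have "\<pi> dvd b ^ e * y"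
      by simp
    then have "\<pi> dvd b \<or> \<pi> dvd y"
      using \<pi>(1) by (auto simp: prime_dvd_mult_iff dest: prime_dvd_power)
    moreover have "\<not> \<pi> dvd y"
    proof
      assume "\<pi> dvd y"
      then have "to_fract y \<in> nonunits D"
        using \<pi>(2) ideal_mult_right[OF prime_ideal[OF pD] _ poly] by auto
      then show False
        using xy(2) by (simp add: nonunits_eq)
    qed
    ultimately show ?thesis
      by blast
  qed simp
  moreover have "to_fract b \<in> nonunits D" if "\<pi> dvd b" for b
    using that \<pi>(2) ideal_mult_right[OF prime_ideal[OF pD] _ poly] by auto
  ultimately show ?thesis
    using that \<pi>(1) by blast
qed

definition divisor_prime :: "ratfun set \<Rightarrow> complex poly poly" where
  "divisor_prime D = (SOME \<pi>. prime \<pi> \<and> (\<forall>b. to_fract b \<in> nonunits D \<longleftrightarrow> \<pi> dvd b))"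

lemma divisor_prime:
  assumes "torus_divisor D"
  shows "prime (divisor_prime D)" "to_fract b \<in> nonunits D \<longleftrightarrow> divisor_prime D dvd b"
proof -
  have "\<exists>\<pi>. prime \<pi> \<and> (\<forall>b. to_fract b \<in> nonunits D \<longleftrightarrow> \<pi> dvd b)"
    using torus_divisor_prime[OF assms] by metis
  from someI_ex[OF this] show "prime (divisor_prime D)" "to_fract b \<in> nonunits D \<longleftrightarrow> divisor_prime D dvd b"
    unfolding divisor_prime_def by blast+
qed

lemma torus_divisor_poly_mem: "torus_divisor D \<Longrightarrow> to_fract b \<in> D"
  using to_fract_mem_laurent_ring laurent_ring_subset_torus torus_divisorD by blast

text \<open>\<open>prime\<close> includes normalization, so a prime that divides another one equals
  it. The prime in turn determines which polynomials are units, and with them all of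
  \<open>D\<close>.\<close>

lemma divisor_prime_dvd_imp_eq:
  assumes D: "torus_divisor D" and D': "torus_divisor D'" and dvd: "divisor_prime D dvd divisor_prime D'"
  shows "D = D'"
proof -
  have eq: "divisor_prime D = divisor_prime D'"
    using primes_dvd_imp_eq[OF divisor_prime(1)[OF D] divisor_prime(1)[OF D'] dvd] .
  have "D1 \<subseteq> D2" if D1: "torus_divisor D1" and D2: "torus_divisor D2" and eq: "divisor_prime D1 = divisor_prime D2" for D1 D2
  proof
    fix f assume "f \<in> D1"
    then obtain a c where ac: "f = to_fract a / to_fract c" "to_fract c \<in> unit_set D1"
      using torus_point_fraction torus_divisorD[OF D1] by metis
    then have "to_fract c \<notin> nonunits D2"
      using divisor_prime(2)[OF D1] divisor_prime(2)[OF D2] eq by (auto simp: nonunits_eq)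
    then have "to_fract c \<in> unit_set D2"
      using torus_divisor_poly_mem[OF D2] by (simp add: nonunits_eq)
    then show "f \<in> D2"
      using ac(1) torus_divisor_poly_mem[OF D2] torus_divisorD(2)[OF D2]
      by (auto simp: divide_inverse intro!: subring_mult dest: unit_setD)
  qed
  then show ?thesis
    using D D' eq by (metis subset_antisym)
qed

text \<open>The numerator of a uniformizer has valuation 1 and is a multiple of the prime of
  \<open>D\<close>, which leaves only valuation 1 for that prime. The primes of the other divisors
  are units of \<open>D\<close>.\<close>

lemma divisor_prime_dval:
  assumes D: "torus_divisor D" and t: "is_dvr D t" and D': "torus_divisor D'"
  shows "dval D t (to_fract (divisor_prime D')) = (if D' = D then 1 else 0)"
proof (cases "D' = D")
  case False
  then have "to_fract (divisor_prime D') \<notin> nonunits D"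
    using divisor_prime(2)[OF D] divisor_prime_dvd_imp_eq[OF D D'] by auto
  then have "to_fract (divisor_prime D') \<in> unit_set D"
    using torus_divisor_poly_mem[OF D] by (simp add: nonunits_eq)
  then show ?thesis
    using False by (simp add: dvr_unit_iff[OF t])
next
  case True
  let ?\<pi> = "to_fract (divisor_prime D) :: ratfun"
  note DM = torus_divisorD(1)[OF D] and sD = torus_divisorD(2)[OF D] and units = torus_divisorD(4,5)[OF D]
  have nz: "?\<pi> \<noteq> 0"
    using divisor_prime(1)[OF D] by auto
  have ge: "dval D t ?\<pi> \<ge> 1"
    using divisor_prime(2)[OF D, of "divisor_prime D"] nz by (simp add: dvr_nonunit_iff[OF t])
  obtain a c where ac: "t = to_fract a / to_fract c" "to_fract c \<in> unit_set D"
    using torus_point_fraction[OF DM units dvr_unif_mem[OF t]] .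
  have a: "to_fract a = t * to_fract c"
    using ac unit_setD(3)[OF ac(2)] by simp
  have c0: "dval D t (to_fract c) = 0" "(to_fract c :: ratfun) \<noteq> 0"
    using ac(2) by (simp_all add: dvr_unit_iff[OF t])
  have da: "dval D t (to_fract a) = 1"
    unfolding a using dval_mult[OF t dvr_unif_nonzero[OF t] c0(2)] c0(1) by (simp add: dval_unif[OF t])
  then have "to_fract a \<in> nonunits D"
    by (simp add: dvr_nonunit_iff[OF t])
  then obtain b where b: "a = divisor_prime D * b"
    using divisor_prime(2)[OF D] by auto
  have "(to_fract a :: ratfun) \<noteq> 0"
    unfolding a using dvr_unif_nonzero[OF t] c0(2) by simp
  then have "(to_fract b :: ratfun) \<noteq> 0"
    using b by auto
  then have "dval D t (to_fract a) = dval D t ?\<pi> + dval D t (to_fract b)" "dval D t (to_fract b) \<ge> 0"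
    using dval_mult[OF t nz, of "to_fract b"] dvr_mem_iff[OF t, of "to_fract b"] torus_divisor_poly_mem[OF D, of b]
    by (simp_all add: b)
  then show ?thesis
    using True ge da by simp
qed

text \<open>The prime of a divisor along which \<open>f\<close> has a pole divides the denominator
  of \<open>f\<close>.\<close>

lemma finite_divisors_of_poles: "finite {D. torus_divisor D \<and> f \<notin> D}"
proof -
  obtain a b where ab: "b \<noteq> 0" "f = to_fract a / to_fract b"
    by (rule ratfun2_cases)
  have "divisor_prime ` {D. torus_divisor D \<and> f \<notin> D} \<subseteq> prime_factors b"
  proof clarify
    fix D assume D: "torus_divisor D" "f \<notin> D"
    have "to_fract b \<notin> unit_set D"
    proof
      assume "to_fract b \<in> unit_set D"
      then have "f \<in> D"
        using ab(2) torus_divisor_poly_mem[OF D(1)] torus_divisorD(2)[OF D(1)]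
        by (auto simp: divide_inverse intro!: subring_mult dest: unit_setD)
      then show False
        using D(2) by simp
    qed
    then have "divisor_prime D dvd b"
      using divisor_prime(2)[OF D(1), of b] torus_divisor_poly_mem[OF D(1)] by (simp add: nonunits_eq)
    then show "divisor_prime D \<in> prime_factors b"
      using ab(1) divisor_prime(1)[OF D(1)] by (intro prime_factorsI)
  qed
  then have "finite (divisor_prime ` {D. torus_divisor D \<and> f \<notin> D})"
    by (rule finite_subset) simp
  moreover have "inj_on divisor_prime {D. torus_divisor D \<and> f \<notin> D}"
    using divisor_prime_dvd_imp_eq by (auto simp: inj_on_def)
  ultimately show ?thesis
    by (rule finite_imageD)
qed

lemma generic_point: "UNIV \<in> M"
proof -
  have R: "is_subring (laurent_ring UNIV)"
    by (rule laurent_ring_subring)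
  have P: "is_prime (laurent_ring UNIV) {0}"
    using subring_zero[OF R] by (auto simp: is_prime_def is_ideal_def)
  have "localization (laurent_ring UNIV) {0} = (UNIV :: ratfun set)"
  proof -
    have "f \<in> localization (laurent_ring UNIV) {0}" for f :: ratfun
    proof -
      obtain a b where "b \<noteq> 0" "f = to_fract a / to_fract b"
        by (rule ratfun2_cases)
      then show ?thesis
        using localizationI[OF R P, of "to_fract a" "to_fract b"] to_fract_mem_laurent_ring by auto
    qed
    then show ?thesis
      by blast
  qed
  then have "UNIV \<in> torus"
    using R P by (force simp: torus_def affine_model_def')
  then show ?thesis
    using torus_subset by blast
qed

text \<open>The Picard group of the torus is trivial because its coordinate ring is factorial.\<close>

lemma trivialization_on_torus:
  assumes L: "line_bundle M L"
  obtains h where "h \<noteq> 0" "\<And>D. torus_divisor D \<Longrightarrow> L D = (*) h ` D"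
proof -
  \<comment> \<open>The trivialization at the generic point is valid wherever the finitely many
    functions in \<open>F\<close> are regular, that is, along all but finitely many torus
    divisors.\<close>
  obtain g0 F where g0: "g0 \<noteq> 0" "finite F" "\<And>q. q \<in> M \<Longrightarrow> F \<subseteq> q \<Longrightarrow> L q = (*) g0 ` q"
    using line_bundle_local[OF L generic_point] by metis
  have "\<exists>g. g \<noteq> 0 \<and> L D = (*) g ` D" if D: "torus_divisor D" for D
  proof -
    obtain g where "line_generator M L D g"
      using line_bundle_generator[OF L torus_divisorD(1)[OF D]] .
    then show ?thesis
      using torus_divisorD(1)[OF D] by (auto simp: line_generator_def)
  qed
  then obtain g where g: "\<And>D. torus_divisor D \<Longrightarrow> g D \<noteq> 0 \<and> L D = (*) (g D) ` D"
    by metis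
  obtain t where t: "\<And>D. torus_divisor D \<Longrightarrow> is_dvr D (t D)"
    using torus_divisorD(3) by metis
  define e where "e D = dval D (t D) (g D) - dval D (t D) g0" for D
  define E where "E = {D. torus_divisor D \<and> e D \<noteq> 0}"
  have "E \<subseteq> (\<Union>f\<in>F. {D. torus_divisor D \<and> f \<notin> D})"
  proof
    fix D assume "D \<in> E"
    then have D: "torus_divisor D" "e D \<noteq> 0"
      by (simp_all add: E_def)
    have "\<not> F \<subseteq> D"
    proof
      assume "F \<subseteq> D"
      then have "(*) (g D) ` D = (*) g0 ` D"
        using g0(3) g D(1) torus_divisorD(1)[OF D(1)] by metis
      then have "dval D (t D) (g D) = dval D (t D) g0"
        using dvr_image_eq_iff[OF t[OF D(1)]] g[OF D(1)] g0(1) by blast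
      then show False
        using D(2) by (simp add: e_def)
    qed
    then show "D \<in> (\<Union>f\<in>F. {D. torus_divisor D \<and> f \<notin> D})"
      using D by blast
  qed
  then have fin: "finite E"
    using g0(2) finite_divisors_of_poles by (rule finite_subset[OF _ finite_UN_I])
  define \<pi> :: "ratfun set \<Rightarrow> ratfun" where "\<pi> D = to_fract (divisor_prime D)" for D
  \<comment> \<open>A power of the prime of \<open>D\<close> corrects the trivialization along
    \<open>D\<close> and, by \<open>divisor_prime_dval\<close>, along no other torus
    divisor.\<close>
  define h where "h = g0 * (\<Prod>D\<in>E. \<pi> D powi e D)"
  have \<pi>: "\<pi> D \<noteq> 0" if "torus_divisor D" for D
    using divisor_prime(1)[OF that] by (auto simp: \<pi>_def)
  have prod: "(\<Prod>D\<in>E. \<pi> D powi e D) \<noteq> 0"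
    using fin \<pi> by (auto simp: E_def)
  have "L D = (*) h ` D" if D: "torus_divisor D" for D
  proof -
    have "dval D (t D) (\<Prod>D'\<in>E. \<pi> D' powi e D') = (\<Sum>D'\<in>E. dval D (t D) (\<pi> D' powi e D'))"
      using \<pi> by (intro dval_prod[OF t[OF D]]) (auto simp: E_def)
    also have "\<dots> = (\<Sum>D'\<in>E. if D' = D then e D else 0)"
      using \<pi> divisor_prime_dval[OF D t[OF D]]
      by (intro sum.cong refl) (simp add: E_def dval_powi[OF t[OF D]] \<pi>_def)
    also have "\<dots> = e D"
      using fin D by (simp add: E_def)
    finally have "dval D (t D) h = dval D (t D) (g D)"
      using dval_mult[OF t[OF D] g0(1) prod] by (simp add: h_def e_def)
    then have "(*) (g D) ` D = (*) h ` D"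
      using dvr_image_eq_iff[OF t[OF D]] g[OF D] g0(1) prod by (simp add: h_def)
    then show ?thesis
      using g[OF D] by simp
  qed
  moreover have "h \<noteq> 0"
    using g0(1) prod by (simp add: h_def)
  ultimately show ?thesis
    using that by blast
qed

text \<open>Hartogs at every point of the torus: monomials stay units in larger local rings, so all
  divisors through such a point are torus divisors.\<close>

lemma torus_regular_function:
  assumes f: "\<And>D. torus_divisor D \<Longrightarrow> f \<in> D"
  shows "f \<in> laurent_ring UNIV"
proof (rule noetherian_mem_of_localizations[OF noetherian_laurent_ring])
  fix P assume P: "is_prime (laurent_ring (UNIV :: complex set)) P"
  let ?p = "localization (laurent_ring UNIV) P"
  have R: "is_subring (laurent_ring (UNIV :: complex set))"
    by (rule laurent_ring_subring)
  have p: "?p \<in> M"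
    using torus_subset R P by (auto simp: torus_def affine_model_def')
  have "lmon k \<in> ?p" for k
    using lmon_mem_laurent_ring subset_localization[OF R P] by blast
  from this[of "(1, 0)"] this[of "(0, 1)"] this[of "(- 1, 0)"] this[of "(0, - 1)"]
  have "coord_X \<in> unit_set ?p" "coord_Y \<in> unit_set ?p"
    by (simp_all add: lmon_def power_int_minus unit_set_def coord_nonzero)
  then have "torus_divisor D" if "codim_one_point M D" "?p \<subseteq> D" for D
    using that unit_set_mono by (auto simp: torus_divisor_def)
  then show "f \<in> ?p"
    using f by (intro hartogs[OF p]) blast
qed

end

section \<open>Sections of an ample line bundle\<close>

text \<open>\<open>G\<close> is only a submodule here, because the lemma is applied to the dualizing
  sheaf before that is known to be invertible.\<close>

lemma tensor_principal_left:
  assumes p: "is_subring p" and F: "F p = (*) a ` p"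
    and G: "0 \<in> G p" "\<And>x y. x \<in> G p \<Longrightarrow> y \<in> G p \<Longrightarrow> x + y \<in> G p" "\<And>r x. r \<in> p \<Longrightarrow> x \<in> G p \<Longrightarrow> r * x \<in> G p"
  shows "tensor F G p = (*) a ` G p"
proof
  show "tensor F G p \<subseteq> (*) a ` G p"
  proof
    fix x assume "x \<in> tensor F G p"
    then obtain T c where T: "x = (\<Sum>s\<in>T. c s * s)" "T \<subseteq> {f * g | f g. f \<in> F p \<and> g \<in> G p}" "\<forall>s\<in>T. c s \<in> p"
      by (auto simp: tensor_def submodule_span_def)
    have "\<exists>y\<in>G p. c s * s = a * y" if sT: "s \<in> T" for s
    proof -
      obtain r g where rg: "s = a * r * g" "r \<in> p" "g \<in> G p"
        using T(2) sT unfolding F by blast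
      have "(c s * r) * g \<in> G p"
        using rg T(3) sT by (intro G(3) subring_mult[OF p]) auto
      moreover have "c s * s = a * ((c s * r) * g)"
        by (simp add: rg(1))
      ultimately show ?thesis
        by blast
    qed
    then obtain y where y: "\<And>s. s \<in> T \<Longrightarrow> y s \<in> G p \<and> c s * s = a * y s"
      by metis
    have "x = a * (\<Sum>s\<in>T. y s)"
      unfolding T(1) sum_distrib_left using y by (intro sum.cong) auto
    moreover have "(\<Sum>s\<in>T. y s) \<in> G p"
      using y by (induction T rule: infinite_finite_induct) (auto intro: G)
    ultimately show "x \<in> (*) a ` G p"
      by blast
  qed
  show "(*) a ` G p \<subseteq> tensor F G p"
  proof clarify
    fix g assume g: "g \<in> G p"
    have "a * 1 \<in> F p"
      unfolding F using subring_one[OF p] by blast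
    then have "a * g \<in> {f * g | f g. f \<in> F p \<and> g \<in> G p}"
      using g by force
    then show "a * g \<in> tensor F G p"
      unfolding tensor_def submodule_span_def mem_Collect_eq using subring_one[OF p]
      by (intro exI[of _ "{a * g}"] exI[of _ "\<lambda>_. 1"]) simp
  qed
qed

lemma tensor_power_principal:
  assumes p: "is_subring p" and F: "F p = (*) a ` p"
  shows "tensor_power F n p = (*) (a ^ n) ` p"
proof (induction n)
  case (Suc n)
  have "tensor_power F (Suc n) p = (*) a ` tensor_power F n p"
    unfolding tensor_power.simps
  proof (rule tensor_principal_left[where p = p and F = F and a = a and G = "tensor_power F n", OF p F])
    show "0 \<in> tensor_power F n p"
      unfolding Suc using subring_zero[OF p] by (auto intro!: image_eqI[of _ _ 0])
    fix x y assume "y \<in> tensor_power F n p"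
    then obtain s where s: "y = a ^ n * s" "s \<in> p"
      unfolding Suc by blast
    {
      assume "x \<in> tensor_power F n p"
      then obtain r where "x = a ^ n * r" "r \<in> p"
        unfolding Suc by blast
      then show "x + y \<in> tensor_power F n p"
        unfolding Suc using s subring_add[OF p] by (auto intro!: image_eqI[of _ _ "r + s"] simp: distrib_left)
    }
    {
      assume "x \<in> p"
      then show "x * y \<in> tensor_power F n p"
        unfolding Suc using s subring_mult[OF p] by (auto intro!: image_eqI[of _ _ "x * s"] simp: mult.left_commute)
    }
  qed
  then show ?case
    unfolding Suc by (simp add: image_image mult.assoc)
qed simp

text \<open>The invariant fields annihilate constants, while the exponents of a monomial are its
  eigenvalues.\<close>

lemma lmon_eq_const:
  assumes "lmon k = (const c :: ratfun)"
  shows "k = 0"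
proof -
  have "theta_X (lmon k) = (0 :: ratfun)" "theta_Y (lmon k) = (0 :: ratfun)"
    unfolding assms by (simp_all only: theta_const)
  then have "of_int (fst k) * lmon k = (0 :: ratfun)" "of_int (snd k) * lmon k = (0 :: ratfun)"
    by (simp_all only: theta_lmon)
  then have "const (of_int (fst k)) = (0 :: ratfun)" "const (of_int (snd k)) = (0 :: ratfun)"
    by (simp_all add: lmon_nonzero const_of_int)
  then show ?thesis
    by (simp add: const_eq_0_iff prod_eq_iff)
qed

lemma dim_over_complex_eq_1:
  assumes "dim_over_complex V = 1"
  obtains b where "b \<in> V" "b \<noteq> 0" "\<And>v. v \<in> V \<Longrightarrow> \<exists>c. v = const c * b"
proof -
  interpret vector_space "\<lambda>(c::complex) f. const c * f"
    by (rule vector_space_ratfun2)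
  obtain B where B: "B \<subseteq> V" "independent B" "V \<subseteq> span B" "card B = dim V"
    using basis_exists[of V] by blast
  then have "card B = 1"
    using assms by (simp add: dim_over_complex_def)
  then obtain b where b: "B = {b}"
    by (auto simp: card_1_singleton_iff)
  have "b \<noteq> 0"
    using B(2) b dependent_zero by auto
  moreover have "\<exists>c. v = const c * b" if "v \<in> V" for v
    using that B(3) unfolding b by (auto simp: span_singleton)
  ultimately show ?thesis
    using that B(1) b by blast
qed

section \<open>Centres on a boundary divisor\<close>

context boundary
begin

lemma composite_zero_unit:
  assumes "lmon k \<in> unit_set (composite (place_at 0))"
  shows "k = 0"
proof -
  have "lmon k \<in> unit_set D"
    using assms unit_set_mono[OF composite_subset] by blast
  then have "dot u k = 0"
    by (simp add: lmon_unit_iff)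
  then obtain j where j: "k = scale j edge"
    by (rule dot_zero_multiple)
  have "z powi j \<in> composite (place_at 0)" "z powi (- j) \<in> composite (place_at 0)"
    using unit_setD(1,2)[OF assms] by (simp_all add: j lmon_scale power_int_minus)
  then have "j = 0"
    using z_powi_place_zero[of j] z_powi_place_zero[of "- j"] by simp
  then show ?thesis
    by (simp add: j scale_def zero_prod_def)
qed

lemma composite_infinity_unit:
  assumes "lmon k \<in> unit_set (composite place_infinity)"
  shows "k = 0"
proof -
  have "lmon k \<in> unit_set D"
    using assms unit_set_mono[OF composite_subset] by blast
  then have "dot u k = 0"
    by (simp add: lmon_unit_iff)
  then obtain j where j: "k = scale j edge"
    by (rule dot_zero_multiple)
  have "z powi j \<in> composite place_infinity" "z powi (- j) \<in> composite place_infinity"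
    using unit_setD(1,2)[OF assms] by (simp_all add: j lmon_scale power_int_minus)
  then have "j = 0"
    using z_powi_place_infinity[of j] z_powi_place_infinity[of "- j"] by simp
  then show ?thesis
    by (simp add: j scale_def zero_prod_def)
qed

text \<open>A power of \<open>z\<close> that is regular both at 0 and at infinity is
  constant.\<close>

lemma composite_zero_inter_infinity:
  assumes "lmon k \<in> composite (place_at 0)" "lmon k \<in> composite place_infinity" "dot u k = 0"
  shows "k = 0"
proof -
  obtain j where j: "k = scale j edge"
    using dot_zero_multiple[OF assms(3)] .
  have "j = 0"
    using z_powi_place_zero[of j] z_powi_place_infinity[of j] assms by (simp add: j lmon_scale)
  then show ?thesis
    by (simp add: j scale_def zero_prod_def)
qed

text \<open>A composite is contained in \<open>D\<close>, so its centre lies on the closure of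
  \<open>D\<close>. These centres stand in for the points of that complete curve.\<close>

lemma composite_center:
  assumes "projective_model M" "residue_valuation V"
  obtains x where "x \<in> M" "x \<subseteq> composite V" "x \<subseteq> D"
proof -
  obtain x where "x \<in> M" "dominates (composite V) x"
    using projective_center[OF assms(1) _ composite_valuation[OF assms(2)]] D_point by blast
  then show ?thesis
    using that composite_subset[of V] by (auto simp: dominates_def)
qed

text \<open>A complete curve does not lie in an affine open set. The residues along \<open>D\<close>
  of the functions in \<open>A\<close> have no poles and are therefore constant, whereas
  \<open>z\<close> is a quotient of such functions and has a transcendental residue.\<close>

lemma affine_not_containing_curve:
  assumes A: "is_subring A" "is_prime A P" "D = localization A P"
    and all: "\<And>V. residue_valuation V \<Longrightarrow> A \<subseteq> composite V"
  shows False
proof -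
  have residue: "\<exists>\<alpha>. a - const \<alpha> \<in> nonunits D" if a: "a \<in> A" for a
  proof -
    have "a \<in> D"
      using a subset_localization[OF A(1,2)] A(3) by blast
    then obtain r where r: "r \<in> residues" "a - r \<in> nonunits D"
      using D_residue by blast
    have mem: "r \<in> V" if V: "residue_valuation V" for V
    proof -
      have VR: "V \<subseteq> residues"
        using V by (simp add: residue_valuation_def)
      obtain s where s: "s \<in> V" "a - s \<in> nonunits D"
        using all[OF V] a by (auto simp: composite_def)
      have "r - s = (a - s) - (a - r)"
        by simp
      then have "r - s \<in> nonunits D"
        using ideal_diff[OF D_subring D_ideal s(2) r(2)] by simp
      moreover have "r - s \<in> residues"
        using r(1) s(1) VR subring_diff[OF residues_subring] by blast
      ultimately have "r - s = 0"
        using residue_unit[of "r - s"] by (auto simp: nonunits_eq)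
      then show ?thesis
        using s(1) by simp
    qed
    obtain \<alpha> where "r = const \<alpha>"
      using constant_of_no_poles[OF mem[OF place_at_valuation] mem[OF place_infinity_valuation]] .
    then show ?thesis
      using r(2) by blast
  qed
  obtain a b where ab: "a \<in> A" "b \<in> A - P" "b \<noteq> 0" "z = a / b"
    using localizationE[OF A(1,2), of z] unit_setD(1)[OF z_unit] A(3) by metis
  obtain \<alpha> \<beta> where \<alpha>\<beta>: "a - const \<alpha> \<in> nonunits D" "b - const \<beta> \<in> nonunits D"
    using residue ab by blast
  have "b \<in> unit_set D"
    using unit_localization_iff'[OF A(1,2), of b] ab A(3) by simp
  then have "\<beta> \<noteq> 0"
    using \<alpha>\<beta>(2) by (auto simp: const_zero nonunits_eq)
  \<comment> \<open>The linear polynomial with root \<open>\<alpha> / \<beta>\<close>, the value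
    that \<open>z\<close> would take along \<open>D\<close>.\<close>
  have "cpoly z [:- \<alpha>, \<beta>:] = (a - const \<alpha>) - z * (b - const \<beta>)"
    using ab(3,4) by (simp add: cpoly_pCons cpoly_0 const_minus algebra_simps)
  also have "\<dots> \<in> nonunits D"
    using \<alpha>\<beta> unit_setD(1)[OF z_unit] ideal_diff[OF D_subring D_ideal] ideal_mult[OF D_ideal] by blast
  finally show False
    using cpoly_unit[of "[:- \<alpha>, \<beta>:]"] \<open>\<beta> \<noteq> 0\<close> by (simp add: nonunits_eq)
qed

end

locale polarized = toric_model M for M +
  fixes L :: sheaf and h :: ratfun
  assumes projective: "projective_model M" and ample: "ample M L"
    and h_nonzero: "h \<noteq> 0" and L_torus: "\<And>D. torus_divisor D \<Longrightarrow> L D = (*) h ` D"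
begin

lemma line_bundle: "line_bundle M L"
  using ample by (simp add: ample_def)

section \<open>Sections of powers of \<open>L\<close>\<close>

definition gen :: "ratfun set \<Rightarrow> ratfun" where
  "gen p = (SOME g. line_generator M L p g)"

lemma gen: "p \<in> M \<Longrightarrow> line_generator M L p (gen p)"
  unfolding gen_def using line_bundle_generator[OF line_bundle] by (metis someI)

lemma gen_nonzero: "p \<in> M \<Longrightarrow> gen p \<noteq> 0"
  and gen_eq: "p \<in> M \<Longrightarrow> q \<in> M \<Longrightarrow> p \<subseteq> q \<Longrightarrow> L q = (*) (gen p) ` q"
  using gen by (auto simp: line_generator_def)

lemma gen_unit:
  assumes "p \<in> M" "q \<in> M" "p \<subseteq> q"
  shows "gen q / gen p \<in> unit_set q"
  using image_mult_eq_iff[OF point_subring[OF assms(2)] gen_nonzero[OF assms(1)] gen_nonzero[OF assms(2)]]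
    gen_eq[OF assms] gen_eq[OF assms(2,2)] by simp

lemma tensor_power_eq: "p \<in> M \<Longrightarrow> tensor_power L n p = (*) (gen p ^ n) ` p"
  by (rule tensor_power_principal[OF point_subring gen_eq]) auto

definition is_section :: "nat \<Rightarrow> ratfun \<Rightarrow> bool" where
  "is_section n s \<longleftrightarrow> (\<forall>p\<in>M. s / gen p ^ n \<in> p)"

lemma global_sections_iff: "s \<in> global_sections M (tensor_power L n) \<longleftrightarrow> is_section n s"
  using gen_nonzero by (auto simp: global_sections_def is_section_def tensor_power_eq mem_image_mult_iff)

lemma nonvanishing_iff:
  "p \<in> nonvanishing_locus M (tensor_power L n) s \<longleftrightarrow> p \<in> M \<and> s / gen p ^ n \<in> unit_set p"
proof (cases "p \<in> M \<and> s \<noteq> 0")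
  case True
  then show ?thesis
    using image_mult_eq_iff[OF point_subring, of p "gen p ^ n" s] gen_nonzero[of p]
    by (simp add: nonvanishing_locus_def tensor_power_eq)
next
  case False
  have "(*) (gen p ^ n) ` p \<noteq> (*) 0 ` p" if p: "p \<in> M"
  proof
    assume eq: "(*) (gen p ^ n) ` p = (*) 0 ` p"
    have "gen p ^ n * 1 \<in> (*) (gen p ^ n) ` p"
      using subring_one[OF point_subring[OF p]] by blast
    then show False
      unfolding eq using gen_nonzero[OF p] by auto
  qed
  then show ?thesis
    using False by (auto simp: nonvanishing_locus_def tensor_power_eq unit_set_def)
qed

definition unif :: "ratfun set \<Rightarrow> ratfun" where
  "unif D = (SOME t. is_dvr D t)"

definition bdry :: "ratfun set set" where
  "bdry = {D. codim_one_point M D \<and> \<not> torus_divisor D}"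

lemma unif: "codim_one_point M D \<Longrightarrow> is_dvr D (unif D)"
  unfolding unif_def using codim_one_point_iff_dvr by (metis someI)

lemma codim_one_point_mem: "codim_one_point M D \<Longrightarrow> D \<in> M"
  by (simp add: codim_one_point_def)

lemma bdry_boundary: "D \<in> bdry \<Longrightarrow> boundary M D (unif D)"
  using unif codim_one_point_mem
  by (intro boundary.intro boundary_axioms.intro toric_model_axioms) (auto simp: bdry_def torus_divisor_def)

definition wt :: "ratfun set \<Rightarrow> int \<times> int" where
  "wt D = boundary.weight D (unif D)"

text \<open>The order along \<open>D\<close> of the generator of \<open>L\<close>, measured against
  the trivialization \<open>h\<close> on the torus. With this sign it is the bound in the inequality
  of the edge that belongs to \<open>D\<close>.\<close>

definition kappa :: "ratfun set \<Rightarrow> int" where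
  "kappa D = dval D (unif D) (gen D / h)"

lemma torus_divisor_units:
  assumes D: "torus_divisor D"
  shows "lmon k \<in> unit_set D" "h / gen D \<in> unit_set D"
proof -
  note DM = torus_divisorD(1)[OF D]
  show "lmon k \<in> unit_set D"
    using lmon_unit_torus torus_divisorD[OF D] by blast
  show "h / gen D \<in> unit_set D"
    using image_mult_eq_iff[OF point_subring[OF DM] gen_nonzero[OF DM] h_nonzero] gen_eq[OF DM DM] L_torus[OF D]
    by simp
qed

lemma dval_section:
  assumes D: "D \<in> bdry"
  shows "dval D (unif D) (h ^ n * lmon k / gen D ^ n) = dot (wt D) k - int n * kappa D"
proof -
  interpret boundary M D "unif D"
    by (rule bdry_boundary[OF D])
  show ?thesis
    using gen_nonzero[OF D_point] h_nonzero
    by (simp add: dval_divide[OF dvr] dval_mult[OF dvr] dval_power[OF dvr] dval_lmon lmon_nonzero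
        wt_def kappa_def algebra_simps)
qed

lemma local_section_cong:
  assumes "p \<in> M" "codim_one_point M D" "p \<subseteq> D"
  shows "s / gen p ^ n \<in> D \<longleftrightarrow> s / gen D ^ n \<in> D"
    and "s / gen p ^ n \<in> unit_set D \<longleftrightarrow> s / gen D ^ n \<in> unit_set D"
proof -
  note DM = codim_one_point_mem[OF assms(2)]
  have e: "(gen D / gen p) ^ n \<in> unit_set D"
    by (rule unit_set_power[OF point_subring[OF DM] gen_unit[OF assms(1) DM assms(3)]])
  have e1: "s / gen p ^ n = s / gen D ^ n * (gen D / gen p) ^ n"
    and e2: "s / gen D ^ n = s / gen p ^ n * inverse ((gen D / gen p) ^ n)"
    using gen_nonzero[OF DM] gen_nonzero[OF assms(1)] by (simp_all add: power_divide)
  show "s / gen p ^ n \<in> D \<longleftrightarrow> s / gen D ^ n \<in> D"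
    using subring_mult[OF point_subring[OF DM]] unit_setD(1,2)[OF e] e1 e2 by metis
  show "s / gen p ^ n \<in> unit_set D \<longleftrightarrow> s / gen D ^ n \<in> unit_set D"
    using unit_set_mult[OF point_subring[OF DM]] e unit_set_inverse[OF e] e1 e2 by metis
qed

text \<open>Hartogs, after the generator at \<open>p\<close> is replaced by the one at
  \<open>D\<close>, which differs from it by a unit of \<open>D\<close>.\<close>

lemma section_iff_codim_one:
  "is_section n s \<longleftrightarrow> (\<forall>D. codim_one_point M D \<longrightarrow> s / gen D ^ n \<in> D)"
proof
  assume "is_section n s"
  then show "\<forall>D. codim_one_point M D \<longrightarrow> s / gen D ^ n \<in> D"
    using codim_one_point_mem by (simp add: is_section_def)
next
  assume *: "\<forall>D. codim_one_point M D \<longrightarrow> s / gen D ^ n \<in> D"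
  show "is_section n s"
    unfolding is_section_def
  proof
    fix p assume p: "p \<in> M"
    show "s / gen p ^ n \<in> p"
      using * local_section_cong(1)[OF p] by (intro hartogs[OF p]) blast
  qed
qed

text \<open>Along torus divisors monomials and \<open>h / gen D\<close> are units, so only the
  boundary imposes conditions: the inequalities of the \<open>n\<close>-fold polygon.\<close>

lemma monomial_section_iff:
  "is_section n (h ^ n * lmon k) \<longleftrightarrow> (\<forall>D\<in>bdry. dot (wt D) k \<ge> int n * kappa D)"
proof -
  have torus: "h ^ n * lmon k / gen D ^ n \<in> D" if D: "torus_divisor D" for D
  proof -
    have "(h / gen D) ^ n * lmon k \<in> D"
      using unit_setD(1)[OF torus_divisor_units(1)[OF D, of k]] unit_setD(1)[OF torus_divisor_units(2)[OF D]]
      by (intro subring_mult[OF torus_divisorD(2)[OF D]] subring_power[OF torus_divisorD(2)[OF D]])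
    then show ?thesis
      by (simp add: power_divide)
  qed
  have bd: "h ^ n * lmon k / gen D ^ n \<in> D \<longleftrightarrow> dot (wt D) k \<ge> int n * kappa D" if D: "D \<in> bdry" for D
  proof -
    interpret boundary M D "unif D"
      by (rule bdry_boundary[OF D])
    have "h ^ n * lmon k / gen D ^ n \<noteq> 0"
      using gen_nonzero[OF D_point] h_nonzero by (simp add: lmon_nonzero)
    then show ?thesis
      using dvr_mem_iff[OF dvr] dval_section[OF D] by simp
  qed
  show ?thesis
    unfolding section_iff_codim_one using torus bd by (auto simp: bdry_def)
qed

text \<open>Every function is a monomial times a unit of \<open>D\<close>. With such a
  trivialization a section times a monomial is a Laurent polynomial in \<open>D\<close>, to which
  \<open>lmon_component_mem\<close> applies.\<close>

lemma boundary_trivialization: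
  assumes D: "D \<in> bdry"
  obtains j e where "h / gen D = lmon j * e" "e \<in> unit_set D" "dot (wt D) j = - kappa D"
proof -
  interpret boundary M D "unif D"
    by (rule bdry_boundary[OF D])
  have nz: "h / gen D \<noteq> 0"
    using gen_nonzero[OF D_point] h_nonzero by simp
  obtain j where j: "(h / gen D) / lmon j \<in> unit_set D"
    using lmon_unit_multiple[OF nz] .
  then have "dval D (unif D) ((h / gen D) / lmon j) = 0"
    by (simp only: dvr_unit_iff[OF dvr])
  then have "dval D (unif D) (h / gen D) = dot weight j"
    unfolding dval_divide[OF dvr nz lmon_nonzero] dval_lmon by simp
  moreover have "dval D (unif D) (h / gen D) = - kappa D"
    using gen_nonzero[OF D_point] h_nonzero by (simp add: kappa_def dval_divide[OF dvr])
  ultimately show ?thesis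
    using that[of j "(h / gen D) / lmon j"] j by (simp add: lmon_nonzero wt_def)
qed

text \<open>On the torus \<open>s / h ^ n\<close> is a Laurent polynomial. Along each boundary
  divisor a shift of exponents makes it an element of \<open>D\<close>, and \<open>D\<close>
  contains all monomials of it.\<close>

lemma section_laurent:
  assumes s: "is_section n s"
  obtains S c where "finite S" "\<And>k. k \<in> S \<Longrightarrow> c k \<noteq> 0" "s = h ^ n * laurent_sum S c"
    "\<And>k. k \<in> S \<Longrightarrow> is_section n (h ^ n * lmon k)"
proof -
  have "s / h ^ n \<in> D" if D: "torus_divisor D" for D
  proof -
    have "s / gen D ^ n \<in> D"
      using s torus_divisorD(1)[OF D] by (simp add: is_section_def)
    moreover have "inverse ((h / gen D) ^ n) \<in> D"
      using unit_setD(2)[OF unit_set_power[OF torus_divisorD(2)[OF D] torus_divisor_units(2)[OF D]]] .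
    ultimately have "s / gen D ^ n * inverse ((h / gen D) ^ n) \<in> D"
      using subring_mult[OF torus_divisorD(2)[OF D]] by blast
    then show ?thesis
      using gen_nonzero[OF torus_divisorD(1)[OF D]] by (simp add: power_divide)
  qed
  then have "s / h ^ n \<in> laurent_ring UNIV"
    by (rule torus_regular_function)
  then obtain S c where S: "finite S" "\<forall>k\<in>S. c k \<noteq> 0" "s / h ^ n = laurent_sum S c"
    by (auto simp: laurent_ring_UNIV)
  have eq: "s = h ^ n * laurent_sum S c"
    using S(3) h_nonzero by (simp add: field_simps)
  have "is_section n (h ^ n * lmon k)" if k: "k \<in> S" for k
    unfolding monomial_section_iff
  proof
    fix D assume D: "D \<in> bdry"
    interpret boundary M D "unif D"
      by (rule bdry_boundary[OF D])
    obtain j e where j: "h / gen D = lmon j * e" "e \<in> unit_set D" "dot (wt D) j = - kappa D"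
      using boundary_trivialization[OF D] .
    have "s / gen D ^ n = laurent_sum S c * (h / gen D) ^ n"
      by (simp add: eq power_divide)
    also have "\<dots> = laurent_sum S c / lmon (scale (- int n) j) * e ^ n"
      unfolding j(1) by (simp add: power_mult_distrib lmon_scale power_int_minus divide_inverse mult_ac)
    finally have "s / gen D ^ n = laurent_sum S c / lmon (scale (- int n) j) * e ^ n" .
    moreover have "s / gen D ^ n \<in> D"
      using s D_point by (simp add: is_section_def)
    ultimately have "laurent_sum S c / lmon (scale (- int n) j) * e ^ n \<in> D"
      by simp
    then have "laurent_sum S c / lmon (scale (- int n) j) * e ^ n * inverse (e ^ n) \<in> D"
      using unit_setD(2)[OF unit_set_power[OF D_subring j(2)]] subring_mult[OF D_subring] by blast
    moreover have "y * e ^ n * inverse (e ^ n) = y" for y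
      using unit_setD(3)[OF j(2)] by (simp add: field_simps)
    ultimately have "laurent_sum S c / lmon (scale (- int n) j) \<in> D"
      by metis
    then have "laurent_sum ((\<lambda>k. k - scale (- int n) j) ` S) (\<lambda>k. c (k + scale (- int n) j)) \<in> D"
      by (simp only: laurent_sum_shift)
    from lmon_component_mem[OF D_point this, of "k - scale (- int n) j"] have "lmon (k - scale (- int n) j) \<in> D"
      using S k by simp
    then show "dot (wt D) k \<ge> int n * kappa D"
      using j(3) by (simp add: lmon_mem_iff dot_diff dot_scale wt_def)
  qed
  then show ?thesis
    using that S eq by blast
qed

lemma ample_section:
  assumes x: "x \<in> M"
  obtains n s A where "n \<ge> 1" "is_section n s" "s / gen x ^ n \<in> unit_set x"
    "\<And>p. p \<in> affine_model A \<longleftrightarrow> p \<in> M \<and> s / gen p ^ n \<in> unit_set p"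
proof -
  obtain n s A where "n \<ge> 1" "s \<in> global_sections M (tensor_power L n)"
    "x \<in> nonvanishing_locus M (tensor_power L n) s" "nonvanishing_locus M (tensor_power L n) s = affine_model A"
    using ample x unfolding ample_def by blast
  moreover from this have "p \<in> affine_model A \<longleftrightarrow> p \<in> M \<and> s / gen p ^ n \<in> unit_set p" for p
    using nonvanishing_iff[of p n s] by simp
  ultimately show ?thesis
    using that[of n s A] global_sections_iff[of s n] x by simp
qed

text \<open>In a local ring a sum of nonunits is no unit, so one of the monomial terms of a section
  that generates at \<open>x\<close> generates there already.\<close>

lemma monomial_generator:
  assumes x: "x \<in> M"
  obtains n k where "n \<ge> 1" "is_section n (h ^ n * lmon k)" "h ^ n * lmon k / gen x ^ n \<in> unit_set x"
proof -
  have ix: "is_ideal x (nonunits x)"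
    using point_local[OF x] by (rule local_subring_ideal)
  obtain n s where s: "n \<ge> 1" "is_section n s" "s / gen x ^ n \<in> unit_set x"
    using ample_section[OF x] by metis
  obtain S c where S: "s = h ^ n * laurent_sum S c" "\<And>k. k \<in> S \<Longrightarrow> is_section n (h ^ n * lmon k)"
    using section_laurent[OF s(2)] by metis
  have "\<exists>k\<in>S. h ^ n * lmon k / gen x ^ n \<notin> nonunits x"
  proof (rule ccontr)
    assume "\<not> ?thesis"
    then have "(\<Sum>k\<in>S. const (c k) * (h ^ n * lmon k / gen x ^ n)) \<in> nonunits x"
      by (intro ideal_sum[OF ix] ideal_mult[OF ix point_const[OF x]]) auto
    moreover have "(\<Sum>k\<in>S. const (c k) * (h ^ n * lmon k / gen x ^ n)) = s / gen x ^ n"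
      unfolding S(1) laurent_sum_def sum_distrib_left sum_divide_distrib by (simp add: mult_ac)
    ultimately show False
      using s(3) by (simp add: nonunits_eq)
  qed
  then obtain k where k: "k \<in> S" "h ^ n * lmon k / gen x ^ n \<notin> nonunits x"
    by blast
  moreover have "h ^ n * lmon k / gen x ^ n \<in> x"
    using S(2)[OF k(1)] x by (simp add: is_section_def)
  ultimately show ?thesis
    using that[of n k] s(1) S(2) by (simp add: nonunits_eq)
qed

text \<open>The vertex of the section polytope at the centre of a monomial valuation ring \<open>V\<close> of rank two.\<close>

lemma vertex:
  assumes D: "D \<in> bdry" and x: "x \<in> M" "x \<subseteq> V" "x \<subseteq> D"
    and multiple: "\<And>f. f \<noteq> 0 \<Longrightarrow> \<exists>l. f / lmon l \<in> unit_set V" and V: "is_subring V"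
    and unit: "\<And>k. lmon k \<in> unit_set V \<Longrightarrow> k = 0"
  obtains m where "is_section 1 (h * lmon m)" "h * lmon m / gen x \<in> unit_set x" "dot (wt D) m = kappa D"
proof -
  interpret boundary M D "unif D"
    by (rule bdry_boundary[OF D])
  obtain n k where k: "n \<ge> 1" "is_section n (h ^ n * lmon k)" "h ^ n * lmon k / gen x ^ n \<in> unit_set x"
    using monomial_generator[OF x(1)] .
  have "gen x / h \<noteq> 0"
    using gen_nonzero[OF x(1)] h_nonzero by simp
  then obtain l where l: "(gen x / h) / lmon l \<in> unit_set V"
    using multiple by blast
  have "((gen x / h) / lmon l) ^ n * (h ^ n * lmon k / gen x ^ n) \<in> unit_set V"
    using k(3) unit_set_mono[OF x(2)] by (intro unit_set_mult[OF V] unit_set_power[OF V] l) auto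
  moreover have "((gen x / h) / lmon l) ^ n * (h ^ n * lmon k / gen x ^ n) = lmon (k - scale (int n) l)"
    using gen_nonzero[OF x(1)] h_nonzero by (simp add: power_divide lmon_diff lmon_power power_mult_distrib)
  \<comment> \<open>\<open>V\<close> has no monomial units except 1, so \<open>k\<close> is exactly
    \<open>n\<close> times the exponent \<open>l\<close> of \<open>gen x / h\<close>.\<close>
  ultimately have kl: "k = scale (int n) l"
    using unit[of "k - scale (int n) l"] by simp
  have "h ^ n * lmon k / gen x ^ n = (h * lmon l / gen x) ^ n"
    by (simp add: kl power_divide power_mult_distrib lmon_power)
  \<comment> \<open>By normality roots of units are units, so \<open>L\<close> itself, not only its
    \<open>n\<close>-th power, is generated at \<open>x\<close> by a monomial.\<close>
  then have gen_unit_x: "h * lmon l / gen x \<in> unit_set x"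
    using k(1,3) point_power_unit[OF x(1), of "h * lmon l / gen x" n] by simp
  have "int n * dot (wt D') l \<ge> int n * kappa D'" if "D' \<in> bdry" for D'
    using k(2) that unfolding monomial_section_iff kl dot_scale by blast
  then have "is_section 1 (h ^ 1 * lmon l)"
    using k(1) unfolding monomial_section_iff by simp
  moreover have "h * lmon l / gen x ^ 1 \<in> unit_set D"
    using gen_unit_x unit_set_mono[OF x(3)] by auto
  then have "h ^ 1 * lmon l / gen D ^ 1 \<in> unit_set D"
    using local_section_cong(2)[OF x(1) _ x(3), of "h * lmon l" 1] D by (simp add: bdry_def)
  then have "dot (wt D) l = kappa D"
    unfolding dvr_unit_iff[OF dvr] dval_section[OF D] by simp
  ultimately show ?thesis
    using that gen_unit_x by simp
qed

text \<open>The two points come from the places 0 and infinity of the curve \<open>D\<close>. To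
  distinguish them takes more than generation by sections: the affineness of a nonvanishing
  locus.\<close>

lemma edge_vertices:
  assumes D: "D \<in> bdry"
  obtains p q where "is_section 1 (h * lmon p)" "is_section 1 (h * lmon q)"
    "dot (wt D) p = kappa D" "dot (wt D) q = kappa D" "p \<noteq> q"
proof -
  interpret boundary M D "unif D"
    by (rule bdry_boundary[OF D])
  have wt: "wt D = weight"
    by (simp add: wt_def)
  have place0: "place_at 0 \<subseteq> residues" "is_subring (place_at 0)"
    and placei: "place_infinity \<subseteq> residues" "is_subring place_infinity"
    using place_at_valuation[of 0] place_infinity_valuation by (simp_all add: residue_valuation_def)
  have comp: "is_subring (composite V)" if "residue_valuation V" for V
    using composite_valuation(1)[OF that] by (simp add: valuation_ring_def)
  obtain x0 where x0: "x0 \<in> M" "x0 \<subseteq> composite (place_at 0)" "x0 \<subseteq> D"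
    using composite_center[OF projective place_at_valuation] .
  obtain xi where xi: "xi \<in> M" "xi \<subseteq> composite place_infinity" "xi \<subseteq> D"
    using composite_center[OF projective place_infinity_valuation] .
  obtain p where p: "is_section 1 (h * lmon p)" "h * lmon p / gen x0 \<in> unit_set x0" "dot (wt D) p = kappa D"
    using vertex[OF D x0 composite_unit_multiple[OF place0] comp[OF place_at_valuation] composite_zero_unit]
      residue_at_zero by metis
  obtain q where q: "is_section 1 (h * lmon q)" "h * lmon q / gen xi \<in> unit_set xi" "dot (wt D) q = kappa D"
    using vertex[OF D xi composite_unit_multiple[OF placei] comp[OF place_infinity_valuation] composite_infinity_unit]
      residue_at_infinity by metis
  have "p \<noteq> q"
  proof
    assume "p = q"
    \<comment> \<open>Otherwise all sections of powers of \<open>L\<close> are constant along \<open>D\<close>, so an affine open set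
      defined by one of them contains the closure of \<open>D\<close>.\<close>
    have ratio: "lmon (k - scale (int n) p) \<in> x"
      if k: "is_section n (h ^ n * lmon k)" and x: "x \<in> M" "h * lmon p / gen x \<in> unit_set x" for n k x
    proof -
      have sx: "is_subring x"
        by (rule point_subring[OF x(1)])
      have "h ^ n * lmon k / gen x ^ n \<in> x"
        using k x(1) by (simp add: is_section_def)
      then have "h ^ n * lmon k / gen x ^ n * inverse ((h * lmon p / gen x) ^ n) \<in> x"
        using unit_setD(2)[OF unit_set_power[OF sx x(2)]] subring_mult[OF sx] by blast
      moreover have "h ^ n * lmon k / gen x ^ n * inverse ((h * lmon p / gen x) ^ n) = lmon (k - scale (int n) p)"
        using gen_nonzero[OF x(1)] h_nonzero
        by (simp add: power_divide power_mult_distrib lmon_power lmon_diff)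
      ultimately show ?thesis
        by simp
    qed
    \<comment> \<open>The quotient of such a section by the power of the section at \<open>p\<close>
      is a monomial of weight 0 that is regular at both ends of the curve, hence trivial.\<close>
    have face: "k = scale (int n) p" if k: "is_section n (h ^ n * lmon k)" "dot (wt D) k = int n * kappa D" for n k
    proof -
      have "lmon (k - scale (int n) p) \<in> x0" "lmon (k - scale (int n) p) \<in> xi"
        using ratio[OF k(1) x0(1) p(2)] ratio[OF k(1) xi(1)] q(2) \<open>p = q\<close> by simp_all
      then have "k - scale (int n) p = 0"
        using x0(2) xi(2) k(2) p(3) wt by (intro composite_zero_inter_infinity) (auto simp: dot_diff dot_scale)
      then show ?thesis
        by simp
    qed
    \<comment> \<open>A monomial section that generates at \<open>x\<close> generates along
      \<open>D\<close> as well, so it lies on the face, which is the single point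
      \<open>scale n p\<close>.\<close>
    have generates: "h * lmon p / gen x \<in> unit_set x" if x: "x \<in> M" "x \<subseteq> D" for x
    proof -
      obtain n k where k: "n \<ge> 1" "is_section n (h ^ n * lmon k)" "h ^ n * lmon k / gen x ^ n \<in> unit_set x"
        using monomial_generator[OF x(1)] .
      have "h ^ n * lmon k / gen x ^ n \<in> unit_set D"
        using k(3) unit_set_mono[OF x(2)] by auto
      then have "h ^ n * lmon k / gen D ^ n \<in> unit_set D"
        using local_section_cong(2)[OF x(1) _ x(2)] D by (simp add: bdry_def)
      then have "dot (wt D) k = int n * kappa D"
        unfolding dvr_unit_iff[OF dvr] dval_section[OF D] by simp
      then have kp: "k = scale (int n) p"
        using face k(2) by blast
      have "h ^ n * lmon k / gen x ^ n = (h * lmon p / gen x) ^ n"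
        by (simp add: kp power_divide power_mult_distrib lmon_power)
      then show ?thesis
        using k(1,3) point_power_unit[OF x(1), of "h * lmon p / gen x" n] by simp
    qed
    obtain n s A where s: "n \<ge> 1" "is_section n s" "s / gen x0 ^ n \<in> unit_set x0"
      "\<And>p. p \<in> affine_model A \<longleftrightarrow> p \<in> M \<and> s / gen p ^ n \<in> unit_set p"
      by (rule ample_section[OF x0(1)]) (rule that)
    obtain S c where S: "finite S" "\<And>k. k \<in> S \<Longrightarrow> c k \<noteq> 0" "s = h ^ n * laurent_sum S c"
      "\<And>k. k \<in> S \<Longrightarrow> is_section n (h ^ n * lmon k)"
      by (rule section_laurent[OF s(2)]) (rule that)
    define k0 where "k0 = scale (int n) p"
    \<comment> \<open>The section \<open>s\<close> measured against the \<open>n\<close>-th power of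
      the section at \<open>p\<close>: at the points of the closure of \<open>D\<close>, a constant
      plus nonunits.\<close>
    define w where "w = laurent_sum S c / lmon k0"
    have w_gen: "s / gen x ^ n = w * (h * lmon p / gen x) ^ n" if "x \<in> M" for x
      by (simp add: S(3) w_def k0_def power_divide power_mult_distrib lmon_power lmon_nonzero)
    \<comment> \<open>\<open>lmon (k - k0)\<close> is regular at \<open>x\<close> but, by
      \<open>face\<close>, no unit along \<open>D\<close>, and so no unit at \<open>x\<close>
      either.\<close>
    have rest: "const (c k) * lmon (k - k0) \<in> nonunits x" if k: "k \<in> S" "k \<noteq> k0" and x: "x \<in> M" "x \<subseteq> D" for k x
    proof -
      have ix: "is_ideal x (nonunits x)"
        using point_local[OF x(1)] by (rule local_subring_ideal)
      have mem: "lmon (k - k0) \<in> x"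
        unfolding k0_def by (rule ratio[OF S(4)[OF k(1)] x(1) generates[OF x]])
      have "lmon (k - k0) \<notin> unit_set D"
      proof
        assume "lmon (k - k0) \<in> unit_set D"
        then have "dot (wt D) k = int n * kappa D"
          using p(3) by (simp add: lmon_unit_iff dot_diff k0_def dot_scale wt)
        then show False
          using face[OF S(4)[OF k(1)]] k(2) by (simp add: k0_def)
      qed
      then have "lmon (k - k0) \<in> nonunits x"
        using mem unit_set_mono[OF x(2)] by (auto simp: nonunits_eq)
      then show ?thesis
        using ideal_mult[OF ix point_const[OF x(1)]] by blast
    qed
    have w_sum: "w = (\<Sum>k\<in>S. const (c k) * lmon (k - k0))"
      by (simp add: w_def laurent_sum_def sum_divide_distrib lmon_diff)
    \<comment> \<open>Without this term \<open>s\<close> would vanish at \<open>x0\<close>, where it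
      was chosen to generate.\<close>
    have "k0 \<in> S"
    proof (rule ccontr)
      assume "k0 \<notin> S"
      have ix: "is_ideal x0 (nonunits x0)"
        using point_local[OF x0(1)] by (rule local_subring_ideal)
      have "w \<in> nonunits x0"
        unfolding w_sum using rest[OF _ _ x0(1,3)] \<open>k0 \<notin> S\<close> by (intro ideal_sum[OF ix]) auto
      then have "w * (h * lmon p / gen x0) ^ n \<in> nonunits x0"
        using unit_setD(1)[OF unit_set_power[OF point_subring[OF x0(1)] p(2)]] by (intro ideal_mult_right[OF ix])
      then show False
        using s(3) w_gen[OF x0(1)] by (simp add: nonunits_eq)
    qed
    \<comment> \<open>The nonzero constant term makes \<open>s\<close> a generator at every point of
      the closure of \<open>D\<close>, which therefore lies in the affine locus.\<close>
    have affine: "x \<in> affine_model A" if x: "x \<in> M" "x \<subseteq> D" for x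
    proof -
      have sx: "is_subring x" and ix: "is_ideal x (nonunits x)"
        using point_local[OF x(1)] by (simp_all add: local_subring_iff)
      define v where "v = (\<Sum>k\<in>S - {k0}. const (c k) * lmon (k - k0))"
      have v: "v \<in> nonunits x"
        unfolding v_def using rest[OF _ _ x] by (intro ideal_sum[OF ix]) auto
      have w: "w = const (c k0) + v"
        unfolding w_sum v_def using S(1) \<open>k0 \<in> S\<close> by (simp add: sum.remove lmon_zero)
      have "const (c k0) \<in> unit_set x"
        using point_const_unit[OF x(1)] S(2)[OF \<open>k0 \<in> S\<close>] .
      then have "w \<notin> nonunits x"
        using ideal_diff[OF sx ix _ v, of w] w by (auto simp: nonunits_eq)
      moreover have "w \<in> x"
        using v point_const[OF x(1)] w subring_add[OF sx] by (auto simp: nonunits_def)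
      ultimately have "w \<in> unit_set x"
        by (simp add: nonunits_eq)
      then have "s / gen x ^ n \<in> unit_set x"
        unfolding w_gen[OF x(1)] using generates[OF x] by (intro unit_set_mult[OF sx] unit_set_power[OF sx])
      then show ?thesis
        using s(4) x(1) by blast
    qed
    obtain P where P: "is_subring A" "is_prime A P" "D = localization A P"
      using affine[OF D_point order_refl] unfolding affine_model_def' by blast
    have "A \<subseteq> composite V" if V: "residue_valuation V" for V
    proof -
      obtain x where x: "x \<in> M" "x \<subseteq> composite V" "x \<subseteq> D"
        using composite_center[OF projective V] .
      obtain Q where Q: "is_prime A Q" "x = localization A Q"
        using affine[OF x(1,3)] unfolding affine_model_def' by blast
      then show ?thesis
        using subset_localization[OF P(1) Q(1)] x(2) by blast
    qed
    then show False
      by (rule affine_not_containing_curve[OF P])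
  qed
  then show ?thesis
    using that p q by blast
qed

end

section \<open>Reflexivity\<close>

context polarized
begin

section \<open>Adjoint sections and interior lattice points\<close>

definition canonical :: "ratfun set \<Rightarrow> ratfun set" where
  "canonical D = submodule_span D {jacobian a b | a b. a \<in> D \<and> b \<in> D}"

lemma dualizing_sheaf_iff:
  "f \<in> dualizing_sheaf M p \<longleftrightarrow> (\<forall>D. codim_one_point M D \<and> p \<subseteq> D \<longrightarrow> f \<in> canonical D)"
  by (auto simp: dualizing_sheaf_def canonical_def)

lemma canonical_torus: "torus_divisor D \<Longrightarrow> canonical D = D"
  unfolding canonical_def by (rule torus_codim_one_canonical) (auto dest: torus_divisorD)

lemma canonical_bdry:
  assumes "D \<in> bdry" "dot (wt D) l = 1"
  shows "canonical D = (*) (lmon (l - (1, 1))) ` D"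
proof -
  interpret boundary M D "unif D"
    by (rule bdry_boundary[OF assms(1)])
  show ?thesis
    unfolding canonical_def using boundary_canonical assms(2) by (simp add: wt_def)
qed

lemma wt_surj:
  assumes "D \<in> bdry"
  obtains l where "dot (wt D) l = 1"
proof -
  interpret boundary M D "unif D"
    by (rule bdry_boundary[OF assms])
  show ?thesis
    using weight_surj that by (metis wt_def)
qed

lemma canonical_principal:
  assumes "codim_one_point M D"
  obtains w where "w \<noteq> 0" "canonical D = (*) w ` D"
proof (cases "torus_divisor D")
  case True
  then show ?thesis
    using that[of 1] canonical_torus by simp
next
  case False
  then have D: "D \<in> bdry"
    using assms by (simp add: bdry_def)
  obtain l where "dot (wt D) l = 1"
    using wt_surj[OF D] .
  then show ?thesis
    using that[of "lmon (l - (1, 1))"] canonical_bdry[OF D] by (simp add: lmon_nonzero)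
qed

lemma canonical_module:
  assumes D: "codim_one_point M D"
  shows "0 \<in> canonical D" "x \<in> canonical D \<Longrightarrow> y \<in> canonical D \<Longrightarrow> x + y \<in> canonical D"
    "r \<in> D \<Longrightarrow> x \<in> canonical D \<Longrightarrow> r * x \<in> canonical D"
proof -
  obtain w where w: "w \<noteq> 0" "canonical D = (*) w ` D"
    using canonical_principal[OF D] .
  have sD: "is_subring D"
    by (rule point_subring[OF codim_one_point_mem[OF D]])
  show "0 \<in> canonical D" "x \<in> canonical D \<Longrightarrow> y \<in> canonical D \<Longrightarrow> x + y \<in> canonical D"
    "r \<in> D \<Longrightarrow> x \<in> canonical D \<Longrightarrow> r * x \<in> canonical D"
    unfolding w(2) mem_image_mult_iff[OF w(1)] using subring_mult[OF sD, of r "x / w"]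
    by (simp_all add: subring_zero[OF sD] subring_add[OF sD] add_divide_distrib)
qed

text \<open>Tensoring with \<open>L\<close> multiplies stalks by the generator, and the dualizing
  sheaf is tested in codimension one, where the generators at \<open>p\<close> and at
  \<open>D\<close> agree up to units.\<close>

lemma adjoint_sections:
  "f \<in> global_sections M (tensor L (dualizing_sheaf M)) \<longleftrightarrow>
    (\<forall>D. codim_one_point M D \<longrightarrow> f / gen D \<in> canonical D)"
proof -
  have local: "tensor L (dualizing_sheaf M) p = (*) (gen p) ` dualizing_sheaf M p" if p: "p \<in> M" for p
  proof (rule tensor_principal_left[where p = p and F = L and a = "gen p" and G = "dualizing_sheaf M"])
    fix r x assume "r \<in> p" "x \<in> dualizing_sheaf M p"
    then show "r * x \<in> dualizing_sheaf M p"
      using canonical_module(3) unfolding dualizing_sheaf_iff by blast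
  qed (use canonical_module(1,2) in \<open>auto simp: dualizing_sheaf_iff intro!: point_subring[OF p] gen_eq[OF p p]\<close>)
  have "f \<in> tensor L (dualizing_sheaf M) p \<longleftrightarrow>
      (\<forall>D. codim_one_point M D \<and> p \<subseteq> D \<longrightarrow> f / gen D \<in> canonical D)" if p: "p \<in> M" for p
  proof -
    have "f / gen p \<in> canonical D \<longleftrightarrow> f / gen D \<in> canonical D" if D: "codim_one_point M D" "p \<subseteq> D" for D
    proof -
      note DM = codim_one_point_mem[OF D(1)]
      have e: "gen D / gen p \<in> unit_set D"
        by (rule gen_unit[OF p DM D(2)])
      have e1: "f / gen p = (gen D / gen p) * (f / gen D)"
        and e2: "f / gen D = inverse (gen D / gen p) * (f / gen p)"
        using gen_nonzero[OF p] gen_nonzero[OF DM] by simp_all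
      show ?thesis
        using canonical_module(3)[OF D(1)] unit_setD(1,2)[OF e] e1 e2 by metis
    qed
    then show ?thesis
      using local[OF p] gen_nonzero[OF p] by (auto simp: mem_image_mult_iff dualizing_sheaf_iff)
  qed
  then show ?thesis
    unfolding global_sections_def using codim_one_point_mem by blast
qed

definition interior_point :: "int \<times> int \<Rightarrow> bool" where
  "interior_point k \<longleftrightarrow> (\<forall>D\<in>bdry. dot (wt D) k \<ge> kappa D + 1)"

text \<open>The shift by \<open>(1, 1)\<close> rewrites a multiple of the invariant form as a
  multiple of \<open>dX \<and> dY\<close>. The simple pole of the invariant form along each boundary
  divisor accounts for the additional 1 in \<open>interior_point\<close>.\<close>

lemma adjoint_monomial:
  assumes "interior_point k"
  shows "h * lmon (k - (1, 1)) \<in> global_sections M (tensor L (dualizing_sheaf M))"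
  unfolding adjoint_sections
proof (intro allI impI)
  fix D assume D: "codim_one_point M D"
  show "h * lmon (k - (1, 1)) / gen D \<in> canonical D"
  proof (cases "torus_divisor D")
    case True
    have "h / gen D * lmon (k - (1, 1)) \<in> D"
      by (rule subring_mult[OF torus_divisorD(2)[OF True]])
        (rule unit_setD(1)[OF torus_divisor_units(2)[OF True]], rule unit_setD(1)[OF torus_divisor_units(1)[OF True]])
    then show ?thesis
      by (simp add: canonical_torus[OF True])
  next
    case False
    then have Db: "D \<in> bdry"
      using D by (simp add: bdry_def)
    interpret boundary M D "unif D"
      by (rule bdry_boundary[OF Db])
    obtain l where l: "dot (wt D) l = 1"
      using wt_surj[OF Db] .
    have eq: "h * lmon (k - (1, 1)) / gen D / lmon (l - (1, 1)) = h ^ 1 * lmon (k - l) / gen D ^ 1"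
      by (simp add: lmon_diff lmon_nonzero)
    have "dot (wt D) k \<ge> kappa D + 1"
      using assms Db by (simp add: interior_point_def)
    then have "dval D (unif D) (h ^ 1 * lmon (k - l) / gen D ^ 1) \<ge> 0"
      unfolding dval_section[OF Db] using l by (simp add: dot_diff)
    then have "h ^ 1 * lmon (k - l) / gen D ^ 1 \<in> D"
      using dvr_mem_iff[OF dvr, of "h ^ 1 * lmon (k - l) / gen D ^ 1"] gen_nonzero[OF D_point] h_nonzero
      by (simp add: lmon_nonzero)
    then show ?thesis
      unfolding canonical_bdry[OF Db l] mem_image_mult_iff[OF lmon_nonzero] eq .
  qed
qed

text \<open>Measured against \<open>h\<close> and the invariant form, \<open>f\<close> becomes the
  Laurent polynomial \<open>f'\<close>. As for sections of \<open>L\<close>, every monomial in it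
  satisfies the inequalities, and there is one because \<open>f\<close> is not 0.\<close>

lemma adjoint_section_interior_point:
  assumes f: "f \<in> global_sections M (tensor L (dualizing_sheaf M))" "f \<noteq> 0"
  obtains k where "interior_point k"
proof -
  define f' where "f' = f * lmon (1, 1) / h"
  have "f' \<in> D" if D: "torus_divisor D" for D
  proof -
    have sD: "is_subring D"
      by (rule torus_divisorD(2)[OF D])
    have "codim_one_point M D"
      using D by (simp add: torus_divisor_def)
    then have "f / gen D \<in> D"
      using f(1) canonical_torus[OF D] unfolding adjoint_sections by blast
    then have "f / gen D * (lmon (1, 1) * inverse (h / gen D)) \<in> D"
      using unit_setD(1)[OF torus_divisor_units(1)[OF D]] unit_setD(2)[OF torus_divisor_units(2)[OF D]]
      by (intro subring_mult[OF sD])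
    then show ?thesis
      using gen_nonzero[OF torus_divisorD(1)[OF D]] by (simp add: f'_def)
  qed
  then have "f' \<in> laurent_ring UNIV"
    by (rule torus_regular_function)
  then obtain S c where S: "finite S" "\<forall>k\<in>S. c k \<noteq> 0" "f' = laurent_sum S c"
    by (auto simp: laurent_ring_UNIV)
  have "f' \<noteq> 0"
    using f(2) h_nonzero by (simp add: f'_def lmon_nonzero)
  then have "S \<noteq> {}"
    using S(3) by (auto simp: laurent_sum_def)
  then obtain k where k: "k \<in> S"
    by blast
  have f_eq: "f = h * f' / lmon (1, 1)"
    using h_nonzero by (simp add: f'_def lmon_nonzero)
  have "dot (wt D) k \<ge> kappa D + 1" if D: "D \<in> bdry" for D
  proof -
    interpret boundary M D "unif D"
      by (rule bdry_boundary[OF D])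
    obtain l where l: "dot (wt D) l = 1"
      using wt_surj[OF D] .
    obtain j e where j: "h / gen D = lmon j * e" "e \<in> unit_set D" "dot (wt D) j = - kappa D"
      using boundary_trivialization[OF D] .
    have "f / gen D \<in> canonical D"
      using f(1) D unfolding adjoint_sections by (simp add: bdry_def)
    then have "f / gen D / lmon (l - (1, 1)) \<in> D"
      unfolding canonical_bdry[OF D l] mem_image_mult_iff[OF lmon_nonzero] .
    moreover have "f / gen D / lmon (l - (1, 1)) = f' / lmon (l - j) * e"
    proof -
      have "f / gen D / lmon (l - (1, 1)) = f' * (h / gen D) / lmon l"
        by (simp add: f_eq lmon_diff lmon_nonzero)
      then show ?thesis
        unfolding j(1) by (simp add: lmon_diff)
    qed
    ultimately have "f' / lmon (l - j) * e * inverse e \<in> D"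
      using unit_setD(2)[OF j(2)] subring_mult[OF D_subring] by metis
    moreover have "y * e * inverse e = y" for y
      using unit_setD(3)[OF j(2)] by (simp add: field_simps)
    ultimately have "laurent_sum S c / lmon (l - j) \<in> D"
      unfolding S(3) by metis
    then have "laurent_sum ((\<lambda>k. k - (l - j)) ` S) (\<lambda>k. c (k + (l - j))) \<in> D"
      by (simp only: laurent_sum_shift)
    from lmon_component_mem[OF D_point this, of "k - (l - j)"] have "lmon (k - (l - j)) \<in> D"
      using S k by simp
    then show ?thesis
      using j(3) l by (simp add: lmon_mem_iff dot_diff wt_def)
  qed
  then have "interior_point k"
    by (simp add: interior_point_def)
  then show ?thesis
    by (rule that)
qed

text \<open>Two interior points give sections whose quotient is a monomial; in a space of dimension
  one that quotient is constant, so the points agree.\<close>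

lemma unique_interior_point:
  assumes dim: "dim_over_complex (global_sections M (tensor L (dualizing_sheaf M))) = 1"
  obtains m where "interior_point m" "\<And>k. interior_point k \<Longrightarrow> k = m"
proof -
  obtain b where b: "b \<in> global_sections M (tensor L (dualizing_sheaf M))" "b \<noteq> 0"
    "\<And>v. v \<in> global_sections M (tensor L (dualizing_sheaf M)) \<Longrightarrow> \<exists>c. v = const c * b"
    using dim_over_complex_eq_1[OF dim] by metis
  obtain m where m: "interior_point m"
    using adjoint_section_interior_point[OF b(1,2)] .
  moreover have "k = m" if k: "interior_point k" for k
  proof -
    obtain \<alpha> \<beta> where \<alpha>\<beta>: "h * lmon (k - (1, 1)) = const \<alpha> * b" "h * lmon (m - (1, 1)) = const \<beta> * b"
      using b(3) adjoint_monomial k m by metis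
    have "lmon (k - m) = (h * lmon (k - (1, 1))) / (h * lmon (m - (1, 1)))"
      using h_nonzero by (simp add: lmon_diff lmon_nonzero)
    also have "\<dots> = const (\<alpha> / \<beta>)"
      unfolding \<alpha>\<beta> using b(2) by (simp add: const_divide)
    finally show ?thesis
      using lmon_eq_const[of "k - m"] by simp
  qed
  ultimately show ?thesis
    using that by blast
qed

text \<open>If the lattice distance to the edge were two or more, the two lattice points on the edge
  and \<open>second_interior_point\<close> would yield another interior point.\<close>

lemma reflexive:
  assumes m: "interior_point m" and unique: "\<And>k. interior_point k \<Longrightarrow> k = m" and D: "D \<in> bdry"
  shows "dot (wt D) m = kappa D + 1"
proof (rule ccontr)
  assume "dot (wt D) m \<noteq> kappa D + 1"
  then have far: "dot (wt D) m \<ge> kappa D + 2"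
    using m D by (force simp: interior_point_def)
  interpret boundary M D "unif D"
    by (rule bdry_boundary[OF D])
  obtain p q where pq: "is_section 1 (h * lmon p)" "is_section 1 (h * lmon q)"
    "dot (wt D) p = kappa D" "dot (wt D) q = kappa D" "p \<noteq> q"
    using edge_vertices[OF D] .
  have "dot weight (q - p) = 0"
    using pq by (simp add: dot_diff wt_def)
  then obtain n where n: "q - p = scale n edge"
    by (rule dot_zero_multiple)
  have "n \<noteq> 0"
    using n pq(5) by (auto simp: scale_def zero_prod_def[symmetric])
  have edge: "edge = (- snd (wt D), fst (wt D))"
    by (simp add: edge_def wt_def)
  obtain l where l: "dot (wt D) l = 1"
    using wt_surj[OF D] .
  have "dot (wt D') p \<ge> kappa D'" "dot (wt D') q \<ge> kappa D'" if "D' \<in> bdry" for D'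
    using pq(1,2) monomial_section_iff[of 1 p] monomial_section_iff[of 1 q] that by simp_all
  then have "\<exists>x. x \<noteq> m \<and> (\<forall>i\<in>bdry. dot (wt i) x \<ge> kappa i + 1)"
    using m far pq(3,4) n edge \<open>n \<noteq> 0\<close> l
    by (intro second_interior_point[where p = p and q = q and j = D and n = n and l = l])
      (simp_all add: interior_point_def)
  then show False
    using unique by (auto simp: interior_point_def)
qed

text \<open>A single function \<open>f\<close> turns a generator \<open>g\<close> of
  \<open>L\<close> into the generator \<open>f / g\<close> of the dualizing sheaf and
  \<open>g / f\<close> of its dual. The dual is thus a rescaled copy of \<open>L\<close> and
  inherits ampleness.\<close>

lemma fano:
  assumes dim: "dim_over_complex (global_sections M (tensor L (dualizing_sheaf M))) = 1"
  shows "gorenstein M" "Defs.ample M (dual (dualizing_sheaf M))"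
proof -
  obtain m where m: "interior_point m" "\<And>k. interior_point k \<Longrightarrow> k = m"
    by (rule unique_interior_point[OF dim]) (rule that)
  define f where "f = h * lmon (m - (1, 1))"
  have f: "f \<noteq> 0"
    using h_nonzero by (simp add: f_def lmon_nonzero)
  have canonical: "canonical D = (*) (f / gen D) ` D" if D: "codim_one_point M D" for D
  proof (cases "torus_divisor D")
    case True
    have "h / gen D * lmon (m - (1, 1)) \<in> unit_set D"
      by (rule unit_set_mult[OF torus_divisorD(2)[OF True] torus_divisor_units(2)[OF True] torus_divisor_units(1)[OF True]])
    then have "f / gen D \<in> unit_set D"
      by (simp add: f_def)
    then show ?thesis
      using image_mult_unit[OF torus_divisorD(2)[OF True], of "f / gen D" 1] by (simp add: canonical_torus[OF True])
  next
    case False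
    then have Db: "D \<in> bdry"
      using D by (simp add: bdry_def)
    interpret boundary M D "unif D"
      by (rule bdry_boundary[OF Db])
    obtain l where l: "dot (wt D) l = 1"
      using wt_surj[OF Db] .
    have "dval D (unif D) (f / gen D) = dot (wt D) (m - (1, 1)) - kappa D"
      using dval_section[OF Db, of 1 "m - (1, 1)"] by (simp add: f_def)
    also have "\<dots> = dot (wt D) (l - (1, 1))"
      using reflexive[OF m Db] l by (simp add: dot_diff)
    also have "\<dots> = dval D (unif D) (lmon (l - (1, 1)))"
      by (simp add: dval_lmon wt_def)
    finally have "(*) (f / gen D) ` D = (*) (lmon (l - (1, 1))) ` D"
      using dvr_image_eq_iff[OF dvr, of "f / gen D" "lmon (l - (1, 1))"] f gen_nonzero[OF D_point]
      by (simp add: lmon_nonzero)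
    then show ?thesis
      by (simp add: canonical_bdry[OF Db l])
  qed
  \<comment> \<open>Both sides are determined in codimension one, the dualizing sheaf by definition
    and the principal module by \<open>hartogs\<close>.\<close>
  have omega: "dualizing_sheaf M p = (*) (f / gen p) ` p" if p: "p \<in> M" for p
  proof -
    have "x \<in> dualizing_sheaf M p \<longleftrightarrow> x * gen p / f \<in> p" for x
    proof -
      have "x \<in> canonical D \<longleftrightarrow> x * gen p / f \<in> D" if D: "codim_one_point M D" "p \<subseteq> D" for D
      proof -
        note DM = codim_one_point_mem[OF D(1)]
        have sD: "is_subring D"
          by (rule point_subring[OF DM])
        have e: "gen D / gen p \<in> unit_set D"
          by (rule gen_unit[OF p DM D(2)])
        have "f / gen D \<noteq> 0"
          using f gen_nonzero[OF DM] by simp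
        then have "x \<in> canonical D \<longleftrightarrow> x * gen D / f \<in> D"
          unfolding canonical[OF D(1)] by (subst mem_image_mult_iff) simp_all
        moreover have "x * gen D / f = (x * gen p / f) * (gen D / gen p)"
          "x * gen p / f = (x * gen D / f) * inverse (gen D / gen p)"
          using gen_nonzero[OF DM] gen_nonzero[OF p] by simp_all
        ultimately show ?thesis
          using subring_mult[OF sD] unit_setD(1,2)[OF e] by metis
      qed
      then have "x \<in> dualizing_sheaf M p \<longleftrightarrow> (\<forall>D. codim_one_point M D \<and> p \<subseteq> D \<longrightarrow> x * gen p / f \<in> D)"
        by (auto simp: dualizing_sheaf_iff)
      also have "\<dots> \<longleftrightarrow> x * gen p / f \<in> p"
        using hartogs[OF p, of "x * gen p / f"] by blast
      finally show ?thesis .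
    qed
    moreover have "f / gen p \<noteq> 0"
      using f gen_nonzero[OF p] by simp
    ultimately have "x \<in> dualizing_sheaf M p \<longleftrightarrow> x \<in> (*) (f / gen p) ` p" for x
      using mem_image_mult_iff[of "f / gen p" x p] by simp
    then show ?thesis
      by blast
  qed
  have dual: "dual (dualizing_sheaf M) p = (*) (gen p / f) ` p" if p: "p \<in> M" for p
  proof -
    have sp: "is_subring p"
      by (rule point_subring[OF p])
    have "x \<in> dual (dualizing_sheaf M) p \<longleftrightarrow> x * (f / gen p) \<in> p" for x
    proof
      assume "x \<in> dual (dualizing_sheaf M) p"
      then have "x * (f / gen p * 1) \<in> p"
        unfolding dual_def omega[OF p] using subring_one[OF sp] by blast
      then show "x * (f / gen p) \<in> p"
        by simp
    next
      assume x: "x * (f / gen p) \<in> p"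
      have "x * (f / gen p * r) \<in> p" if "r \<in> p" for r
        using subring_mult[OF sp x that] by (simp only: mult.assoc)
      then show "x \<in> dual (dualizing_sheaf M) p"
        unfolding dual_def omega[OF p] by blast
    qed
    moreover have "gen p / f \<noteq> 0"
      using f gen_nonzero[OF p] by simp
    ultimately have "x \<in> dual (dualizing_sheaf M) p \<longleftrightarrow> x \<in> (*) (gen p / f) ` p" for x
      using mem_image_mult_iff[of "gen p / f" x p] by simp
    then show ?thesis
      by blast
  qed
  \<comment> \<open>\<open>gen p\<close> is only known to generate at the generizations of
    \<open>p\<close>; a neighbourhood comes from a local trivialization \<open>g\<close> of
    \<open>L\<close>.\<close>
  have transfer: "\<exists>U g. openin (zariski M) U \<and> p \<in> U \<and> g \<noteq> 0 \<and>
      (\<forall>q\<in>U. dualizing_sheaf M q = (*) (f / g) ` q \<and> dual (dualizing_sheaf M) q = (*) (g / f) ` q)"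
    if p: "p \<in> M" for p
  proof -
    obtain U g where U: "openin (zariski M) U" "p \<in> U" "g \<noteq> 0" "\<And>q. q \<in> U \<Longrightarrow> L q = (*) g ` q"
      using line_bundle p unfolding line_bundle_def by metis
    have "dualizing_sheaf M q = (*) (f / g) ` q \<and> dual (dualizing_sheaf M) q = (*) (g / f) ` q" if "q \<in> U" for q
    proof -
      have q: "q \<in> M"
        using zariski_neighbourhood[OF U(1) that] by blast
      have sq: "is_subring q"
        by (rule point_subring[OF q])
      have "g / gen q \<in> unit_set q"
        using image_mult_eq_iff[OF sq gen_nonzero[OF q] U(3)] gen_eq[OF q q] U(4)[OF that] by simp
      then show ?thesis
        using image_mult_eq_iff[OF sq, of "f / g" "f / gen q"] image_mult_eq_iff[OF sq, of "gen q / f" "g / f"]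
          f U(3) gen_nonzero[OF q] by (simp add: omega[OF q] dual[OF q])
    qed
    then show ?thesis
      using U(1-3) by (intro exI[of _ U] exI[of _ g]) simp
  qed
  show "gorenstein M"
    unfolding gorenstein_def line_bundle_def
  proof
    fix p assume "p \<in> M"
    from transfer[OF this] obtain U g where "openin (zariski M) U" "p \<in> U" "g \<noteq> 0"
      "\<forall>q\<in>U. dualizing_sheaf M q = (*) (f / g) ` q \<and> dual (dualizing_sheaf M) q = (*) (g / f) ` q"
      by (elim exE conjE) (rule that)
    then show "\<exists>U g. openin (zariski M) U \<and> p \<in> U \<and> g \<noteq> 0 \<and> (\<forall>q\<in>U. dualizing_sheaf M q = (*) g ` q)"
      using f by (intro exI[of _ U] exI[of _ "f / g"]) simp
  qed
  have power: "tensor_power (dual (dualizing_sheaf M)) n p = (*) ((gen p / f) ^ n) ` p" if "p \<in> M" for n p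
    using tensor_power_principal[where F = "dual (dualizing_sheaf M)" and p = p and a = "gen p / f"]
      point_subring[OF that] dual[OF that] by blast
  show "Defs.ample M (dual (dualizing_sheaf M))"
    unfolding ample_def
  proof (intro conjI ballI)
    show "Defs.line_bundle M (dual (dualizing_sheaf M))"
      unfolding line_bundle_def
    proof
      fix p assume "p \<in> M"
      from transfer[OF this] obtain U g where "openin (zariski M) U" "p \<in> U" "g \<noteq> 0"
        "\<forall>q\<in>U. dualizing_sheaf M q = (*) (f / g) ` q \<and> dual (dualizing_sheaf M) q = (*) (g / f) ` q"
        by (elim exE conjE) (rule that)
      then show "\<exists>U g. openin (zariski M) U \<and> p \<in> U \<and> g \<noteq> 0 \<and> (\<forall>q\<in>U. dual (dualizing_sheaf M) q = (*) g ` q)"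
        using f by (intro exI[of _ U] exI[of _ "g / f"]) simp
    qed
    fix p assume p: "p \<in> M"
    obtain n s A where s: "n \<ge> 1" "is_section n s" "s / gen p ^ n \<in> unit_set p"
      "\<And>q. q \<in> affine_model A \<longleftrightarrow> q \<in> M \<and> s / gen q ^ n \<in> unit_set q"
      by (rule ample_section[OF p]) (rule that)
    \<comment> \<open>Division by \<open>f ^ n\<close> matches sections of the \<open>n\<close>-th
      powers and leaves their quotients by the generators unchanged, so the affine locus is the
      same.\<close>
    define s' where "s' = s / f ^ n"
    have quot: "s' / (gen q / f) ^ n = s / gen q ^ n" for q
      using f by (simp add: s'_def power_divide)
    have locus: "nonvanishing_locus M (tensor_power (dual (dualizing_sheaf M)) n) s' = affine_model A"
    proof -
      have "s \<noteq> 0"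
        using s(3) by (auto simp: unit_set_def)
      then have "s' \<noteq> 0"
        using f by (simp add: s'_def)
      have "(*) ((gen q / f) ^ n) ` q = (*) s' ` q \<longleftrightarrow> s / gen q ^ n \<in> unit_set q" if q: "q \<in> M" for q
        using image_mult_eq_iff[OF point_subring[OF q], of "(gen q / f) ^ n" s'] f gen_nonzero[OF q] \<open>s' \<noteq> 0\<close>
        by (simp add: quot)
      then have "q \<in> nonvanishing_locus M (tensor_power (dual (dualizing_sheaf M)) n) s' \<longleftrightarrow> q \<in> affine_model A" for q
        using s(4)[of q] power[of q n] by (cases "q \<in> M") (simp_all add: nonvanishing_locus_def)
      then show ?thesis
        by blast
    qed
    have "s' \<in> global_sections M (tensor_power (dual (dualizing_sheaf M)) n)"
      unfolding global_sections_def
    proof (intro CollectI ballI)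
      fix q assume q: "q \<in> M"
      have "s / gen q ^ n \<in> q"
        using s(2) q by (simp add: is_section_def)
      then show "s' \<in> tensor_power (dual (dualizing_sheaf M)) n q"
        using power[OF q, of n] f gen_nonzero[OF q] quot[of q] by (simp add: mem_image_mult_iff)
    qed
    then show "\<exists>n\<ge>1. \<exists>s\<in>global_sections M (tensor_power (dual (dualizing_sheaf M)) n).
      p \<in> nonvanishing_locus M (tensor_power (dual (dualizing_sheaf M)) n) s \<and>
      (\<exists>A. nonvanishing_locus M (tensor_power (dual (dualizing_sheaf M)) n) s = affine_model A)"
      using s(1,3,4) p locus by (intro exI[of _ n] conjI bexI[of _ s']) auto
  qed
qed

end

theorem theorem1:
  fixes X :: "ratfun set set"
  assumes "toric_surface X" and "projective_model X"
    and "\<exists>L. ample X L \<and>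
      dim_over_complex (global_sections X (tensor L (dualizing_sheaf X))) = 1"
  shows "gorenstein_toric_fano_surface X"
proof -
  obtain L where L: "ample X L" "dim_over_complex (global_sections X (tensor L (dualizing_sheaf X))) = 1"
    using assms(3) by blast
  interpret toric_model X
    using assms(1) by unfold_locales (auto simp: toric_surface_def)
  obtain h where h: "h \<noteq> 0" "\<And>D. torus_divisor D \<Longrightarrow> L D = (*) h ` D"
    using trivialization_on_torus[of L] L(1) by (metis ample_def)
  interpret polarized X L h
    using assms(2) L(1) h by unfold_locales
  show ?thesis
    using fano[OF L(2)] assms(1,2) by (simp add: gorenstein_toric_fano_surface_def)
qed

end
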